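(* Let $(\Omega,\sigma)$ be a minimal continuous flow on a compact metric space, let $a,b:\Omega\to\mathbb{R}$ be continuous, and let $g:\Omega\times\mathbb{R}\to\mathbb{R}$ be such that the partial derivative $g_x$ exists, $g$ and $g_x$ are continuous on $\Omega\times\mathbb{R}$, and $\lim_{x\to\pm\infty}g(\omega,x)/x=-\infty$ uniformly on $\Omega$. Let $(\Omega\times\mathbb{R},\tau)$ be the flow induced by the family $x'=a(\omega\cdot t)\,x+b(\omega\cdot t)+g(\omega\cdot t,x)$, $\omega\in\Omega$. Then the following assertions are equivalent: (1) Any $\tau$-minimal set has strictly negative upper Lyapunov exponent. (2) There exists a unique $\tau$-minimal set, and its upper Lyapunov exponent is strictly negative. Assume that this is the case, let $\mathcal{A}=\bigcup_{\omega\in\Omega}\big(\{\omega\}\times[\alpha_{\mathcal{A}}(\omega),\beta_{\mathcal{A}}(\omega)]\big)$ be the global attractor, and let $\mathcal{M}^\alpha$ and $\mathcal{M}^\beta$ be the $\tau$-minimal sets associated with $\alpha_{\mathcal{A}}$ and $\beta_{\mathcal{A}}$ (defined in the context). Then the attractor $\mathcal{A}$ is given by the unique $\tau$-minimal set $\mathcal{M}^\alpha=\mathcal{M}^\beta=\{\alpha_{\mathcal{A}}\}=\{\beta_{\mathcal{A}}\}$, and it attracts exponentially any $\tau$-orbit as time increases.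
   Context: Write $\omega\cdot t:=\sigma(t,\omega)$. The induced (local) flow is $\tau(t,\omega,x_0)=(\omega\cdot t,x(t,\omega,x_0))$, where $x(t,\omega,x_0)$ is the maximal solution of the equation corresponding to $\omega$ with $x(0,\omega,x_0)=x_0$. A set is $\tau$-invariant if it is composed of globally defined orbits and is mapped onto itself by $\tau_t$ for all $t\in\mathbb{R}$. A $\tau$-minimal set is a nonempty compact $\tau$-invariant set with no proper nonempty compact $\tau$-invariant subset ($(\Omega,\sigma)$ minimal: $\Omega$ itself is minimal for $\sigma$). The upper Lyapunov exponent of a $\tau$-minimal set $\mathcal{M}$ is $\gamma^s_{\mathcal{M}}:=\sup\int_{\mathcal{M}}\big(a(\omega)+g_x(\omega,x)\big)\,d\nu$, the supremum being over all $\tau$-invariant Borel probability measures $\nu$ on $\mathcal{M}$. Background: under the stated conditions all forward semiorbits are globally defined and bounded, and $\tau$ has a global attractor $\mathcal{A}$, i.e. a compact $\tau$-invariant set with $\lim_{t\to\infty}\mathrm{dist}(\tau_t(\mathcal{C}),\mathcal{A})=0$ (Hausdorff semidistance) for every bounded $\mathcal{C}$; it has the displayed form, with $\alpha_{\mathcal{A}}$ lower semicontinuous and $\beta_{\mathcal{A}}$ upper semicontinuous, both $\tau$-equilibria ($\alpha(\omega\cdot t)=x(t,\omega,\alpha(\omega))$ for all $t,\omega$). Let $\Omega_c$ be the (residual) set of common continuity points of $\alpha_{\mathcal{A}},\beta_{\mathcal{A}}$. For any $\omega_0\in\Omega_c$, $\mathcal{M}^\alpha$ and $\mathcal{M}^\beta$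 are the closures in $\Omega\times\mathbb{R}$ of $\{(\omega_0\cdot t,\alpha_{\mathcal{A}}(\omega_0\cdot t)) : t\in\mathbb{R}\}$ and $\{(\omega_0\cdot t,\beta_{\mathcal{A}}(\omega_0\cdot t)) : t\in\mathbb{R}\}$; they are $\tau$-minimal and independent of the choice of $\omega_0$. $\{\eta\}$ denotes the graph of a continuous $\tau$-equilibrium $\eta:\Omega\to\mathbb{R}$ (so the conclusion includes the continuity of $\alpha_{\mathcal{A}}=\beta_{\mathcal{A}}$). If $\mathcal{A}=\{\eta\}$, "it attracts exponentially any $\tau$-orbit as time increases" means: for every $(\omega,x_0)\in\Omega\times\mathbb{R}$ there are $C,\gamma>0$ with $|x(t,\omega,x_0)-\eta(\omega\cdot t)|\le C e^{-\gamma t}$ for all $t\ge0$. *)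

theory Defs
  imports "HOL-Probability.Probability"
begin

text \<open>
  The base space is a compact subset \<open>W\<close> of a metric space; the base flow is \<open>\<sigma> t w\<close>.
  The right-hand side of the scalar equation for \<open>w\<close> is \<open>f (\<sigma> t w) x\<close>.
\<close>

definition continuous_flow :: "'w::metric_space set \<Rightarrow> (real \<Rightarrow> 'w \<Rightarrow> 'w) \<Rightarrow> bool" where
  "continuous_flow W \<sigma> \<longleftrightarrow>
     (\<forall>t. \<forall>w\<in>W. \<sigma> t w \<in> W) \<and>
     (\<forall>w\<in>W. \<sigma> 0 w = w) \<and>
     (\<forall>s t. \<forall>w\<in>W. \<sigma> (s + t) w = \<sigma> s (\<sigma> t w)) \<and>
     continuous_on (UNIV \<times> W) (\<lambda>(t, w). \<sigma> t w)"

definition minimal_flow :: "'w::metric_space set \<Rightarrow> (real \<Rightarrow> 'w \<Rightarrow> 'w) \<Rightarrow> bool" where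
  "minimal_flow W \<sigma> \<longleftrightarrow>
     W \<noteq> {} \<and> compact W \<and> (\<forall>t. \<sigma> t ` W = W) \<and>
     (\<forall>S. S \<subseteq> W \<and> S \<noteq> {} \<and> compact S \<and> (\<forall>t. \<sigma> t ` S = S) \<longrightarrow> S = W)"

definition equation_rhs ::
  "('w \<Rightarrow> real) \<Rightarrow> ('w \<Rightarrow> real) \<Rightarrow> ('w \<Rightarrow> real \<Rightarrow> real) \<Rightarrow> 'w \<Rightarrow> real \<Rightarrow> real" where
  "equation_rhs a b g w x = a w * x + b w + g w x"

definition is_solution ::
  "(real \<Rightarrow> 'w \<Rightarrow> 'w) \<Rightarrow> ('w \<Rightarrow> real \<Rightarrow> real) \<Rightarrow> 'w \<Rightarrow> real \<Rightarrow> real set \<Rightarrow> (real \<Rightarrow> real) \<Rightarrow> bool" where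
  "is_solution \<sigma> f w x0 I u \<longleftrightarrow>
     open I \<and> is_interval I \<and> 0 \<in> I \<and> u 0 = x0 \<and>
     (\<forall>t\<in>I. (u has_real_derivative f (\<sigma> t w) (u t)) (at t))"

text \<open>
  Domain and values of the maximal solution, obtained by gluing all solutions of the initial
  value problem. The value is unambiguous when solutions are unique (here \<open>f\<close> is \<open>C\<^sup>1\<close> in \<open>x\<close>),
  and meaningless outside the domain.
\<close>

definition sol_dom ::
  "(real \<Rightarrow> 'w \<Rightarrow> 'w) \<Rightarrow> ('w \<Rightarrow> real \<Rightarrow> real) \<Rightarrow> 'w \<Rightarrow> real \<Rightarrow> real set" where
  "sol_dom \<sigma> f w x0 = \<Union>{I. \<exists>u. is_solution \<sigma> f w x0 I u}"

definition sol ::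
  "(real \<Rightarrow> 'w \<Rightarrow> 'w) \<Rightarrow> ('w \<Rightarrow> real \<Rightarrow> real) \<Rightarrow> real \<Rightarrow> 'w \<Rightarrow> real \<Rightarrow> real" where
  "sol \<sigma> f t w x0 = (THE y. \<exists>I u. is_solution \<sigma> f w x0 I u \<and> t \<in> I \<and> y = u t)"

definition skew_flow ::
  "(real \<Rightarrow> 'w \<Rightarrow> 'w) \<Rightarrow> ('w \<Rightarrow> real \<Rightarrow> real) \<Rightarrow> real \<Rightarrow> 'w \<times> real \<Rightarrow> 'w \<times> real" where
  "skew_flow \<sigma> f t = (\<lambda>(w, x0). (\<sigma> t w, sol \<sigma> f t w x0))"

definition skew_invariant ::
  "'w set \<Rightarrow> (real \<Rightarrow> 'w \<Rightarrow> 'w) \<Rightarrow> ('w \<Rightarrow> real \<Rightarrow> real) \<Rightarrow> ('w \<times> real) set \<Rightarrow> bool" where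
  "skew_invariant W \<sigma> f S \<longleftrightarrow>
     S \<subseteq> W \<times> UNIV \<and> (\<forall>(w, x)\<in>S. sol_dom \<sigma> f w x = UNIV) \<and>
     (\<forall>t. skew_flow \<sigma> f t ` S = S)"

definition skew_minimal ::
  "'w::metric_space set \<Rightarrow> (real \<Rightarrow> 'w \<Rightarrow> 'w) \<Rightarrow> ('w \<Rightarrow> real \<Rightarrow> real) \<Rightarrow> ('w \<times> real) set \<Rightarrow> bool" where
  "skew_minimal W \<sigma> f M \<longleftrightarrow>
     M \<noteq> {} \<and> compact M \<and> skew_invariant W \<sigma> f M \<and>
     (\<forall>S. S \<subseteq> M \<and> S \<noteq> {} \<and> compact S \<and> skew_invariant W \<sigma> f S \<longrightarrow> S = M)"

definition invariant_measures ::
  "(real \<Rightarrow> 'w \<Rightarrow> 'w) \<Rightarrow> ('w \<Rightarrow> real \<Rightarrow> real) \<Rightarrow> ('w::metric_space \<times> real) set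
     \<Rightarrow> ('w \<times> real) measure set" where
  "invariant_measures \<sigma> f M =
     {\<nu>. prob_space \<nu> \<and> sets \<nu> = sets (restrict_space borel M) \<and>
         (\<forall>t. skew_flow \<sigma> f t \<in> measurable \<nu> \<nu> \<and> distr \<nu> \<nu> (skew_flow \<sigma> f t) = \<nu>)}"

text \<open>
  The supremum is taken in \<open>\<real>\<close>: for compact invariant nonempty \<open>M\<close> and continuous \<open>a\<close>, \<open>gx\<close> the
  set of integrals is bounded, and it is nonempty by the Krylov-Bogoliubov theorem.
\<close>

definition upper_lyapunov ::
  "(real \<Rightarrow> 'w \<Rightarrow> 'w) \<Rightarrow> ('w \<Rightarrow> real \<Rightarrow> real) \<Rightarrow> ('w \<Rightarrow> real) \<Rightarrow> ('w \<Rightarrow> real \<Rightarrow> real)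
     \<Rightarrow> ('w::metric_space \<times> real) set \<Rightarrow> real" where
  "upper_lyapunov \<sigma> f a gx M =
     (SUP \<nu>\<in>invariant_measures \<sigma> f M. \<integral>(w, x). a w + gx w x \<partial>\<nu>)"

text \<open>
  Hausdorff semidistance; with values in \<open>[0,\<infinity>]\<close> it is \<open>0\<close> for empty \<open>X\<close> and
  \<open>\<infinity>\<close> for empty \<open>Y\<close> and nonempty \<open>X\<close>.
\<close>

definition hausdorff_semidist :: "'z::metric_space set \<Rightarrow> 'z set \<Rightarrow> ennreal" where
  "hausdorff_semidist X Y = (SUP p\<in>X. INF q\<in>Y. ennreal (dist p q))"

definition global_attractor ::
  "'w::metric_space set \<Rightarrow> (real \<Rightarrow> 'w \<Rightarrow> 'w) \<Rightarrow> ('w \<Rightarrow> real \<Rightarrow> real) \<Rightarrow> ('w \<times> real) set \<Rightarrow> bool" where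
  "global_attractor W \<sigma> f A \<longleftrightarrow>
     compact A \<and> skew_invariant W \<sigma> f A \<and>
     (\<forall>w\<in>W. \<forall>x. {0..} \<subseteq> sol_dom \<sigma> f w x) \<and>
     (\<forall>C. C \<subseteq> W \<times> UNIV \<and> bounded C \<longrightarrow>
        ((\<lambda>t. hausdorff_semidist (skew_flow \<sigma> f t ` C) A) \<longlongrightarrow> 0) at_top)"

definition attractor_with_bounds ::
  "'w::metric_space set \<Rightarrow> (real \<Rightarrow> 'w \<Rightarrow> 'w) \<Rightarrow> ('w \<Rightarrow> real \<Rightarrow> real) \<Rightarrow> ('w \<times> real) set
     \<Rightarrow> ('w \<Rightarrow> real) \<Rightarrow> ('w \<Rightarrow> real) \<Rightarrow> bool" where
  "attractor_with_bounds W \<sigma> f A \<alpha> \<beta> \<longleftrightarrow>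
     global_attractor W \<sigma> f A \<and> (\<forall>w\<in>W. \<alpha> w \<le> \<beta> w) \<and>
     A = (\<Union>w\<in>W. {w} \<times> {\<alpha> w..\<beta> w})"

definition common_continuity_points ::
  "'w::metric_space set \<Rightarrow> ('w \<Rightarrow> real) \<Rightarrow> ('w \<Rightarrow> real) \<Rightarrow> 'w set" where
  "common_continuity_points W \<alpha> \<beta> =
     {w\<in>W. continuous (at w within W) \<alpha> \<and> continuous (at w within W) \<beta>}"

text \<open>
  \<open>orbit_closure \<sigma> \<alpha> w0\<close> and \<open>orbit_closure \<sigma> \<beta> w0\<close>, for \<open>w0\<close> a common continuity point
  of \<open>\<alpha>\<close> and \<open>\<beta>\<close>, are the minimal sets associated with the two bounds of the attractor.
  As \<open>W\<close> is closed, the closure in the ambient space is the closure in \<open>W \<times> \<real>\<close>.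
\<close>

definition orbit_closure ::
  "(real \<Rightarrow> 'w \<Rightarrow> 'w) \<Rightarrow> ('w::metric_space \<Rightarrow> real) \<Rightarrow> 'w \<Rightarrow> ('w \<times> real) set" where
  "orbit_closure \<sigma> \<eta> w0 = closure (range (\<lambda>t. (\<sigma> t w0, \<eta> (\<sigma> t w0))))"

definition equilibrium ::
  "'w set \<Rightarrow> (real \<Rightarrow> 'w \<Rightarrow> 'w) \<Rightarrow> ('w \<Rightarrow> real \<Rightarrow> real) \<Rightarrow> ('w \<Rightarrow> real) \<Rightarrow> bool" where
  "equilibrium W \<sigma> f \<eta> \<longleftrightarrow>
     (\<forall>w\<in>W. \<forall>t. t \<in> sol_dom \<sigma> f w (\<eta> w) \<and> \<eta> (\<sigma> t w) = sol \<sigma> f t w (\<eta> w))"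

definition graph_over :: "'w set \<Rightarrow> ('w \<Rightarrow> real) \<Rightarrow> ('w \<times> real) set" where
  "graph_over W \<eta> = (\<lambda>w. (w, \<eta> w)) ` W"

definition attracts_exponentially ::
  "'w set \<Rightarrow> (real \<Rightarrow> 'w \<Rightarrow> 'w) \<Rightarrow> ('w \<Rightarrow> real \<Rightarrow> real) \<Rightarrow> ('w \<Rightarrow> real) \<Rightarrow> bool" where
  "attracts_exponentially W \<sigma> f \<eta> \<longleftrightarrow>
     (\<forall>w\<in>W. \<forall>x0. \<exists>C>0. \<exists>\<gamma>>0. \<forall>t\<ge>0.
        t \<in> sol_dom \<sigma> f w x0 \<and> \<bar>sol \<sigma> f t w x0 - \<eta> (\<sigma> t w)\<bar> \<le> C * exp (- \<gamma> * t))"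

end

theory Submission imports Defs begin

text \<open>Write \<open>q = a + g\<^sub>x\<close> for the derivative of the right-hand side in \<open>x\<close>. The proof has four steps.

First, a negative upper Lyapunov exponent is turned into uniform contraction. If the averages of \<open>q\<close>
along orbits of a minimal set \<open>M\<close> were not eventually bounded by a negative number, the empirical
measures of long orbit pieces would accumulate at an invariant measure \<open>\<nu>\<close> with \<open>\<integral>q d\<nu>\<close> larger than
the exponent (\<open>krylov_bogoliubov_average\<close>, \<open>negative_exponent_bounds_growth\<close>). The weak compactness behind
this is reduced to Helly's theorem on the line: a compact metric space is coded by real numbers
with a Borel map whose inverse is uniformly continuous. A Gronwall estimate then shows that
solutions starting within some \<open>\<delta>\<close> of a point of \<open>M\<close> in the same fibre are attracted exponentially
to its orbit (\<open>exponential_tube\<close>).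

Second, \<open>M\<close> is the graph of a continuous function (\<open>minimal_is_graph\<close>). Two points of a common fibre
are at distance at least \<open>\<delta>\<close> in the remote past, since closer points would have merged. But the orbit
of a topmost point of a fibre consists of topmost points and is dense in \<open>M\<close>, so it comes
close to the lowest point of \<open>M\<close>; hence over some nonempty open subset of the base all fibres
have diameter less than \<open>\<delta> / 2\<close>. The backward base orbit visits that set again and again.

Third, there is only one minimal set (\<open>unique_exponentially_attracting_minimal_set\<close>). The limit set of
each forward orbit contains a minimal set, hence the orbit enters the tube around a minimal graph.
Over a fixed base point the initial values that enter the tube of a given minimal set form an open
set; for different minimal sets these sets are disjoint, and they cover a connected interval.
Compactness of the strip makes the entrance time, and with it the exponential rate, uniform.

Fourth, uniform attraction of bounded sets makes the graph a global attractor, and a compact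
invariant set, being the image of itself under the time-\<open>t\<close> maps, must lie in the graph.

Solutions of the equation may blow up backwards in time. The dynamical arguments therefore use the
equation with \<open>x\<close> clamped to an interval \<open>[-R, R]\<close>, which generates a global continuous flow; on
compact invariant sets and on forward orbits in the strip it agrees with the original one.\<close>

section \<open>Weak compactness of probability measures on a compact metric space\<close>

text \<open>The first nonzero digit dominates the tail: \<open>1 - (1/4) * (4/3) > 1/2\<close>. Base 4 leaves room for
digits in \<open>{-1, 0, 1}\<close>, that is, for differences of two expansions with digits 0 and 1.\<close>

lemma base4_expansion_separates:
  fixes c :: "nat \<Rightarrow> real"
  assumes c: "\<And>n. c n \<in> {-1, 0, 1}"
    and small: "\<bar>\<Sum>k. c k * (1/4)^k\<bar> < (1/4)^N / 2" and "n \<le> N"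
  shows "c n = 0"
proof (rule ccontr)
  assume "c n \<noteq> 0"
  define m where "m = (LEAST n. c n \<noteq> 0)"
  have cm: "c m \<noteq> 0" and below: "\<And>k. k < m \<Longrightarrow> c k = 0" and "m \<le> n"
    unfolding m_def using LeastI[of "\<lambda>n. c n \<noteq> 0", OF \<open>c n \<noteq> 0\<close>]
      Least_le[of "\<lambda>n. c n \<noteq> 0", OF \<open>c n \<noteq> 0\<close>] not_less_Least[of _ "\<lambda>n. c n \<noteq> 0"] by blast+
  have c1: "\<bar>c k\<bar> \<le> 1" for k using c[of k] by auto
  have geo: "summable (\<lambda>k. (1/4::real)^k)" "(\<Sum>k. (1/4::real)^k) = 4/3"
    using summable_geometric[of "1/4::real"] suminf_geometric[of "1/4::real"] by auto
  have bnd: "norm (c (k + j) * (1/4)^k) \<le> (1/4)^k" for k j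
    using c1[of "k+j"] by (simp add: abs_mult mult_left_le_one_le)
  have sumj: "summable (\<lambda>k. c (k + j) * (1/4)^k)" for j
    by (rule summable_comparison_test'[OF geo(1), of 0]) (use bnd in auto)
  have "(\<Sum>k. c k * (1/4)^k) = (\<Sum>k. c (k + m) * (1/4)^(k + m)) + (\<Sum>k<m. c k * (1/4)^k)"
    using suminf_split_initial_segment[OF sumj[of 0, simplified], of m] by simp
  also have "(\<Sum>k<m. c k * (1/4)^k) = 0" using below by simp
  also have "(\<Sum>k. c (k + m) * (1/4)^(k + m)) = (1/4)^m * (\<Sum>k. c (k + m) * (1/4)^k)"
    by (subst suminf_mult[OF sumj, symmetric]) (simp add: power_add mult_ac)
  also have "(\<Sum>k. c (k + m) * (1/4)^k) = c m + (\<Sum>k. c (Suc k + m) * (1/4)^(Suc k))"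
    using suminf_split_head[OF sumj[of m]] by simp
  also have "(\<Sum>k. c (Suc k + m) * (1/4)^(Suc k)) = (1/4) * (\<Sum>k. c (k + Suc m) * (1/4)^k)"
    by (subst suminf_mult[OF sumj, symmetric]) (simp add: mult_ac)
  finally have S: "(\<Sum>k. c k * (1/4)^k) = (1/4)^m * (c m + (1/4) * (\<Sum>k. c (k + Suc m) * (1/4)^k))"
    by simp
  have "\<bar>\<Sum>k. c (k + Suc m) * (1/4)^k\<bar> \<le> (\<Sum>k. (1/4::real)^k)"
    using norm_suminf_le[OF bnd[of _ "Suc m"] geo(1)] by simp
  then have t: "\<bar>\<Sum>k. c (k + Suc m) * (1/4)^k\<bar> \<le> 4/3" using geo by simp
  have "\<bar>c m\<bar> = 1" using cm c[of m] by auto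
  then have "\<bar>c m + (1/4) * (\<Sum>k. c (k + Suc m) * (1/4)^k)\<bar> \<ge> 1/2"
    using t by linarith
  then have "(1/4)^m * (1/2) \<le> \<bar>\<Sum>k. c k * (1/4)^k\<bar>"
    unfolding S abs_mult by (simp add: mult_left_mono)
  moreover have "(1/4::real)^N \<le> (1/4)^m"
    using \<open>m \<le> n\<close> \<open>n \<le> N\<close> by (intro power_decreasing) auto
  ultimately show False using small by simp
qed

text \<open>The sequence runs through finite covers of \<open>M\<close> by balls of radius \<open>1, 1/2, 1/3, \<dots>\<close>.\<close>

lemma compact_fine_balls:
  fixes M :: "'a::metric_space set"
  assumes "compact M" "M \<noteq> {}"
  obtains B :: "nat \<Rightarrow> 'a set" where "\<And>n. open (B n)"
    "\<And>\<epsilon>. \<epsilon> > 0 \<Longrightarrow> \<exists>N. \<forall>m\<in>M. \<exists>n\<le>N. m \<in> B n \<and> (\<forall>y\<in>B n. dist m y < \<epsilon>)"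
proof -
  have "\<exists>T. finite T \<and> T \<subseteq> M \<and> M \<subseteq> (\<Union>x\<in>T. ball x (1 / real (Suc j)))" for j
    by (rule compactE_image[OF \<open>compact M\<close>, of M "\<lambda>x. ball x (1 / real (Suc j))"]) auto
  then obtain T where T: "\<And>j. finite (T j)" "\<And>j. M \<subseteq> (\<Union>x\<in>T j. ball x (1 / real (Suc j)))"
    by metis
  define \<B> where "\<B> = (\<Union>j. (\<lambda>x. ball x (1 / real (Suc j))) ` T j)"
  have cB: "countable \<B>" unfolding \<B>_def using T(1) by (intro countable_UN) (auto intro: countable_finite)
  have "T 0 \<noteq> {}" using T(2)[of 0] \<open>M \<noteq> {}\<close> by auto
  then have neB: "\<B> \<noteq> {}" unfolding \<B>_def by auto
  define B where "B = from_nat_into \<B>"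
  have rB: "range B = \<B>" unfolding B_def using range_from_nat_into[OF neB cB] .
  show ?thesis
  proof (rule that[of B])
    show "open (B n)" for n
    proof -
      have "B n \<in> \<B>" using rB by auto
      then show ?thesis unfolding \<B>_def by auto
    qed
    fix \<epsilon> :: real assume "\<epsilon> > 0"
    obtain j where j: "2 / real (Suc j) < \<epsilon>"
    proof -
      obtain j where "inverse (real (Suc j)) < \<epsilon>/2" using reals_Archimedean[of "\<epsilon>/2"] \<open>\<epsilon>>0\<close> by auto
      then show ?thesis using that[of j] by (simp add: field_simps)
    qed
    have "\<exists>n. B n = ball x (1 / real (Suc j))" if "x \<in> T j" for x
    proof -
      have "ball x (1 / real (Suc j)) \<in> range B" unfolding rB \<B>_def using that by auto
      then show ?thesis by (metis imageE)
    qed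
    then obtain i where i: "\<And>x. x \<in> T j \<Longrightarrow> B (i x) = ball x (1 / real (Suc j))" by metis
    have fin: "finite (i ` T j)" using T(1) by auto
    show "\<exists>N. \<forall>m\<in>M. \<exists>n\<le>N. m \<in> B n \<and> (\<forall>y\<in>B n. dist m y < \<epsilon>)"
    proof (rule exI, rule ballI)
      fix m assume "m \<in> M"
      then obtain x where x: "x \<in> T j" "m \<in> ball x (1 / real (Suc j))" using T(2)[of j] by auto
      have "dist m y < \<epsilon>" if "y \<in> ball x (1 / real (Suc j))" for y
      proof -
        have "dist m y \<le> dist x m + dist x y" by (metis dist_triangle3 dist_commute)
        also have "\<dots> < 2 / real (Suc j)" using x that by (simp add: field_simps)
        finally show ?thesis using j by linarith
      qed
      moreover have "i x \<le> Max (i ` T j)" using x fin by auto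
      ultimately show "\<exists>n\<le>Max (i ` T j). m \<in> B n \<and> (\<forall>y\<in>B n. dist m y < \<epsilon>)"
        using x i[OF x(1)] by metis
    qed
  qed
qed

text \<open>The code of a point records to which balls of a fine sequence it belongs. It is Borel but in general
discontinuous; what matters is that its inverse is uniformly continuous, because two points with the
same first digits lie in a common small ball.\<close>

lemma compact_metric_borel_coding:
  fixes M :: "'a::metric_space set"
  assumes "compact M" "M \<noteq> {}"
  obtains s :: "'a \<Rightarrow> real" where "s \<in> borel_measurable borel" "\<And>x. s x \<in> {0..2}"
    "\<And>\<epsilon>. \<epsilon> > 0 \<Longrightarrow> \<exists>\<eta>>0. \<forall>x\<in>M. \<forall>y\<in>M. \<bar>s x - s y\<bar> < \<eta> \<longrightarrow> dist x y < \<epsilon>"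
proof -
  obtain B :: "nat \<Rightarrow> 'a set" where oB: "\<And>n. open (B n)"
    and B: "\<And>\<epsilon>. \<epsilon> > 0 \<Longrightarrow> \<exists>N. \<forall>m\<in>M. \<exists>n\<le>N. m \<in> B n \<and> (\<forall>y\<in>B n. dist m y < \<epsilon>)"
    using compact_fine_balls[OF assms] by blast
  define s where "s x = (\<Sum>n. indicator (B n) x * (1/4::real)^n)" for x
  have geo: "summable (\<lambda>k. (1/4::real)^k)" "(\<Sum>k. (1/4::real)^k) = 4/3"
    using summable_geometric[of "1/4::real"] suminf_geometric[of "1/4::real"] by auto
  have sm: "summable (\<lambda>n. indicator (B n) x * (1/4::real)^n)" for x
    by (rule summable_comparison_test'[OF geo(1), of 0]) (auto simp: indicator_def)
  show ?thesis
  proof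
    have [measurable]: "B n \<in> sets borel" for n using oB by auto
    show "s \<in> borel_measurable borel" unfolding s_def by measurable
    show "s x \<in> {0..2}" for x
    proof -
      have "s x \<le> (\<Sum>k. (1/4::real)^k)"
        unfolding s_def by (rule suminf_le[OF _ sm geo(1)]) (auto simp: indicator_def)
      moreover have "0 \<le> s x" unfolding s_def by (rule suminf_nonneg[OF sm]) auto
      ultimately show ?thesis using geo by auto
    qed
    fix \<epsilon> :: real assume "\<epsilon> > 0"
    then obtain N where N: "\<forall>m\<in>M. \<exists>n\<le>N. m \<in> B n \<and> (\<forall>y\<in>B n. dist m y < \<epsilon>)" using B by blast
    show "\<exists>\<eta>>0. \<forall>x\<in>M. \<forall>y\<in>M. \<bar>s x - s y\<bar> < \<eta> \<longrightarrow> dist x y < \<epsilon>"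
    proof (intro exI conjI ballI impI)
      fix x y assume xy: "x \<in> M" "y \<in> M" "\<bar>s x - s y\<bar> < (1/4)^N / 2"
      obtain n where n: "n \<le> N" "x \<in> B n" "\<forall>y\<in>B n. dist x y < \<epsilon>" using N xy by blast
      define c where "c n = (indicator (B n) x - indicator (B n) y :: real)" for n
      have "s x - s y = (\<Sum>k. c k * (1/4)^k)"
        unfolding s_def c_def by (subst suminf_diff[OF sm sm]) (simp add: left_diff_distrib)
      then have "c n = 0"
        using base4_expansion_separates[of c N n] xy(3) n(1) by (auto simp: c_def indicator_def)
      then have "y \<in> B n" using n(2) by (auto simp: c_def indicator_def split: if_splits)
      then show "dist x y < \<epsilon>" using n by blast
    qed simp
  qed
qed

text \<open>The decoding map extends from the set of codes to its closure. The values of the extension are taken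
from limits of points of \<open>M\<close>, which exist by compactness, so the ambient type need not be complete.\<close>

lemma decoding_extends:
  fixes M :: "'a::metric_space set" and s :: "'a \<Rightarrow> real"
  assumes "compact M"
    and uc: "\<And>\<epsilon>. \<epsilon> > 0 \<Longrightarrow> \<exists>\<eta>>0. \<forall>x\<in>M. \<forall>y\<in>M. \<bar>s x - s y\<bar> < \<eta> \<longrightarrow> dist x y < \<epsilon>"
  obtains \<phi> where "continuous_on (closure (s ` M)) \<phi>" "\<phi> ` closure (s ` M) \<subseteq> M"
    "\<And>x. x \<in> M \<Longrightarrow> \<phi> (s x) = x"
proof -
  have "\<exists>m\<in>M. \<forall>e>0. \<exists>x\<in>M. \<bar>s x - z\<bar> < e \<and> dist x m < e" if "z \<in> closure (s ` M)" for z
  proof -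
    obtain u where u: "\<And>n. u n \<in> s ` M" "u \<longlonglongrightarrow> z" using \<open>z \<in> _\<close> closure_sequential by metis
    have "\<exists>x. x \<in> M \<and> u n = s x" for n using u(1)[of n] by auto
    then obtain v where v: "\<And>n. v n \<in> M" "\<And>n. u n = s (v n)" by metis
    then obtain m r where m: "m \<in> M" "strict_mono (r::nat\<Rightarrow>nat)" "(v \<circ> r) \<longlonglongrightarrow> m"
      using seq_compactE[OF compact_imp_seq_compact[OF \<open>compact M\<close>], of v] by blast
    have "(u \<circ> r) \<longlonglongrightarrow> z" using u(2) m(2) LIMSEQ_subseq_LIMSEQ by blast
    have "\<exists>x\<in>M. \<bar>s x - z\<bar> < e \<and> dist x m < e" if "e > 0" for e
    proof -
      have "\<forall>\<^sub>F n in sequentially. dist ((u \<circ> r) n) z < e \<and> dist ((v \<circ> r) n) m < e"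
        using tendstoD[OF \<open>(u \<circ> r) \<longlonglongrightarrow> z\<close> \<open>e>0\<close>] tendstoD[OF m(3) \<open>e>0\<close>] by eventually_elim auto
      then obtain n where "dist ((u \<circ> r) n) z < e \<and> dist ((v \<circ> r) n) m < e"
        using eventually_happens'[OF sequentially_bot] by blast
      then show ?thesis using v by (intro bexI[of _ "v (r n)"]) (auto simp: dist_real_def)
    qed
    then show ?thesis using m(1) by blast
  qed
  then obtain \<phi> where \<phi>M: "\<And>z. z \<in> closure (s ` M) \<Longrightarrow> \<phi> z \<in> M"
    and \<phi>: "\<And>z e. z \<in> closure (s ` M) \<Longrightarrow> e > 0 \<Longrightarrow> \<exists>x\<in>M. \<bar>s x - z\<bar> < e \<and> dist x (\<phi> z) < e"
    by metis
  have key: "dist (\<phi> z) (\<phi> z') < \<epsilon>"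
    if "\<epsilon> > 0" "\<eta> > 0" "\<forall>x\<in>M. \<forall>y\<in>M. \<bar>s x - s y\<bar> < \<eta> \<longrightarrow> dist x y < \<epsilon>/3"
      "z \<in> closure (s ` M)" "z' \<in> closure (s ` M)" "\<bar>z - z'\<bar> < \<eta>/3" for \<epsilon> \<eta> z z'
  proof -
    note zz = that(4,5)
    define e where "e = min (\<epsilon>/3) (\<eta>/3)"
    have "e > 0" "e \<le> \<epsilon>/3" "e \<le> \<eta>/3" using that unfolding e_def by auto
    obtain x where x: "x \<in> M" "\<bar>s x - z\<bar> < e" "dist x (\<phi> z) < e" using \<phi>[OF zz(1) \<open>e>0\<close>] by blast
    obtain y where y: "y \<in> M" "\<bar>s y - z'\<bar> < e" "dist y (\<phi> z') < e" using \<phi>[OF zz(2) \<open>e>0\<close>] by blast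
    have "\<bar>s x - s y\<bar> < \<eta>" using x(2) y(2) that(6) \<open>e \<le> \<eta>/3\<close> by linarith
    then have "dist x y < \<epsilon>/3" using that(3) x y by blast
    moreover have "dist (\<phi> z) (\<phi> z') \<le> dist x (\<phi> z) + dist x y + dist y (\<phi> z')"
      using dist_triangle[of "\<phi> z" "\<phi> z'" x] dist_triangle[of x "\<phi> z'" y]
      by (simp add: dist_commute)
    ultimately show ?thesis using x y \<open>e \<le> \<epsilon>/3\<close> by linarith
  qed
  have "continuous_on (closure (s ` M)) \<phi>"
    unfolding continuous_on_iff
  proof (intro ballI allI impI)
    fix z \<epsilon> assume z: "z \<in> closure (s ` M)" "(\<epsilon>::real) > 0"
    then obtain \<eta> where "\<eta> > 0" "\<forall>x\<in>M. \<forall>y\<in>M. \<bar>s x - s y\<bar> < \<eta> \<longrightarrow> dist x y < \<epsilon>/3"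
      using uc[of "\<epsilon>/3"] by auto
    then show "\<exists>d>0. \<forall>z'\<in>closure (s ` M). dist z' z < d \<longrightarrow> dist (\<phi> z') (\<phi> z) < \<epsilon>"
      using key[OF z(2)] z by (intro exI[of _ "\<eta>/3"]) (auto simp: dist_real_def)
  qed
  moreover have "\<phi> (s x) = x" if "x \<in> M" for x
  proof (rule ccontr)
    assume "\<phi> (s x) \<noteq> x"
    define \<epsilon> where "\<epsilon> = dist x (\<phi> (s x)) / 2"
    have "\<epsilon> > 0" using \<open>\<phi> (s x) \<noteq> x\<close> by (simp add: \<epsilon>_def)
    obtain \<eta> where \<eta>: "\<eta> > 0" "\<forall>x\<in>M. \<forall>y\<in>M. \<bar>s x - s y\<bar> < \<eta> \<longrightarrow> dist x y < \<epsilon>"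
      using uc[OF \<open>\<epsilon>>0\<close>] by auto
    have "s x \<in> closure (s ` M)" using that by (meson closure_subset imageI subsetD)
    then obtain y where y: "y \<in> M" "\<bar>s y - s x\<bar> < min \<epsilon> \<eta>" "dist y (\<phi> (s x)) < min \<epsilon> \<eta>"
      using \<phi>[of "s x" "min \<epsilon> \<eta>"] \<open>\<epsilon>>0\<close> \<eta> by auto
    then have "dist x y < \<epsilon>" using \<eta>(2) that by (auto simp: abs_minus_commute)
    then have "dist x (\<phi> (s x)) < 2 * \<epsilon>" using y(3) dist_triangle[of x "\<phi> (s x)" y] by linarith
    then show False by (simp add: \<epsilon>_def)
  qed
  ultimately show ?thesis using that \<phi>M by blast
qed

lemma continuous_on_compact_bounded:
  fixes F :: "'a::metric_space \<Rightarrow> real"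
  assumes "compact M" "continuous_on M F"
  obtains B where "0 < B" "\<And>x. x \<in> M \<Longrightarrow> \<bar>F x\<bar> \<le> B"
proof -
  have "bounded (F ` M)" using assms compact_continuous_image compact_imp_bounded by blast
  then show ?thesis using that by (auto simp: bounded_pos)
qed

text \<open>The measures are transported to a bounded interval by the coding map, where Helly's selection
theorem applies, and the limit is transported back by the decoding map. Integrals of a continuous \<open>F\<close>
converge because \<open>F\<close> composed with the decoding map extends to a bounded continuous function on
the line.\<close>

lemma prob_measures_on_compact_sequentially_compact:
  fixes M :: "'a::metric_space set" and \<mu> :: "nat \<Rightarrow> 'a measure"
  assumes M: "compact M" "M \<noteq> {}"
    and \<mu>: "\<And>n. prob_space (\<mu> n)" "\<And>n. sets (\<mu> n) = sets (restrict_space borel M)"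
  obtains \<nu> :: "'a measure" and r where "strict_mono (r :: nat \<Rightarrow> nat)" "prob_space \<nu>"
    "sets \<nu> = sets (restrict_space borel M)"
    "\<And>F :: 'a \<Rightarrow> real. continuous_on M F \<Longrightarrow> (\<lambda>n. \<integral>x. F x \<partial>\<mu> (r n)) \<longlonglongrightarrow> (\<integral>x. F x \<partial>\<nu>)"
proof -
  obtain s :: "'a \<Rightarrow> real" where s: "s \<in> borel_measurable borel" "\<And>x. s x \<in> {0..2}"
    "\<And>\<epsilon>. \<epsilon> > 0 \<Longrightarrow> \<exists>\<eta>>0. \<forall>x\<in>M. \<forall>y\<in>M. \<bar>s x - s y\<bar> < \<eta> \<longrightarrow> dist x y < \<epsilon>"
    using compact_metric_borel_coding[OF M] by blast
  define K where "K = closure (s ` M)"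
  obtain \<phi> where \<phi>: "continuous_on K \<phi>" "\<phi> ` K \<subseteq> M" "\<And>x. x \<in> M \<Longrightarrow> \<phi> (s x) = x"
    using decoding_extends[OF M(1) s(3)] unfolding K_def by blast
  have "closed K" "K \<noteq> {}" using M unfolding K_def by auto
  have sK: "s x \<in> K" if "x \<in> M" for x using that unfolding K_def by (meson closure_subset imageI subsetD)
  have space: "space (\<mu> n) = M" for n using sets_eq_imp_space_eq[OF \<mu>(2)[of n]] by (simp add: space_restrict_space)
  have s_meas[measurable]: "s \<in> borel_measurable (\<mu> n)" for n
    using measurable_restrict_space1[OF s(1)] measurable_cong_sets[OF \<mu>(2) refl] by blast
  define \<kappa> where "\<kappa> n = distr (\<mu> n) borel s" for n
  have rd: "real_distribution (\<kappa> n)" for n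
  proof -
    interpret prob_space "\<mu> n" by (rule \<mu>)
    show ?thesis unfolding \<kappa>_def by (rule real_distribution_distr) simp
  qed
  have "tight \<kappa>"
    unfolding tight_def
  proof (intro conjI allI impI rd)
    fix \<epsilon> :: real assume "\<epsilon> > 0"
    have "measure (\<kappa> n) {-1<..2} = 1" for n
    proof -
      interpret prob_space "\<mu> n" by (rule \<mu>)
      have "s x \<le> 2" "- 1 < s x" for x using s(2)[of x] by auto
      then have "s -` {-1<..2} = UNIV" by auto
      then show ?thesis unfolding \<kappa>_def by (subst measure_distr) (auto simp: prob_space)
    qed
    then show "\<exists>a b. a < b \<and> (\<forall>n. 1 - \<epsilon> < measure (\<kappa> n) {a<..b})"
      using \<open>\<epsilon> > 0\<close> by (intro exI[of _ "-1"] exI[of _ 2]) auto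
  qed
  then obtain r L where r: "strict_mono (r::nat\<Rightarrow>nat)" and L: "real_distribution L"
    and w: "weak_conv_m (\<kappa> \<circ> (\<lambda>x. x) \<circ> r) L"
    using tight_imp_convergent_subsubsequence[of \<kappa> "\<lambda>x. x"] by (auto simp: strict_mono_def)
  interpret L: real_distribution L by (rule L)
  have rdr: "real_distribution ((\<kappa> \<circ> (\<lambda>x. x) \<circ> r) n)" for n using rd by simp
  have conv: "(\<lambda>n. \<integral>x. G x \<partial>\<kappa> (r n)) \<longlonglongrightarrow> (\<integral>x. G x \<partial>L)"
    if "continuous_on UNIV G" "\<And>x. \<bar>G x\<bar> \<le> B" for G :: "real \<Rightarrow> real" and B
    using weak_conv_imp_integral_bdd_continuous_conv[OF rdr L w, of G B] that
    by (auto simp: continuous_on_eq_continuous_at o_def)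
  have push: "(\<integral>x. G x \<partial>\<kappa> n) = (\<integral>x. G (s x) \<partial>\<mu> n)" if "G \<in> borel_measurable borel" for G :: "real \<Rightarrow> real" and n
    unfolding \<kappa>_def using that by (subst integral_distr) auto
  \<comment> \<open>The limit does not charge the complement of the closed set of codes.\<close>
  have AEK: "AE x in L. x \<in> K"
  proof -
    define G where "G x = min 1 (infdist x K)" for x :: real
    have G: "continuous_on UNIV G" "\<And>x. \<bar>G x\<bar> \<le> 1" "\<And>x. 0 \<le> G x"
      unfolding G_def by (auto intro!: continuous_intros simp: infdist_nonneg)
    have Gm[measurable]: "G \<in> borel_measurable borel" using G(1) by (rule borel_measurable_continuous_onI)
    have "(\<integral>x. G x \<partial>\<kappa> n) = 0" for n
    proof -
      have "(\<integral>x. G (s x) \<partial>\<mu> n) = (\<integral>x. 0 \<partial>\<mu> n)"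
        by (rule Bochner_Integration.integral_cong) (auto simp: space G_def sK)
      then show ?thesis by (simp add: push)
    qed
    then have "(\<integral>x. G x \<partial>L) = 0" using conv[OF G(1,2)] LIMSEQ_unique[of "\<lambda>n. 0::real" 0] by auto
    moreover have "integrable L G" by (rule L.integrable_const_bound[of _ 1]) (use G in auto)
    ultimately have "AE x in L. G x = 0" using integral_nonneg_eq_0_iff_AE[of L G] G(3) by auto
    then show ?thesis
    proof eventually_elim
      case (elim x)
      then have "infdist x K = 0" unfolding G_def by (auto simp: min_def split: if_splits)
      then show ?case using in_closed_iff_infdist_zero[OF \<open>closed K\<close> \<open>K \<noteq> {}\<close>] by simp
    qed
  qed
  obtain m0 where "m0 \<in> M" using M by auto
  define \<psi> where "\<psi> x = (if x \<in> K then \<phi> x else m0)" for x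
  have [measurable]: "K \<in> sets borel" using \<open>closed K\<close> by auto
  have "\<psi> \<in> borel_measurable borel"
    unfolding \<psi>_def
    by (rule measurable_If_restrict_space_iff[THEN iffD2])
       (use \<phi>(1) in \<open>auto intro!: borel_measurable_continuous_on_restrict\<close>)
  then have \<psi>[measurable]: "\<psi> \<in> measurable L (restrict_space borel M)"
    using \<phi>(2) \<open>m0 \<in> M\<close> by (intro measurable_restrict_space2) (auto simp: \<psi>_def intro: \<phi>(2)[THEN subsetD, OF imageI])
  define \<nu> where "\<nu> = distr L (restrict_space borel M) \<psi>"
  have "(\<lambda>n. \<integral>x. F x \<partial>\<mu> (r n)) \<longlonglongrightarrow> (\<integral>x. F x \<partial>\<nu>)" if F: "continuous_on M F" for F :: "'a \<Rightarrow> real"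
  proof -
    obtain B where "0 < B" and B: "\<And>x. x \<in> M \<Longrightarrow> \<bar>F x\<bar> \<le> B"
      using continuous_on_compact_bounded[OF M(1) F] by blast
    have "continuous_on K (F \<circ> \<phi>)" using \<phi> F by (metis continuous_on_compose continuous_on_subset)
    then obtain G where G: "continuous_on UNIV G" "\<And>x. x \<in> K \<Longrightarrow> G x = F (\<phi> x)" "\<And>x. \<bar>G x\<bar> \<le> B"
      using Tietze[of K "F \<circ> \<phi>" UNIV B] \<open>closed K\<close> \<open>0 < B\<close> B \<phi>(2) by (auto simp: image_subset_iff)
    have Gm: "G \<in> borel_measurable borel" using G(1) by (rule borel_measurable_continuous_onI)
    have Fm: "F \<in> borel_measurable (restrict_space borel M)"
      using F by (rule borel_measurable_continuous_on_restrict)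
    have 1: "(\<integral>x. G x \<partial>\<kappa> n) = (\<integral>x. F x \<partial>\<mu> n)" for n
      unfolding push[OF Gm] by (rule Bochner_Integration.integral_cong) (auto simp: space G sK \<phi>)
    have "(\<integral>x. F x \<partial>\<nu>) = (\<integral>x. F (\<psi> x) \<partial>L)" unfolding \<nu>_def using Fm by (subst integral_distr) auto
    also have "\<dots> = (\<integral>x. G x \<partial>L)"
    proof (rule integral_cong_AE)
      show "AE x in L. F (\<psi> x) = G x" using AEK by eventually_elim (auto simp: \<psi>_def G)
      show "(\<lambda>x. F (\<psi> x)) \<in> borel_measurable L" using \<psi> Fm by (rule measurable_compose)
      show "G \<in> borel_measurable L" using Gm by simp
    qed
    finally show ?thesis using conv[OF G(1,3)] by (simp add: 1)
  qed
  moreover have "prob_space \<nu>" unfolding \<nu>_def by (rule L.prob_space_distr) simp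
  moreover have "sets \<nu> = sets (restrict_space borel M)" unfolding \<nu>_def by simp
  ultimately show ?thesis using that r by blast
qed

lemma borel_prob_eqI_continuous:
  fixes M :: "'a::metric_space set"
  assumes M: "compact M" and \<mu>: "prob_space \<mu>" "sets \<mu> = sets (restrict_space borel M)"
    and \<nu>: "prob_space \<nu>" "sets \<nu> = sets (restrict_space borel M)"
    and eq: "\<And>F :: 'a \<Rightarrow> real. continuous_on M F \<Longrightarrow> bounded (F ` M) \<Longrightarrow> (\<integral>x. F x \<partial>\<mu>) = (\<integral>x. F x \<partial>\<nu>)"
  shows "\<mu> = \<nu>"
proof -
  define E where "E = (\<lambda>C. M \<inter> C) ` {C :: 'a set. closed C}"
  have space: "space \<mu> = M" "space \<nu> = M"
    using sets_eq_imp_space_eq[OF \<mu>(2)] sets_eq_imp_space_eq[OF \<nu>(2)] by (auto simp: space_restrict_space)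
  have gen: "sets (restrict_space borel M) = sigma_sets M E"
    unfolding sets_restrict_space E_def
    using sigma_sets_Int[of M UNIV "Collect closed"] borel_closed[OF compact_imp_closed[OF M]]
    by (simp add: borel_eq_closed)
  show ?thesis
  proof (rule measure_eqI_generator_eq[where E=E and \<Omega>=M and A="\<lambda>_. M"])
    show "Int_stable E"
    proof (rule Int_stableI)
      fix X Y assume "X \<in> E" "Y \<in> E"
      then obtain A B where "closed A" "closed B" "X = M \<inter> A" "Y = M \<inter> B" unfolding E_def by auto
      then show "X \<inter> Y \<in> E" unfolding E_def by (intro image_eqI[of _ _ "A \<inter> B"]) auto
    qed
    show "E \<subseteq> Pow M" unfolding E_def by auto
    show "sets \<mu> = sigma_sets M E" "sets \<nu> = sigma_sets M E" using gen \<mu> \<nu> by auto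
    show "range (\<lambda>_. M) \<subseteq> E" unfolding E_def by (auto intro!: image_eqI[of M _ UNIV])
    show "(\<Union>i::nat. M) = M" by auto
    interpret \<mu>: prob_space \<mu> by fact
    interpret \<nu>: prob_space \<nu> by fact
    show "emeasure \<mu> M \<noteq> \<infinity>" using \<mu>.emeasure_finite by auto
    fix X assume "X \<in> E"
    then obtain C where C: "closed C" "X = M \<inter> C" unfolding E_def by auto
    show "emeasure \<mu> X = emeasure \<nu> X"
    proof (cases "C = {}")
      case True then show ?thesis using C by simp
    next
      case False
      \<comment> \<open>The indicator of a closed set is a decreasing limit of continuous functions.\<close>
      define F where "F n x = max 0 (1 - real n * infdist x C)" for n x
      have cF: "continuous_on M (F n)" for n unfolding F_def by (intro continuous_intros)
      have bF: "\<bar>F n x\<bar> \<le> 1" for n x unfolding F_def using infdist_nonneg[of x C] by auto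
      have lim: "(\<lambda>n. F n x) \<longlonglongrightarrow> indicator C x" for x
      proof (cases "x \<in> C")
        case True then show ?thesis by (simp add: F_def)
      next
        case False
        then have "infdist x C > 0"
          using in_closed_iff_infdist_zero[OF C(1) \<open>C \<noteq> {}\<close>] infdist_nonneg[of x C] by (metis order_less_le)
        then obtain N :: nat where N: "1 / infdist x C < real N" using reals_Archimedean2 by blast
        have "F n x = 0" if "n \<ge> N" for n
        proof -
          have "1 / infdist x C < real n" using N that by simp
          then show ?thesis using \<open>infdist x C > 0\<close> unfolding F_def by (simp add: field_simps)
        qed
        then have "(\<lambda>n. F n x) \<longlonglongrightarrow> 0"
          by (intro tendsto_eventually eventually_sequentiallyI[of N]) auto
        then show ?thesis using False by simp
      qed
      have int: "(\<lambda>n. \<integral>x. F n x \<partial>\<rho>) \<longlonglongrightarrow> measure \<rho> X"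
        if \<rho>: "prob_space \<rho>" "sets \<rho> = sets (restrict_space borel M)" "space \<rho> = M" for \<rho> :: "'a measure"
      proof -
        interpret prob_space \<rho> by fact
        have ms: "borel_measurable \<rho> = (borel_measurable (restrict_space borel M) :: ('a \<Rightarrow> real) set)"
          using measurable_cong_sets[OF \<rho>(2) refl] .
        have XM: "X \<in> sets \<rho>" unfolding \<rho>(2) sets_restrict_space using C by auto
        have "(\<lambda>n. \<integral>x. F n x \<partial>\<rho>) \<longlonglongrightarrow> (\<integral>x. indicator C x \<partial>\<rho>)"
        proof (rule integral_dominated_convergence[where w="\<lambda>_. 1"])
          show "(\<lambda>x. indicator C x :: real) \<in> borel_measurable \<rho>"
            unfolding ms using C(1) by (intro measurable_restrict_space1) auto
          show "F n \<in> borel_measurable \<rho>" for n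
            unfolding ms by (rule borel_measurable_continuous_on_restrict[OF cF])
        qed (use lim bF in auto)
        also have "(\<integral>x. indicator C x \<partial>\<rho>) = (\<integral>x. indicator X x \<partial>\<rho> :: real)"
          by (rule Bochner_Integration.integral_cong) (auto simp: \<rho> C indicator_def)
        also have "\<dots> = measure \<rho> X" using XM by simp
        finally show ?thesis .
      qed
      have "(\<integral>x. F n x \<partial>\<mu>) = (\<integral>x. F n x \<partial>\<nu>)" for n
        by (rule eq[OF cF]) (use bF in \<open>auto simp: bounded_iff\<close>)
      then have "measure \<mu> X = measure \<nu> X"
        using int[OF \<mu> space(1)] int[OF \<nu> space(2)] LIMSEQ_unique by auto
      then show ?thesis by (simp add: \<mu>.emeasure_eq_measure \<nu>.emeasure_eq_measure)
    qed
  qed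
qed

section \<open>Invariant measures from time averages\<close>

lemma continuous_has_antiderivative:
  fixes h :: "real \<Rightarrow> real"
  assumes "continuous_on UNIV h"
  obtains H where "\<And>x. (H has_real_derivative h x) (at x)"
  using einterval_antiderivative[of "-\<infinity>" "\<infinity>" h] assms
  by (auto simp: continuous_on_eq_continuous_at has_real_derivative_iff_has_vector_derivative)

lemma continuous_flow_orbit_continuous:
  assumes "continuous_flow M \<phi>" "p \<in> M"
  shows "continuous_on UNIV (\<lambda>s. \<phi> s p)"
proof -
  have "continuous_on UNIV ((\<lambda>(t, w). \<phi> t w) \<circ> (\<lambda>s. (s, p)))"
    by (rule continuous_on_compose, intro continuous_intros,
        rule continuous_on_subset[of "UNIV \<times> M"]) (use assms in \<open>auto simp: continuous_flow_def\<close>)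
  then show ?thesis by (simp add: o_def)
qed

lemma continuous_flow_time_map_continuous:
  assumes "continuous_flow M \<phi>"
  shows "continuous_on M (\<phi> t)"
proof -
  have "continuous_on M ((\<lambda>(t, w). \<phi> t w) \<circ> (\<lambda>x. (t, x)))"
    by (rule continuous_on_compose, intro continuous_intros,
        rule continuous_on_subset[of "UNIV \<times> M"]) (use assms in \<open>auto simp: continuous_flow_def\<close>)
  then show ?thesis by (simp add: o_def)
qed

lemma FTC_real:
  fixes h :: "real \<Rightarrow> real"
  assumes "a \<le> b" "\<And>x. (H has_real_derivative h x) (at x)"
  shows "integral {a..b} h = H b - H a"
  by (rule integral_unique, rule fundamental_theorem_of_calculus)
     (use assms in \<open>auto simp: has_real_derivative_iff_has_vector_derivative[symmetric] intro: DERIV_subset\<close>)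

text \<open>The measure is a weak limit of the uniform distributions on the orbit pieces of length \<open>T n\<close>. A time
shift by \<open>u\<close> changes their integrals by at most \<open>2 * B * \<bar>u\<bar> / T n\<close>, whence invariance. The
starting points may vary with \<open>n\<close>; this is what yields bounds that are uniform in the starting point.\<close>

lemma krylov_bogoliubov_average:
  fixes M :: "'a::metric_space set" and p :: "nat \<Rightarrow> 'a"
  assumes M: "compact M" and \<phi>: "continuous_flow M \<phi>" and q: "continuous_on M q"
    and p: "\<And>n. p n \<in> M" and T: "\<And>n. T n > 0" "filterlim T at_top sequentially"
    and avg: "\<And>n. c * T n \<le> integral {0..T n} (\<lambda>s. q (\<phi> s (p n)))"
  obtains \<nu> where "prob_space \<nu>" "sets \<nu> = sets (restrict_space borel M)"
    "\<And>t. \<phi> t \<in> measurable \<nu> \<nu>" "\<And>t. distr \<nu> \<nu> (\<phi> t) = \<nu>" "c \<le> (\<integral>x. q x \<partial>\<nu>)"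
proof -
  have "M \<noteq> {}" using p by auto
  have \<phi>M: "\<phi> t x \<in> M" if "x \<in> M" for t x using \<phi> that by (auto simp: continuous_flow_def)
  have oc: "continuous_on UNIV (\<lambda>s. F (\<phi> s (p n)))" if "continuous_on M F" for F :: "'a \<Rightarrow> real" and n
    by (rule continuous_on_compose2[OF that continuous_flow_orbit_continuous[OF \<phi> p]]) (auto simp: \<phi>M p)
  define \<mu> where "\<mu> n = distr (uniform_measure lborel {0..T n}) (restrict_space borel M) (\<lambda>s. \<phi> s (p n))" for n
  have meas: "(\<lambda>s. \<phi> s (p n)) \<in> measurable (uniform_measure lborel {0..T n}) (restrict_space borel M)" for n
    using borel_measurable_continuous_onI[OF continuous_flow_orbit_continuous[OF \<phi> p[of n]]] \<phi>M p
    by (auto intro!: measurable_restrict_space2)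
  have prob: "prob_space (\<mu> n)" for n
    unfolding \<mu>_def
    by (rule prob_space.prob_space_distr[OF prob_space_uniform_measure meas]) (use T(1)[of n] in auto)
  have sets_\<mu>: "sets (\<mu> n) = sets (restrict_space borel M)" for n unfolding \<mu>_def by simp
  have integral_\<mu>: "(\<integral>x. F x \<partial>\<mu> n) = integral {0..T n} (\<lambda>s. F (\<phi> s (p n))) / T n"
    if F: "continuous_on M F" for F :: "'a \<Rightarrow> real" and n
  proof -
    let ?h = "\<lambda>s. F (\<phi> s (p n))"
    have h: "?h \<in> borel_measurable borel" using oc[OF F] by (rule borel_measurable_continuous_onI)
    have "(\<integral>x. F x \<partial>\<mu> n) = (\<integral>s. ?h s \<partial>uniform_measure lborel {0..T n})"
      unfolding \<mu>_def by (subst integral_distr[OF meas borel_measurable_continuous_on_restrict[OF F]]) auto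
    also have "uniform_measure lborel {0..T n} = density lborel (\<lambda>s. ennreal (indicator {0..T n} s / T n))"
      unfolding uniform_measure_def using T(1)[of n]
      by (intro arg_cong[where f="density lborel"] ext) (auto simp: indicator_def divide_ennreal ennreal_1[symmetric] simp del: ennreal_1)
    also have "(\<integral>s. ?h s \<partial>density lborel (\<lambda>s. ennreal (indicator {0..T n} s / T n)))
        = (\<integral>s. (indicator {0..T n} s / T n) *\<^sub>R ?h s \<partial>lborel)"
      by (rule integral_density) (use h T(1)[of n] in auto)
    also have "\<dots> = (\<integral>s. (indicator {0..T n} s *\<^sub>R ?h s) / T n \<partial>lborel)"
      by (rule Bochner_Integration.integral_cong) auto
    also have "\<dots> = (LINT s:{0..T n}|lborel. ?h s) / T n"
      unfolding set_lebesgue_integral_def by simp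
    also have "(LINT s:{0..T n}|lborel. ?h s) = integral {0..T n} ?h"
      by (rule set_borel_integral_eq_integral(2), rule borel_integrable_atLeastAtMost')
         (rule continuous_on_subset[OF oc[OF F]], simp)
    finally show ?thesis .
  qed
  obtain r \<nu> where r: "strict_mono (r::nat\<Rightarrow>nat)" and \<nu>: "prob_space \<nu>" "sets \<nu> = sets (restrict_space borel M)"
    and lim: "\<And>F :: 'a \<Rightarrow> real. continuous_on M F \<Longrightarrow> (\<lambda>n. \<integral>x. F x \<partial>\<mu> (r n)) \<longlonglongrightarrow> (\<integral>x. F x \<partial>\<nu>)"
    by (rule prob_measures_on_compact_sequentially_compact[OF M \<open>M \<noteq> {}\<close> prob sets_\<mu>], rule that)
  interpret \<nu>: prob_space \<nu> by (rule \<nu>)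
  have space: "space \<nu> = M" using sets_eq_imp_space_eq[OF \<nu>(2)] by (auto simp: space_restrict_space)
  have Tr: "filterlim (\<lambda>n. T (r n)) at_top sequentially"
    using filterlim_compose[OF T(2) filterlim_subseq[OF r]] .
  have inv: "(\<integral>x. F (\<phi> u x) \<partial>\<nu>) = (\<integral>x. F x \<partial>\<nu>)" if F: "continuous_on M F" for F :: "'a \<Rightarrow> real" and u
  proof -
    have F': "continuous_on M (\<lambda>x. F (\<phi> u x))"
      by (rule continuous_on_compose2[OF F continuous_flow_time_map_continuous[OF \<phi>]]) (auto simp: \<phi>M)
    obtain B where B: "\<And>x. x \<in> M \<Longrightarrow> \<bar>F x\<bar> \<le> B"
      using continuous_on_compact_bounded[OF M F] by blast
    have bound: "\<bar>(\<integral>x. F (\<phi> u x) \<partial>\<mu> n) - (\<integral>x. F x \<partial>\<mu> n)\<bar> \<le> (2 * B * \<bar>u\<bar>) / T n" for n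
    proof -
      let ?h = "\<lambda>s. F (\<phi> s (p n))"
      obtain H where H: "\<And>x. (H has_real_derivative ?h x) (at x)"
        using continuous_has_antiderivative[OF oc[OF F]] by blast
      have H': "((\<lambda>s. H (s + u)) has_real_derivative F (\<phi> u (\<phi> s (p n)))) (at s)" for s
      proof -
        have "\<phi> (s + u) (p n) = \<phi> u (\<phi> s (p n))"
          using \<phi> p[of n] unfolding continuous_flow_def by (metis add.commute)
        then show ?thesis using H[of "s + u"] by (simp add: DERIV_shift)
      qed
      have lip: "\<bar>H (x + u) - H x\<bar> \<le> B * \<bar>u\<bar>" for x
        using field_differentiable_bound[of UNIV H ?h B "x + u" x] H B[OF \<phi>M[OF p]]
        by (auto intro: has_field_derivative_at_within)
      have "(\<integral>x. F (\<phi> u x) \<partial>\<mu> n) - (\<integral>x. F x \<partial>\<mu> n) = ((H (T n + u) - H (0 + u)) - (H (T n) - H 0)) / T n"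
        unfolding integral_\<mu>[OF F] integral_\<mu>[OF F']
        using T(1)[of n] by (subst FTC_real[OF _ H], simp, subst FTC_real[OF _ H']) (auto simp: diff_divide_distrib)
      moreover have "\<bar>(H (T n + u) - H (0 + u)) - (H (T n) - H 0)\<bar> \<le> 2 * B * \<bar>u\<bar>"
        using lip[of "T n"] lip[of 0] by linarith
      ultimately show ?thesis using T(1)[of n] by (simp add: divide_right_mono)
    qed
    have "(\<lambda>n. (2 * B * \<bar>u\<bar>) / T (r n)) \<longlonglongrightarrow> 0"
      using tendsto_mult[OF tendsto_const[of "2 * B * \<bar>u\<bar>"] tendsto_inverse_0_at_top[OF Tr]]
      by (simp add: divide_inverse)
    then have "(\<lambda>n. (\<integral>x. F (\<phi> u x) \<partial>\<mu> (r n)) - (\<integral>x. F x \<partial>\<mu> (r n))) \<longlonglongrightarrow> 0"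
      by (rule Lim_null_comparison[rotated]) (use bound in auto)
    moreover have "(\<lambda>n. (\<integral>x. F (\<phi> u x) \<partial>\<mu> (r n)) - (\<integral>x. F x \<partial>\<mu> (r n)))
        \<longlonglongrightarrow> (\<integral>x. F (\<phi> u x) \<partial>\<nu>) - (\<integral>x. F x \<partial>\<nu>)"
      by (intro tendsto_diff lim F F')
    ultimately show ?thesis using LIMSEQ_unique by fastforce
  qed
  have \<phi>meas: "\<phi> t \<in> measurable \<nu> \<nu>" for t
  proof -
    have "\<phi> t \<in> borel_measurable (restrict_space borel M)"
      by (rule borel_measurable_continuous_on_restrict[OF continuous_flow_time_map_continuous[OF \<phi>]])
    then have "\<phi> t \<in> measurable (restrict_space borel M) (restrict_space borel M)"
      using \<phi>M by (intro measurable_restrict_space2) (auto simp: space_restrict_space)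
    then show ?thesis using measurable_cong_sets[OF \<nu>(2) \<nu>(2)] by blast
  qed
  have "distr \<nu> \<nu> (\<phi> t) = \<nu>" for t
  proof (rule borel_prob_eqI_continuous[OF M _ _ \<nu>])
    show "prob_space (distr \<nu> \<nu> (\<phi> t))" by (rule \<nu>.prob_space_distr[OF \<phi>meas])
    show "sets (distr \<nu> \<nu> (\<phi> t)) = sets (restrict_space borel M)" using \<nu>(2) by simp
    fix F :: "'a \<Rightarrow> real" assume F: "continuous_on M F"
    have "F \<in> borel_measurable \<nu>"
      using borel_measurable_continuous_on_restrict[OF F] measurable_cong_sets[OF \<nu>(2) refl] by blast
    then show "(\<integral>x. F x \<partial>distr \<nu> \<nu> (\<phi> t)) = (\<integral>x. F x \<partial>\<nu>)"
      using inv[OF F] by (subst integral_distr[OF \<phi>meas]) auto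
  qed
  moreover have "c \<le> (\<integral>x. q x \<partial>\<nu>)"
  proof (rule LIMSEQ_le_const[OF lim[OF q]], intro exI allI impI)
    fix n show "c \<le> (\<integral>x. q x \<partial>\<mu> (r n))"
      unfolding integral_\<mu>[OF q] using avg[of "r n"] T(1)[of "r n"] by (simp add: pos_le_divide_eq)
  qed
  ultimately show ?thesis using that \<nu> \<phi>meas by blast
qed

section \<open>Scalar equations driven by a flow\<close>

text \<open>Uniqueness for linear growth: \<open>z\<^sup>2 exp (-2 L t)\<close> does not increase and \<open>z\<^sup>2 exp (2 L t)\<close> does not
decrease, so both the future and the past of a zero vanish.\<close>

lemma zero_if_derivative_dominated:
  fixes z z' :: "real \<Rightarrow> real"
  assumes z: "\<And>t. t \<in> {a..b} \<Longrightarrow> (z has_real_derivative z' t) (at t)"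
    and bound: "\<And>t. t \<in> {a..b} \<Longrightarrow> \<bar>z' t\<bar> \<le> L * \<bar>z t\<bar>"
    and c: "c \<in> {a..b}" "z c = 0" and t: "t \<in> {a..b}"
  shows "z t = 0"
proof -
  have zz: "\<bar>z s * z' s\<bar> \<le> L * (z s)^2" if "s \<in> {a..b}" for s
    using mult_left_mono[OF bound[OF that], of "\<bar>z s\<bar>"] by (simp add: abs_mult power2_eq_square algebra_simps)
  show ?thesis
  proof (cases "c \<le> t")
    case True
    let ?E = "\<lambda>s. (z s)^2 * exp (-2 * L * s)"
    have "?E t \<le> ?E c"
    proof (rule DERIV_nonpos_imp_nonincreasing[OF True])
      fix s assume "c \<le> s" "s \<le> t"
      then have s: "s \<in> {a..b}" using c t by auto
      have "(?E has_real_derivative 2 * (z s * z' s - L * (z s)^2) * exp (-2 * L * s)) (at s)"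
        by (auto intro!: derivative_eq_intros z s simp: algebra_simps)
      moreover have "2 * (z s * z' s - L * (z s)^2) * exp (-2 * L * s) \<le> 0"
        using zz[OF s] by (simp add: mult_le_0_iff)
      ultimately show "\<exists>y. (?E has_real_derivative y) (at s) \<and> y \<le> 0" by blast
    qed
    then have "(z t)^2 \<le> 0" using c by (simp add: mult_le_0_iff)
    then show ?thesis by simp
  next
    case False
    then have "t \<le> c" by simp
    let ?E = "\<lambda>s. (z s)^2 * exp (2 * L * s)"
    have "?E t \<le> ?E c"
    proof (rule DERIV_nonneg_imp_nondecreasing[OF \<open>t \<le> c\<close>])
      fix s assume "t \<le> s" "s \<le> c"
      then have s: "s \<in> {a..b}" using c t by auto
      have "(?E has_real_derivative 2 * (z s * z' s + L * (z s)^2) * exp (2 * L * s)) (at s)"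
        by (auto intro!: derivative_eq_intros z s simp: algebra_simps)
      moreover have "2 * (z s * z' s + L * (z s)^2) * exp (2 * L * s) \<ge> 0"
        using zz[OF s] by (simp add: zero_le_mult_iff)
      ultimately show "\<exists>y. (?E has_real_derivative y) (at s) \<and> 0 \<le> y" by blast
    qed
    then have "(z t)^2 \<le> 0" using c by (simp add: mult_le_0_iff)
    then show ?thesis by simp
  qed
qed

lemma integral_monomial_unit:
  "integral {0..1} (\<lambda>r::real. c * r ^ k) = c / real (Suc k)"
proof -
  have "((\<lambda>r. c * r ^ Suc k / real (Suc k)) has_real_derivative c * r ^ k) (at r)" for r :: real
    by (rule derivative_eq_intros refl | simp)+
  from FTC_real[OF _ this, of 0 1] show ?thesis by simp
qed

text \<open>Picard iteration with parameters. The integral over \<open>{0..t}\<close> is rescaled to \<open>{0..1}\<close>, so that positive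
and negative times need no separate treatment and joint continuity of each iterate is continuity
of an integral over a fixed interval. The iterates converge uniformly for bounded \<open>t\<close>,
which passes joint continuity on to the solution.\<close>

lemma global_solution_family:
  fixes W :: "'w::metric_space set" and F :: "'w \<Rightarrow> real \<Rightarrow> real"
  assumes \<sigma>: "continuous_flow W \<sigma>"
    and F: "continuous_on (W \<times> UNIV) (\<lambda>(w, x). F w x)"
    and B: "\<And>w x. w \<in> W \<Longrightarrow> \<bar>F w x\<bar> \<le> B"
    and L: "0 \<le> L" "\<And>w x y. w \<in> W \<Longrightarrow> \<bar>F w x - F w y\<bar> \<le> L * \<bar>x - y\<bar>"
  obtains X :: "real \<Rightarrow> 'w \<Rightarrow> real \<Rightarrow> real" where
    "continuous_on (UNIV \<times> W \<times> UNIV) (\<lambda>(t, w, x). X t w x)"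
    "\<And>w x. w \<in> W \<Longrightarrow> X 0 w x = x"
    "\<And>w x t. w \<in> W \<Longrightarrow> ((\<lambda>s. X s w x) has_real_derivative F (\<sigma> t w) (X t w x)) (at t)"
proof -
  have \<sigma>W: "\<sigma> t w \<in> W" if "w \<in> W" for t w using \<sigma> that by (auto simp: continuous_flow_def)
  have \<sigma>c: "continuous_on (UNIV \<times> W) (\<lambda>(t, w). \<sigma> t w)" using \<sigma> by (auto simp: continuous_flow_def)
  define P where "P = rec_nat (\<lambda>t w x. x)
     (\<lambda>_ Q (t::real) w x. x + integral {0..1::real} (\<lambda>r. t * F (\<sigma> (t * r) w) (Q (t * r) w x)))"
  have P0: "P 0 = (\<lambda>t w x. x)" by (simp add: P_def)
  have PS: "P (Suc k) t w x = x + integral {0..1} (\<lambda>r. t * F (\<sigma> (t * r) w) (P k (t * r) w x))" for k t w x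
    by (simp add: P_def)
  have integrand_cont: "continuous_on ((UNIV \<times> W \<times> UNIV) \<times> cbox 0 1)
      (\<lambda>((t, w, x), r). t * F (\<sigma> (t * r) w) (Q (t * r) w x))"
    if Q: "continuous_on (UNIV \<times> W \<times> UNIV) (\<lambda>(t, w, x). Q t w x)" for Q :: "real \<Rightarrow> 'w \<Rightarrow> real \<Rightarrow> real"
  proof -
    let ?S = "(UNIV \<times> W \<times> UNIV) \<times> cbox 0 (1::real) :: ((real \<times> 'w \<times> real) \<times> real) set"
    have s: "continuous_on ?S (\<lambda>p. \<sigma> (fst (fst p) * snd p) (fst (snd (fst p))))"
      by (rule continuous_on_compose2[OF \<sigma>c, where f="\<lambda>p. (fst (fst p) * snd p, fst (snd (fst p)))", simplified])
         (auto intro!: continuous_intros)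
    have "continuous_on ?S (\<lambda>p. (\<lambda>(t, w, x). Q t w x) (fst (fst p) * snd p, fst (snd (fst p)), snd (snd (fst p))))"
      by (rule continuous_on_compose2[OF Q]) (auto intro!: continuous_intros)
    then have q: "continuous_on ?S (\<lambda>p. Q (fst (fst p) * snd p) (fst (snd (fst p))) (snd (snd (fst p))))"
      by (simp add: case_prod_unfold)
    have "continuous_on ?S (\<lambda>p. F (\<sigma> (fst (fst p) * snd p) (fst (snd (fst p))))
        (Q (fst (fst p) * snd p) (fst (snd (fst p))) (snd (snd (fst p)))))"
      by (rule continuous_on_compose2[OF F, where f="\<lambda>p. (\<sigma> (fst (fst p) * snd p) (fst (snd (fst p))),
           Q (fst (fst p) * snd p) (fst (snd (fst p))) (snd (snd (fst p))))", simplified])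
         (use s q \<sigma>W in \<open>auto intro!: continuous_intros\<close>)
    then show ?thesis by (auto simp: case_prod_unfold intro!: continuous_intros)
  qed
  have Pc: "continuous_on (UNIV \<times> W \<times> UNIV) (\<lambda>(t, w, x). P k t w x)" for k
  proof (induction k)
    case 0 show ?case by (auto simp: P0 case_prod_unfold intro!: continuous_intros)
  next
    case (Suc k)
    have "continuous_on (UNIV \<times> W \<times> UNIV)
       (\<lambda>p. integral (cbox 0 1) (\<lambda>r. case p of (t, w, x) \<Rightarrow> t * F (\<sigma> (t * r) w) (P k (t * r) w x)))"
      by (rule integral_continuous_on_param) (use integrand_cont[OF Suc] in \<open>simp add: case_prod_unfold\<close>)
    then show ?case by (auto simp: PS case_prod_unfold intro!: continuous_intros)
  qed
  have slice: "continuous_on {0..1} (\<lambda>r. t * F (\<sigma> (t * r) w) (Q (t * r) w x))"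
    if "continuous_on (UNIV \<times> W \<times> UNIV) (\<lambda>(t, w, x). Q t w x)" "w \<in> W" for Q :: "real \<Rightarrow> 'w \<Rightarrow> real \<Rightarrow> real" and t w x
  proof -
    have "continuous_on {0..1} (\<lambda>r. (\<lambda>((t, w, x), r). t * F (\<sigma> (t * r) w) (Q (t * r) w x)) ((t, w, x), r))"
      by (rule continuous_on_compose2[OF integrand_cont[OF that(1)]]) (use that(2) in \<open>auto intro!: continuous_intros\<close>)
    then show ?thesis by simp
  qed
  have int: "(\<lambda>r. t * F (\<sigma> (t * r) w) (P k (t * r) w x)) integrable_on {0..1}" if "w \<in> W" for t w x k
    using slice[OF Pc that] by (rule integrable_continuous_real)
  have D: "\<bar>P (Suc k) t w x - P k t w x\<bar> \<le> B * \<bar>t\<bar> * (L * \<bar>t\<bar>) ^ k / fact k" if w: "w \<in> W" for k t w x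
  proof (induction k arbitrary: t)
    case 0
    have "norm (integral {0..1} (\<lambda>r. t * F (\<sigma> (t * r) w) (P 0 (t * r) w x))) \<le> integral {0..1::real} (\<lambda>r. B * \<bar>t\<bar>)"
      by (rule integral_norm_bound_integral[OF int[OF w]])
         (use B[OF \<sigma>W[OF w]] in \<open>auto simp: abs_mult mult.commute[of B] intro!: mult_left_mono\<close>)
    then show ?case by (simp add: PS P0)
  next
    case (Suc k)
    let ?c = "B * \<bar>t\<bar> * (L * \<bar>t\<bar>) ^ Suc k / fact k"
    have "0 \<le> B" using B[OF w, of 0] by linarith
    have eq: "P (Suc (Suc k)) t w x - P (Suc k) t w x =
      integral {0..1} (\<lambda>r. t * F (\<sigma> (t * r) w) (P (Suc k) (t * r) w x) - t * F (\<sigma> (t * r) w) (P k (t * r) w x))"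
      unfolding PS[of "Suc k"] PS[of k t] using int[OF w, where t=t and x=x]
      by (subst Henstock_Kurzweil_Integration.integral_diff) auto
    have le: "norm (integral {0..1} (\<lambda>r. t * F (\<sigma> (t * r) w) (P (Suc k) (t * r) w x) - t * F (\<sigma> (t * r) w) (P k (t * r) w x)))
      \<le> integral {0..1} (\<lambda>r. ?c * r ^ k)"
    proof (rule integral_norm_bound_integral)
      fix r :: real assume r: "r \<in> {0..1}"
      have "norm (t * F (\<sigma> (t * r) w) (P (Suc k) (t * r) w x) - t * F (\<sigma> (t * r) w) (P k (t * r) w x))
         = \<bar>t\<bar> * \<bar>F (\<sigma> (t * r) w) (P (Suc k) (t * r) w x) - F (\<sigma> (t * r) w) (P k (t * r) w x)\<bar>"
        by (simp add: right_diff_distrib[symmetric] abs_mult)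
      also have "\<dots> \<le> \<bar>t\<bar> * (L * \<bar>P (Suc k) (t * r) w x - P k (t * r) w x\<bar>)"
        by (intro mult_left_mono L \<sigma>W w) simp
      also have "\<dots> \<le> \<bar>t\<bar> * (L * (B * \<bar>t * r\<bar> * (L * \<bar>t * r\<bar>) ^ k / fact k))"
        by (intro mult_left_mono Suc.IH L) simp
      also have "\<dots> \<le> \<bar>t\<bar> * (L * (B * \<bar>t\<bar> * (L * \<bar>t * r\<bar>) ^ k / fact k))"
        using r \<open>0 \<le> B\<close> L(1)
        by (intro mult_left_mono divide_right_mono mult_right_mono) (auto simp: abs_mult mult_left_le)
      also have "\<dots> = ?c * r ^ k" using r by (simp add: abs_mult power_mult_distrib)
      finally show "norm (t * F (\<sigma> (t * r) w) (P (Suc k) (t * r) w x) - t * F (\<sigma> (t * r) w) (P k (t * r) w x)) \<le> ?c * r ^ k" .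
    qed ((rule integrable_diff int[OF w])+, intro integrable_continuous_real continuous_intros)
    have val: "integral {0..1} (\<lambda>r. ?c * r ^ k) = B * \<bar>t\<bar> * (L * \<bar>t\<bar>) ^ Suc k / fact (Suc k)"
      by (simp only: integral_monomial_unit fact_Suc divide_divide_eq_left mult.commute[of "fact k" "real (Suc k)"])
    show ?case using le unfolding eq val real_norm_def .
  qed
  define X where "X t w x = x + (\<Sum>k. P (Suc k) t w x - P k t w x)" for t w x
  have lim: "uniform_limit ({-T..T} \<times> W \<times> UNIV) (\<lambda>n (t, w, x). P n t w x) (\<lambda>(t, w, x). X t w x) sequentially" for T
  proof -
    let ?A = "{-T..T} \<times> W \<times> (UNIV :: real set)"
    have "uniform_limit ?A (\<lambda>n p. \<Sum>k<n. (case p of (t, w, x) \<Rightarrow> P (Suc k) t w x - P k t w x))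
       (\<lambda>p. \<Sum>k. (case p of (t, w, x) \<Rightarrow> P (Suc k) t w x - P k t w x)) sequentially"
    proof (rule Weierstrass_m_test)
      show "summable (\<lambda>k. B * \<bar>T\<bar> * (L * \<bar>T\<bar>) ^ k / fact k)"
        using summable_mult[OF summable_exp[of "L * \<bar>T\<bar>"], of "B * \<bar>T\<bar>"] by (simp add: field_simps)
      fix k and p :: "real \<times> 'w \<times> real" assume p: "p \<in> ?A"
      obtain t w x where [simp]: "p = (t, w, x)" by (cases p)
      have "0 \<le> B" using B[of w 0] p by force
      have "\<bar>P (Suc k) t w x - P k t w x\<bar> \<le> B * \<bar>t\<bar> * (L * \<bar>t\<bar>) ^ k / fact k" using D p by auto
      also have "\<dots> \<le> B * \<bar>T\<bar> * (L * \<bar>T\<bar>) ^ k / fact k"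
        using p \<open>0 \<le> B\<close> L(1) by (intro divide_right_mono mult_mono power_mono) auto
      finally show "norm (case p of (t, w, x) \<Rightarrow> P (Suc k) t w x - P k t w x) \<le> B * \<bar>T\<bar> * (L * \<bar>T\<bar>) ^ k / fact k" by simp
    qed
    then have "uniform_limit ?A (\<lambda>n p. snd (snd p) + (\<Sum>k<n. (case p of (t, w, x) \<Rightarrow> P (Suc k) t w x - P k t w x)))
       (\<lambda>p. snd (snd p) + (\<Sum>k. (case p of (t, w, x) \<Rightarrow> P (Suc k) t w x - P k t w x))) sequentially"
      by (intro uniform_limit_add uniform_limit_const)
    moreover have "snd (snd p) + (\<Sum>k<n. (case p of (t, w, x) \<Rightarrow> P (Suc k) t w x - P k t w x)) = (case p of (t, w, x) \<Rightarrow> P n t w x)" for n and p :: "real \<times> 'w \<times> real"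
      by (cases p) (simp add: sum_lessThan_telescope[of "\<lambda>k. P k _ _ _"] P0)
    ultimately show ?thesis by (simp add: X_def case_prod_unfold)
  qed
  have Xc: "continuous_on (UNIV \<times> W \<times> UNIV) (\<lambda>(t, w, x). X t w x)"
    unfolding continuous_on_eq_continuous_within
  proof
    fix p :: "real \<times> 'w \<times> real" assume p: "p \<in> UNIV \<times> W \<times> UNIV"
    define T where "T = \<bar>fst p\<bar> + 1"
    have "continuous_on ({-T..T} \<times> W \<times> UNIV) (\<lambda>(t, w, x). X t w x)"
      by (rule uniform_limit_theorem[OF _ lim]) (auto intro!: always_eventually continuous_on_subset[OF Pc])
    moreover have "p \<in> {-T..T} \<times> W \<times> UNIV" using p by (auto simp: T_def)
    ultimately have "continuous (at p within {-T..T} \<times> W \<times> UNIV) (\<lambda>(t, w, x). X t w x)"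
      by (auto simp: continuous_on_eq_continuous_within)
    moreover have "at p within {-T..T} \<times> W \<times> UNIV = at p within UNIV \<times> W \<times> UNIV"
      by (rule at_within_nhd[of _ "{-T<..<T} \<times> UNIV"]) (use p in \<open>auto simp: T_def open_Times\<close>)
    ultimately show "continuous (at p within UNIV \<times> W \<times> UNIV) (\<lambda>(t, w, x). X t w x)" by simp
  qed
  have Xeq: "X t w x = x + integral {0..1} (\<lambda>r. t * F (\<sigma> (t * r) w) (X (t * r) w x))" if w: "w \<in> W" for t w x
  proof -
    have ul: "uniform_limit {0..1} (\<lambda>n r. t * F (\<sigma> (t * r) w) (P n (t * r) w x))
       (\<lambda>r. t * F (\<sigma> (t * r) w) (X (t * r) w x)) sequentially"
    proof (rule uniform_limitI)
      fix e :: real assume "e > 0"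
      define d where "d = e / (\<bar>t\<bar> * L + 1)"
      have pos: "\<bar>t\<bar> * L + 1 > 0" using L(1) by (simp add: add_nonneg_pos)
      then have "d > 0" using \<open>e>0\<close> by (simp add: d_def)
      from uniform_limitD[OF lim this, of "\<bar>t\<bar>"]
      show "\<forall>\<^sub>F n in sequentially. \<forall>r\<in>{0..1}. dist (t * F (\<sigma> (t * r) w) (P n (t * r) w x)) (t * F (\<sigma> (t * r) w) (X (t * r) w x)) < e"
      proof (eventually_elim, intro ballI)
        fix n and r :: real
        assume n: "\<forall>p\<in>{- \<bar>t\<bar>..\<bar>t\<bar>} \<times> W \<times> UNIV. dist (case p of (t, w, x) \<Rightarrow> P n t w x) (case p of (t, w, x) \<Rightarrow> X t w x) < d"
          and r: "r \<in> {0..1}"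
        have "\<bar>t * r\<bar> \<le> \<bar>t\<bar>" using r by (auto simp: abs_mult mult_left_le)
        then have "dist (P n (t * r) w x) (X (t * r) w x) < d" using n w by (auto simp: abs_le_iff)
        then have 1: "\<bar>P n (t * r) w x - X (t * r) w x\<bar> < d" by (simp add: dist_real_def)
        have "dist (t * F (\<sigma> (t * r) w) (P n (t * r) w x)) (t * F (\<sigma> (t * r) w) (X (t * r) w x))
          = \<bar>t\<bar> * \<bar>F (\<sigma> (t * r) w) (P n (t * r) w x) - F (\<sigma> (t * r) w) (X (t * r) w x)\<bar>"
          by (simp add: dist_real_def right_diff_distrib[symmetric] abs_mult)
        also have "\<dots> \<le> \<bar>t\<bar> * (L * \<bar>P n (t * r) w x - X (t * r) w x\<bar>)"
          by (intro mult_left_mono L \<sigma>W w) simp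
        also have "\<dots> \<le> (\<bar>t\<bar> * L) * d"
          using 1 L(1) by (simp add: mult.assoc mult_left_mono)
        also have "\<dots> < (\<bar>t\<bar> * L + 1) * d" using \<open>d > 0\<close> by (simp add: algebra_simps)
        also have "\<dots> = e" using pos by (simp add: d_def)
        finally show "dist (t * F (\<sigma> (t * r) w) (P n (t * r) w x)) (t * F (\<sigma> (t * r) w) (X (t * r) w x)) < e" .
      qed
    qed
    obtain I J where I: "\<And>n. ((\<lambda>r. t * F (\<sigma> (t * r) w) (P n (t * r) w x)) has_integral I n) {0..1}"
      and J: "((\<lambda>r. t * F (\<sigma> (t * r) w) (X (t * r) w x)) has_integral J) {0..1}" and IJ: "I \<longlonglongrightarrow> J"
      by (rule uniform_limit_integral[OF ul slice[OF Pc w] sequentially_bot], rule that)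
    have "P (Suc n) t w x = x + I n" for n unfolding PS integral_unique[OF I] ..
    then have "(\<lambda>n. P (Suc n) t w x) \<longlonglongrightarrow> x + J" using IJ by (auto intro!: tendsto_intros)
    moreover have "- \<bar>t\<bar> \<le> t \<and> t \<le> \<bar>t\<bar>" by linarith
    then have "(\<lambda>n. P n t w x) \<longlonglongrightarrow> X t w x"
      using tendsto_uniform_limitI[OF lim[of "\<bar>t\<bar>"], of "(t, w, x)"] w by auto
    then have "(\<lambda>n. P (Suc n) t w x) \<longlonglongrightarrow> X t w x" by (rule LIMSEQ_Suc)
    ultimately show ?thesis using LIMSEQ_unique integral_unique[OF J] by metis
  qed
  show ?thesis
  proof
    show "continuous_on (UNIV \<times> W \<times> UNIV) (\<lambda>(t, w, x). X t w x)" by (rule Xc)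
    show "X 0 w x = x" if "w \<in> W" for w x using Xeq[OF that, of 0 x] by simp
    fix w x t assume w: "w \<in> W"
    let ?h = "\<lambda>s. F (\<sigma> s w) (X s w x)"
    have s: "continuous_on UNIV (\<lambda>s. \<sigma> s w)" by (rule continuous_flow_orbit_continuous[OF \<sigma> w])
    have "continuous_on UNIV (\<lambda>s. (\<lambda>(t, w, x). X t w x) (s, w, x))"
      by (rule continuous_on_compose2[OF Xc]) (use w in \<open>auto intro!: continuous_intros\<close>)
    then have xs: "continuous_on UNIV (\<lambda>s. X s w x)" by simp
    have "continuous_on UNIV (\<lambda>s. (\<lambda>(w, x). F w x) (\<sigma> s w, X s w x))"
      by (rule continuous_on_compose2[OF F continuous_on_Pair[OF s xs]]) (use \<sigma>W[OF w] in auto)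
    then have "continuous_on UNIV ?h" by simp
    then obtain H where H: "\<And>u. (H has_real_derivative ?h u) (at u)"
      by (rule continuous_has_antiderivative) (rule that)
    have "X s w x = x + (H s - H 0)" for s
    proof -
      have "((\<lambda>r. H (s * r)) has_real_derivative s * ?h (s * r)) (at r)" for r
      proof -
        have "((\<lambda>r. s * r) has_real_derivative s) (at r)" by (auto intro!: derivative_eq_intros)
        from DERIV_chain2[where f=H and g="\<lambda>r. s * r", OF H this] show ?thesis by (simp add: mult.commute)
      qed
      from FTC_real[OF _ this, of 0 1] show ?thesis using Xeq[OF w, of s x] by simp
    qed
    then have "(\<lambda>s. X s w x) = (\<lambda>s. x + (H s - H 0))" by auto
    then show "((\<lambda>s. X s w x) has_real_derivative F (\<sigma> t w) (X t w x)) (at t)"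
      using H[of t] by (auto intro!: derivative_eq_intros)
  qed
qed

section \<open>Dissipative families and clamped flows\<close>

text \<open>The function \<open>q\<close> is the derivative of the right-hand side \<open>f\<close> in \<open>x\<close>. Outside of the strip
\<open>\<bar>x\<bar> < R0\<close> the field points strictly inwards, which is what coercivity of the nonlinearity
provides.\<close>

locale dissipative_family =
  fixes W :: "'w::metric_space set" and \<sigma> :: "real \<Rightarrow> 'w \<Rightarrow> 'w"
    and f q :: "'w \<Rightarrow> real \<Rightarrow> real" and R0 :: real
  assumes compact_base: "compact W"
    and base_flow: "continuous_flow W \<sigma>"
    and base_minimal: "minimal_flow W \<sigma>"
    and f_deriv: "\<And>w x. w \<in> W \<Longrightarrow> (f w has_real_derivative q w x) (at x)"
    and f_cont: "continuous_on (W \<times> UNIV) (\<lambda>(w, x). f w x)"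
    and q_cont: "continuous_on (W \<times> UNIV) (\<lambda>(w, x). q w x)"
    and R0_pos: "0 < R0"
    and inward_above: "\<And>w x. w \<in> W \<Longrightarrow> R0 \<le> x \<Longrightarrow> f w x < 0"
    and inward_below: "\<And>w x. w \<in> W \<Longrightarrow> x \<le> - R0 \<Longrightarrow> 0 < f w x"
begin

lemma base_closed [simp]: "w \<in> W \<Longrightarrow> \<sigma> t w \<in> W"
  and base_zero [simp]: "w \<in> W \<Longrightarrow> \<sigma> 0 w = w"
  and base_add: "w \<in> W \<Longrightarrow> \<sigma> (s + t) w = \<sigma> s (\<sigma> t w)"
  and base_cont: "continuous_on (UNIV \<times> W) (\<lambda>(t, w). \<sigma> t w)"
  using base_flow by (auto simp: continuous_flow_def)

lemma f_lipschitz_on_strip: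
  obtains L where "0 \<le> L"
    "\<And>w x y. w \<in> W \<Longrightarrow> x \<in> {-r..r} \<Longrightarrow> y \<in> {-r..r} \<Longrightarrow> \<bar>f w x - f w y\<bar> \<le> L * \<bar>x - y\<bar>"
proof -
  have "compact (W \<times> {-r..r})" using compact_base by (intro compact_Times) auto
  moreover have "continuous_on (W \<times> {-r..r}) (\<lambda>(w, x). q w x)" by (rule continuous_on_subset[OF q_cont]) auto
  ultimately obtain B where "0 < B" and B: "\<And>p. p \<in> W \<times> {-r..r} \<Longrightarrow> \<bar>case p of (w, x) \<Rightarrow> q w x\<bar> \<le> B"
    by (rule continuous_on_compact_bounded) (rule that)
  show ?thesis
  proof (rule that[of B])
    fix w x y assume "w \<in> W" "x \<in> {-r..r}" "y \<in> {-r..r}"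
    then show "\<bar>f w x - f w y\<bar> \<le> B * \<bar>x - y\<bar>"
      using field_differentiable_bound[of "{-r..r}" "f w" "q w" B x y, OF _ f_deriv[THEN has_field_derivative_at_within]] B
      by auto
  qed (use \<open>0 < B\<close> in auto)
qed

text \<open>The two solutions are bounded on the compact interval between 0 and \<open>t\<close>, and on a bounded strip the
field is Lipschitz.\<close>

lemma solution_unique:
  assumes u: "is_solution \<sigma> f w x I u" and v: "is_solution \<sigma> f w x J v"
    and w: "w \<in> W" and t: "t \<in> I" "t \<in> J"
  shows "u t = v t"
proof -
  let ?K = "{min 0 t..max 0 t}"
  have K: "?K \<subseteq> I" "?K \<subseteq> J"
    using u v t by (auto simp: is_solution_def min_def max_def split: if_splits intro: mem_is_interval_1_I)
  have du: "(u has_real_derivative f (\<sigma> s w) (u s)) (at s)"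
    and dv: "(v has_real_derivative f (\<sigma> s w) (v s)) (at s)" if "s \<in> ?K" for s
    using u v K that unfolding is_solution_def by blast+
  have "continuous_on ?K u" "continuous_on ?K v"
    using du dv by (meson DERIV_isCont continuous_at_imp_continuous_on)+
  then obtain A B where "0 < A" "0 < B" and A: "\<And>s. s \<in> ?K \<Longrightarrow> \<bar>u s\<bar> \<le> A" and B: "\<And>s. s \<in> ?K \<Longrightarrow> \<bar>v s\<bar> \<le> B"
    using continuous_on_compact_bounded[of ?K] by (metis compact_Icc)
  obtain L where L: "\<And>w x y. w \<in> W \<Longrightarrow> x \<in> {-max A B..max A B} \<Longrightarrow> y \<in> {-max A B..max A B} \<Longrightarrow> \<bar>f w x - f w y\<bar> \<le> L * \<bar>x - y\<bar>"
    by (rule f_lipschitz_on_strip[of "max A B"]) (rule that)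
  have "u t - v t = 0"
  proof (rule zero_if_derivative_dominated[where z="\<lambda>s. u s - v s" and L=L and
      z'="\<lambda>s. f (\<sigma> s w) (u s) - f (\<sigma> s w) (v s)" and a="min 0 t" and b="max 0 t" and c=0])
    show "((\<lambda>s. u s - v s) has_real_derivative f (\<sigma> s w) (u s) - f (\<sigma> s w) (v s)) (at s)" if "s \<in> ?K" for s
      using du[OF that] dv[OF that] by (rule DERIV_diff)
    show "\<bar>f (\<sigma> s w) (u s) - f (\<sigma> s w) (v s)\<bar> \<le> L * \<bar>u s - v s\<bar>" if "s \<in> ?K" for s
      using A[OF that] B[OF that] by (intro L) (auto simp: w abs_le_iff)
  qed (use u v in \<open>auto simp: is_solution_def\<close>)
  then show ?thesis by simp
qed

lemma sol_eqI:
  assumes u: "is_solution \<sigma> f w x I u" and w: "w \<in> W" and t: "t \<in> I"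
  shows "sol \<sigma> f t w x = u t" "t \<in> sol_dom \<sigma> f w x"
proof -
  show "sol \<sigma> f t w x = u t"
    unfolding sol_def
  proof (rule the_equality)
    show "\<exists>I' u'. is_solution \<sigma> f w x I' u' \<and> t \<in> I' \<and> u t = u' t" using u t by blast
    show "y = u t" if "\<exists>I' u'. is_solution \<sigma> f w x I' u' \<and> t \<in> I' \<and> y = u' t" for y
      using that solution_unique[OF _ u w _ t] by blast
  qed
  show "t \<in> sol_dom \<sigma> f w x" unfolding sol_dom_def using u t by blast
qed

lemma sol_has_derivative:
  assumes t: "t \<in> sol_dom \<sigma> f w x" and w: "w \<in> W"
  shows "((\<lambda>s. sol \<sigma> f s w x) has_real_derivative f (\<sigma> t w) (sol \<sigma> f t w x)) (at t)"
proof -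
  obtain I u where u: "is_solution \<sigma> f w x I u" "t \<in> I" using t unfolding sol_dom_def by blast
  have "(u has_real_derivative f (\<sigma> t w) (u t)) (at t)" using u unfolding is_solution_def by blast
  then have "(u has_real_derivative f (\<sigma> t w) (sol \<sigma> f t w x)) (at t)"
    using sol_eqI(1)[OF u(1) w u(2)] by simp
  then show ?thesis
  proof (rule has_field_derivative_transform_within_open)
    show "open I" "t \<in> I" using u by (auto simp: is_solution_def)
    show "u s = sol \<sigma> f s w x" if "s \<in> I" for s using sol_eqI(1)[OF u(1) w that] by simp
  qed
qed

lemma sol_zero:
  assumes "sol_dom \<sigma> f w x \<noteq> {}" "w \<in> W"
  shows "sol \<sigma> f 0 w x = x"
proof -
  obtain I u where u: "is_solution \<sigma> f w x I u" using assms unfolding sol_dom_def by blast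
  then show ?thesis using sol_eqI(1)[OF u assms(2), of 0] by (auto simp: is_solution_def)
qed

lemma skew_invariant_orbit:
  assumes "skew_invariant W \<sigma> f S" "(w, x) \<in> S"
  shows "w \<in> W" "(\<sigma> t w, sol \<sigma> f t w x) \<in> S" "sol_dom \<sigma> f w x = UNIV"
proof -
  show "w \<in> W" "sol_dom \<sigma> f w x = UNIV" using assms unfolding skew_invariant_def by auto
  have "skew_flow \<sigma> f t (w, x) \<in> skew_flow \<sigma> f t ` S" using assms(2) by (rule imageI)
  then show "(\<sigma> t w, sol \<sigma> f t w x) \<in> S"
    using assms(1) unfolding skew_invariant_def by (simp add: skew_flow_def)
qed

text \<open>If the largest value of \<open>x\<close> on the set were at least \<open>R0\<close>, the field would point inwards at a point
where it is attained, and the orbit of this point would have come from farther out. The smallest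
value is treated in the same way.\<close>

lemma compact_invariant_in_strip:
  assumes S: "compact S" "skew_invariant W \<sigma> f S"
  shows "S \<subseteq> W \<times> {-R0..R0}"
proof (cases "S = {}")
  case False
  obtain w x where wx: "(w, x) \<in> S" and max: "\<And>v y. (v, y) \<in> S \<Longrightarrow> y \<le> x"
    using continuous_attains_sup[OF S(1) False continuous_on_snd[OF continuous_on_id]] by force
  obtain v y where vy: "(v, y) \<in> S" and min: "\<And>w x. (w, x) \<in> S \<Longrightarrow> y \<le> x"
    using continuous_attains_inf[OF S(1) False continuous_on_snd[OF continuous_on_id]] by force
  note ow = skew_invariant_orbit[OF S(2) wx] and ov = skew_invariant_orbit[OF S(2) vy]
  have "x < R0"
  proof (rule ccontr)
    assume "\<not> x < R0"
    then have "f w x < 0" using inward_above ow(1) by auto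
    then have "((\<lambda>s. sol \<sigma> f s w x) has_real_derivative f w x) (at 0)"
      using sol_has_derivative[of 0 w x] ow sol_zero[of w x] by simp
    from DERIV_neg_dec_left[OF this \<open>f w x < 0\<close>] obtain d where "d > 0"
      and d: "\<And>h. 0 < h \<Longrightarrow> h < d \<Longrightarrow> sol \<sigma> f 0 w x < sol \<sigma> f (0 - h) w x" by blast
    have "x < sol \<sigma> f (- (d/2)) w x" using d[of "d/2"] \<open>d > 0\<close> ow sol_zero[of w x] by simp
    then show False using max[OF ow(2)[of "- (d/2)"]] by simp
  qed
  moreover have "- R0 < y"
  proof (rule ccontr)
    assume "\<not> - R0 < y"
    then have "0 < f v y" using inward_below ov(1) by auto
    then have "((\<lambda>s. sol \<sigma> f s v y) has_real_derivative f v y) (at 0)"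
      using sol_has_derivative[of 0 v y] ov sol_zero[of v y] by simp
    from DERIV_pos_inc_left[OF this \<open>0 < f v y\<close>] obtain d where "d > 0"
      and d: "\<And>h. 0 < h \<Longrightarrow> h < d \<Longrightarrow> sol \<sigma> f (0 - h) v y < sol \<sigma> f 0 v y" by blast
    have "sol \<sigma> f (- (d/2)) v y < y" using d[of "d/2"] \<open>d > 0\<close> ov sol_zero[of v y] by simp
    then show False using min[OF ov(2)[of "- (d/2)"]] by simp
  qed
  moreover have "S \<subseteq> W \<times> UNIV" using S(2) by (simp add: skew_invariant_def)
  ultimately show ?thesis using max min by fastforce
qed simp

definition clamped :: "real \<Rightarrow> 'w \<Rightarrow> real \<Rightarrow> real" where
  "clamped R w x = f w (max (- R) (min R x))"

lemma clamped_eq: "\<bar>x\<bar> \<le> R \<Longrightarrow> clamped R w x = f w x"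
  by (simp add: clamped_def abs_le_iff)

lemma clamped_lipschitz:
  assumes "0 < R"
  obtains L where "0 \<le> L" "\<And>w x y. w \<in> W \<Longrightarrow> \<bar>clamped R w x - clamped R w y\<bar> \<le> L * \<bar>x - y\<bar>"
proof -
  have range: "max (- R) (min R x) \<in> {-R..R}" for x using assms by auto
  obtain L where L: "0 \<le> L" "\<And>w x y. w \<in> W \<Longrightarrow> x \<in> {-R..R} \<Longrightarrow> y \<in> {-R..R} \<Longrightarrow> \<bar>f w x - f w y\<bar> \<le> L * \<bar>x - y\<bar>"
    by (rule f_lipschitz_on_strip[of R]) (rule that)
  show ?thesis
  proof (rule that[OF L(1)])
    fix w x y assume "w \<in> W"
    have "\<bar>max (- R) (min R x) - max (- R) (min R y)\<bar> \<le> \<bar>x - y\<bar>" by (auto simp: max_def min_def)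
    then show "\<bar>clamped R w x - clamped R w y\<bar> \<le> L * \<bar>x - y\<bar>" unfolding clamped_def
      using L(2)[OF \<open>w \<in> W\<close> range range, of x y] mult_left_mono[OF _ L(1)] by (meson order_trans)
  qed
qed

lemma clamped_flow_exists:
  assumes "0 < R"
  obtains X where "continuous_on (UNIV \<times> W \<times> UNIV) (\<lambda>(t, w, x). X t w x)"
    "\<And>w x. w \<in> W \<Longrightarrow> X 0 w x = x"
    "\<And>w x t. w \<in> W \<Longrightarrow> ((\<lambda>s. X s w x) has_real_derivative clamped R (\<sigma> t w) (X t w x)) (at t)"
proof -
  have range: "max (- R) (min R x) \<in> {-R..R}" for x using assms by auto
  have "compact (W \<times> {-R..R})" using compact_base by (intro compact_Times) auto
  moreover have "continuous_on (W \<times> {-R..R}) (\<lambda>(w, x). f w x)" by (rule continuous_on_subset[OF f_cont]) auto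
  ultimately obtain B where "0 < B" and B: "\<And>p. p \<in> W \<times> {-R..R} \<Longrightarrow> \<bar>case p of (w, x) \<Rightarrow> f w x\<bar> \<le> B"
    by (rule continuous_on_compact_bounded) (rule that)
  obtain L where L: "0 \<le> L" "\<And>w x y. w \<in> W \<Longrightarrow> \<bar>clamped R w x - clamped R w y\<bar> \<le> L * \<bar>x - y\<bar>"
    by (rule clamped_lipschitz[OF assms]) (rule that)
  show ?thesis
  proof (rule global_solution_family[OF base_flow, of "clamped R" B L])
    have "continuous_on (W \<times> UNIV) (\<lambda>p. (\<lambda>(w, x). f w x) (fst p, max (- R) (min R (snd p))))"
      by (rule continuous_on_compose2[OF f_cont]) (auto intro!: continuous_intros)
    then show "continuous_on (W \<times> UNIV) (\<lambda>(w, x). clamped R w x)" by (simp add: clamped_def case_prod_unfold)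
    show "\<bar>clamped R w x\<bar> \<le> B" if "w \<in> W" for w x
      unfolding clamped_def using B[of "(w, max (- R) (min R x))"] range that by auto
    show "\<bar>clamped R w x - clamped R w y\<bar> \<le> L * \<bar>x - y\<bar>" if "w \<in> W" for w x y by (rule L(2)[OF that])
  qed (use L that in blast)+
qed

end

text \<open>The solutions \<open>X t w x\<close> of the clamped equation exist for all times and define the skew-product flow
\<open>\<Psi>\<close>. The bound \<open>R\<close> stays a parameter because each bounded set of initial values calls for its own
strip.\<close>

locale clamped_flow = dissipative_family +
  fixes R :: real and X :: "real \<Rightarrow> 'a \<Rightarrow> real \<Rightarrow> real"
  assumes R: "R0 < R"
    and X_cont: "continuous_on (UNIV \<times> W \<times> UNIV) (\<lambda>(t, w, x). X t w x)"
    and X_zero [simp]: "\<And>w x. w \<in> W \<Longrightarrow> X 0 w x = x"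
    and X_deriv: "\<And>w x t. w \<in> W \<Longrightarrow> ((\<lambda>s. X s w x) has_real_derivative clamped R (\<sigma> t w) (X t w x)) (at t)"
begin

lemma X_solves:
  assumes "w \<in> W" "\<bar>X t w x\<bar> \<le> R"
  shows "((\<lambda>s. X s w x) has_real_derivative f (\<sigma> t w) (X t w x)) (at t)"
  using X_deriv[OF assms(1), of x t] clamped_eq[OF assms(2)] by simp

lemma X_unique:
  assumes w: "w \<in> W" and u: "\<And>s. (u has_real_derivative clamped R (\<sigma> s w) (u s)) (at s)"
  shows "u t = X t w (u 0)"
proof -
  obtain L where L: "\<And>w x y. w \<in> W \<Longrightarrow> \<bar>clamped R w x - clamped R w y\<bar> \<le> L * \<bar>x - y\<bar>"
    by (rule clamped_lipschitz[of R]) (use R R0_pos in \<open>auto intro: that\<close>)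
  have "u t - X t w (u 0) = 0"
  proof (rule zero_if_derivative_dominated[where z="\<lambda>s. u s - X s w (u 0)" and L=L and
      z'="\<lambda>s. clamped R (\<sigma> s w) (u s) - clamped R (\<sigma> s w) (X s w (u 0))" and a="min 0 t" and b="max 0 t" and c=0])
    show "((\<lambda>s. u s - X s w (u 0)) has_real_derivative
        clamped R (\<sigma> s w) (u s) - clamped R (\<sigma> s w) (X s w (u 0))) (at s)" for s
      using u X_deriv[OF w] by (rule DERIV_diff)
    show "\<bar>clamped R (\<sigma> s w) (u s) - clamped R (\<sigma> s w) (X s w (u 0))\<bar> \<le> L * \<bar>u s - X s w (u 0)\<bar>" for s
      by (intro L) (simp add: w)
  qed (use w in auto)
  then show ?thesis by simp
qed

lemma X_add:
  assumes w: "w \<in> W"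
  shows "X (s + t) w x = X s (\<sigma> t w) (X t w x)"
proof -
  have "((\<lambda>s. X (s + t) w x) has_real_derivative clamped R (\<sigma> s (\<sigma> t w)) (X (s + t) w x)) (at s)" for s
    using X_deriv[OF w, of x "s + t"] by (simp add: DERIV_shift base_add[OF w])
  from X_unique[OF base_closed[OF w] this, of s] show ?thesis by simp
qed

text \<open>The solution attains its maximum over \<open>{0..t}\<close>; if this were larger than \<open>r\<close>, it would not be at
time 0, and the inward field would make the solution larger just before.\<close>

lemma X_stays_in_strip:
  assumes w: "w \<in> W" and r: "R0 \<le> r" "\<bar>x\<bar> \<le> r" and t: "0 \<le> t"
  shows "\<bar>X t w x\<bar> \<le> r"
proof -
  have cont: "continuous_on {0..t} (\<lambda>s. X s w x)"
    using X_deriv[OF w] by (meson DERIV_isCont continuous_at_imp_continuous_on)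
  have ne: "{0..t} \<noteq> {}" using t by auto
  obtain s where s: "s \<in> {0..t}" and smax: "\<And>s'. s' \<in> {0..t} \<Longrightarrow> X s' w x \<le> X s w x"
    using continuous_attains_sup[OF compact_Icc ne cont] by blast
  obtain s2 where s2: "s2 \<in> {0..t}" and smin: "\<And>s'. s' \<in> {0..t} \<Longrightarrow> X s2 w x \<le> X s' w x"
    using continuous_attains_inf[OF compact_Icc ne cont] by blast
  have "X s w x \<le> r"
  proof (rule ccontr)
    assume c: "\<not> X s w x \<le> r"
    then have "s > 0" using s r w by (cases "s = 0") auto
    have "clamped R (\<sigma> s w) (X s w x) < 0"
      unfolding clamped_def using c r R R0_pos w by (intro inward_above) auto
    from DERIV_neg_dec_left[OF X_deriv[OF w] this] obtain d where "d > 0"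
      and d: "\<And>h. 0 < h \<Longrightarrow> h < d \<Longrightarrow> X s w x < X (s - h) w x" by blast
    then have "X s w x < X (s - min s (d/2)) w x" using \<open>s > 0\<close> by (intro d) auto
    then show False using smax[of "s - min s (d/2)"] s \<open>s > 0\<close> \<open>d > 0\<close> by (auto simp: min_def split: if_splits)
  qed
  moreover have "- r \<le> X s2 w x"
  proof (rule ccontr)
    assume c: "\<not> - r \<le> X s2 w x"
    then have "s2 > 0" using s2 r w by (cases "s2 = 0") auto
    have "clamped R (\<sigma> s2 w) (X s2 w x) > 0"
      unfolding clamped_def using c r R R0_pos w by (intro inward_below) auto
    from DERIV_pos_inc_left[OF X_deriv[OF w] this] obtain d where "d > 0"
      and d: "\<And>h. 0 < h \<Longrightarrow> h < d \<Longrightarrow> X (s2 - h) w x < X s2 w x" by blast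
    then have "X (s2 - min s2 (d/2)) w x < X s2 w x" using \<open>s2 > 0\<close> by (intro d) auto
    then show False using smin[of "s2 - min s2 (d/2)"] s2 \<open>s2 > 0\<close> \<open>d > 0\<close> by (auto simp: min_def split: if_splits)
  qed
  ultimately show ?thesis using smax[of t] smin[of t] t by auto
qed

text \<open>A solution in the sense of \<open>is_solution\<close> lives on an open interval around 0. The strict inequality
\<open>r < R\<close> leaves room to go back a little in time without reaching the clamped region.\<close>

lemma X_is_sol_forward:
  assumes w: "w \<in> W" and r: "R0 \<le> r" "r < R" "\<bar>x\<bar> \<le> r" and t: "0 \<le> t"
  shows "sol \<sigma> f t w x = X t w x" "t \<in> sol_dom \<sigma> f w x"
proof -
  have "isCont (\<lambda>s. X s w x) 0" using X_deriv[OF w] DERIV_isCont by blast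
  then have "\<forall>\<^sub>F s in at 0. dist (X s w x) (X 0 w x) < R - r"
    using r by (intro tendstoD) (auto simp: isCont_def)
  then obtain d where "d > 0" and d: "\<And>s. s \<noteq> 0 \<Longrightarrow> \<bar>s\<bar> < d \<Longrightarrow> \<bar>X s w x - x\<bar> < R - r"
    using w by (auto simp: eventually_at dist_real_def)
  have bd: "\<bar>X s w x\<bar> \<le> R" if "s > - d" for s
  proof (cases "s < 0")
    case True
    then show ?thesis using d[of s] that r(3) by linarith
  next
    case False
    then show ?thesis using X_stays_in_strip[OF w r(1,3), of s] r(2) by linarith
  qed
  have "is_solution \<sigma> f w x {-d<..} (\<lambda>s. X s w x)"
    unfolding is_solution_def
    using X_solves[OF w] bd \<open>d > 0\<close> w by auto
  from sol_eqI[OF this w] show "sol \<sigma> f t w x = X t w x" "t \<in> sol_dom \<sigma> f w x" using t \<open>d > 0\<close> by auto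
qed

lemma X_is_sol_if_bounded:
  assumes w: "w \<in> W" and bd: "\<And>t. \<bar>X t w x\<bar> \<le> R"
  shows "sol \<sigma> f t w x = X t w x" "sol_dom \<sigma> f w x = UNIV"
proof -
  have "is_solution \<sigma> f w x UNIV (\<lambda>s. X s w x)"
    unfolding is_solution_def using X_solves[OF w] bd w by auto
  from sol_eqI[OF this w] show "sol \<sigma> f t w x = X t w x" "sol_dom \<sigma> f w x = UNIV" by auto
qed

definition \<Psi> :: "real \<Rightarrow> 'a \<times> real \<Rightarrow> 'a \<times> real" where
  "\<Psi> t = (\<lambda>(w, x). (\<sigma> t w, X t w x))"

lemma \<Psi>_pair [simp]: "\<Psi> t (w, x) = (\<sigma> t w, X t w x)"
  by (simp add: \<Psi>_def)

lemma \<Psi>_flow: "continuous_flow (W \<times> UNIV) \<Psi>"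
  unfolding continuous_flow_def
proof (intro conjI allI ballI)
  fix s t :: real and p :: "'a \<times> real" assume "p \<in> W \<times> UNIV"
  then obtain w x where p: "p = (w, x)" "w \<in> W" by auto
  then show "\<Psi> t p \<in> W \<times> UNIV" "\<Psi> 0 p = p" "\<Psi> (s + t) p = \<Psi> s (\<Psi> t p)"
    by (auto simp: base_add X_add)
next
  have s: "continuous_on (UNIV \<times> W \<times> (UNIV :: real set)) (\<lambda>p. (\<lambda>(t, w). \<sigma> t w) (fst p, fst (snd p)))"
    by (rule continuous_on_compose2[OF base_cont]) (auto intro!: continuous_intros)
  show "continuous_on (UNIV \<times> W \<times> UNIV) (\<lambda>(t, p). \<Psi> t p)"
    using continuous_on_Pair[OF s X_cont] by (simp add: \<Psi>_def case_prod_unfold)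
qed

text \<open>For compact sets this notion coincides with invariance under the original local flow, see
\<open>skew_invariant_iff\<close>, but it refers to the global flow \<open>\<Psi>\<close> only.\<close>

definition invariant :: "('a \<times> real) set \<Rightarrow> bool" where
  "invariant S \<longleftrightarrow> S \<subseteq> W \<times> {-R..R} \<and> (\<forall>t. \<forall>p\<in>S. \<Psi> t p \<in> S)"

lemma invariant_flow: "invariant S \<Longrightarrow> continuous_flow S \<Psi>"
  using \<Psi>_flow unfolding continuous_flow_def invariant_def
  by (auto 4 4 intro: continuous_on_subset)

lemma invariant_sol:
  assumes "invariant S" "(w, x) \<in> S"
  shows "sol \<sigma> f t w x = X t w x" "sol_dom \<sigma> f w x = UNIV"
proof -
  have "\<bar>X t w x\<bar> \<le> R" for t
  proof -
    have "\<Psi> t (w, x) \<in> W \<times> {-R..R}" using assms unfolding invariant_def by blast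
    then show ?thesis by auto
  qed
  moreover have "w \<in> W" using assms unfolding invariant_def by blast
  ultimately show "sol \<sigma> f t w x = X t w x" "sol_dom \<sigma> f w x = UNIV" using X_is_sol_if_bounded by auto
qed

lemma invariant_skew_flow:
  assumes "invariant S" "p \<in> S" shows "skew_flow \<sigma> f t p = \<Psi> t p"
  using invariant_sol[OF assms(1)] assms(2) by (cases p) (auto simp: skew_flow_def)

lemma invariant_image:
  assumes "invariant S" shows "\<Psi> t ` S = S"
proof -
  note fl = invariant_flow[OF assms]
  have "p \<in> \<Psi> t ` S" if "p \<in> S" for p
  proof (rule image_eqI)
    show "\<Psi> (- t) p \<in> S" using fl that by (auto simp: continuous_flow_def)
    show "p = \<Psi> t (\<Psi> (- t) p)" using fl that unfolding continuous_flow_def by (metis add.right_inverse)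
  qed
  moreover have "\<Psi> t ` S \<subseteq> S" using assms unfolding invariant_def by blast
  ultimately show ?thesis by blast
qed

text \<open>Both directions rest on boundedness: an orbit that stays in the strip solves the clamped equation if
and only if it solves the original one.\<close>

lemma skew_invariant_iff:
  assumes "compact S" shows "skew_invariant W \<sigma> f S \<longleftrightarrow> invariant S"
proof
  assume S: "skew_invariant W \<sigma> f S"
  note strip = compact_invariant_in_strip[OF assms S]
  have "(\<sigma> t w, X t w x) \<in> S" if "(w, x) \<in> S" for t w x
  proof -
    note o = skew_invariant_orbit[OF S that]
    have "\<bar>sol \<sigma> f s w x\<bar> \<le> R" for s
    proof -
      have "sol \<sigma> f s w x \<in> {-R0..R0}" using strip o(2)[of s] by blast
      then show ?thesis using R by auto
    qed
    then have "((\<lambda>s. sol \<sigma> f s w x) has_real_derivative clamped R (\<sigma> s w) (sol \<sigma> f s w x)) (at s)" for s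
      using sol_has_derivative[of s w x] o by (simp add: clamped_eq)
    from X_unique[OF o(1) this, of t] show ?thesis using o sol_zero[of w x] by (metis UNIV_not_empty)
  qed
  moreover have "S \<subseteq> W \<times> {-R..R}" by (rule order.trans[OF strip]) (use R in auto)
  ultimately show "invariant S" unfolding invariant_def by auto
next
  assume S: "invariant S"
  have "skew_flow \<sigma> f t ` S = \<Psi> t ` S" for t
    using invariant_skew_flow[OF S] by (auto intro!: image_cong)
  then show "skew_invariant W \<sigma> f S"
    unfolding skew_invariant_def using invariant_image[OF S] invariant_sol(2)[OF S] S
    by (auto simp: invariant_def)
qed

lemma invariant_in_strip:
  "compact S \<Longrightarrow> invariant S \<Longrightarrow> S \<subseteq> W \<times> {-R0..R0}"
  using compact_invariant_in_strip skew_invariant_iff by blast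

lemma skew_minimal_iff:
  "skew_minimal W \<sigma> f M \<longleftrightarrow> M \<noteq> {} \<and> compact M \<and> invariant M \<and>
     (\<forall>S. S \<subseteq> M \<and> S \<noteq> {} \<and> compact S \<and> invariant S \<longrightarrow> S = M)"
  unfolding skew_minimal_def using skew_invariant_iff by blast

end

section \<open>Limit sets and minimal sets\<close>

text \<open>The set is the usual limit set of the forward orbit, the intersection of the closures of its tails.
Only the forward orbit is assumed to stay in a compact set, but the limit set is invariant for
all times.\<close>

lemma limit_set_compact_invariant:
  fixes \<phi> :: "real \<Rightarrow> 'a::metric_space \<Rightarrow> 'a"
  assumes \<phi>: "continuous_flow Y \<phi>" and p: "p \<in> Y" and K: "compact K" "K \<subseteq> Y"
    and stays: "\<And>t. 0 \<le> t \<Longrightarrow> \<phi> t p \<in> K"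
  obtains S where "compact S" "S \<noteq> {}" "S \<subseteq> K" "\<And>t x. x \<in> S \<Longrightarrow> \<phi> t x \<in> S"
    "\<And>n. S \<subseteq> closure ((\<lambda>t. \<phi> t p) ` {real n..})"
proof -
  define C where "C n = closure ((\<lambda>t. \<phi> t p) ` {real n..})" for n :: nat
  define S where "S = (\<Inter>n. C n)"
  have CK: "C n \<subseteq> K" for n
    unfolding C_def using stays compact_imp_closed[OF K(1)] by (intro closure_minimal) auto
  have mono: "C n \<subseteq> C m" if "m \<le> n" for m n
    unfolding C_def using that by (intro closure_mono image_mono) auto
  have "K \<inter> (\<Inter>n\<in>UNIV. C n) \<noteq> {}"
  proof (rule compact_imp_fip_image[OF K(1)])
    show "closed (C n)" for n by (simp add: C_def)
    fix I :: "nat set" assume I: "finite I"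
    have "C (Max (insert 0 I)) \<subseteq> C n" if "n \<in> I" for n using I that by (intro mono) auto
    then have "C (Max (insert 0 I)) \<subseteq> K \<inter> (\<Inter>n\<in>I. C n)" using CK by blast
    moreover have "C n \<noteq> {}" for n by (auto simp: C_def)
    ultimately show "K \<inter> (\<Inter>n\<in>I. C n) \<noteq> {}" by blast
  qed
  then have ne: "S \<noteq> {}" unfolding S_def by blast
  have SK: "S \<subseteq> K" unfolding S_def using CK by blast
  have cS: "compact S"
  proof -
    have "closed S" unfolding S_def C_def by auto
    then show ?thesis using K(1) SK by (metis compact_Int_closed inf.absorb2)
  qed
  have inv: "\<phi> t x \<in> S" if x: "x \<in> S" for t x
    unfolding S_def
  proof
    fix n
    obtain m :: nat where m: "real m \<ge> real n - t" using real_arch_simple by blast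
    have "\<phi> t ` closure ((\<lambda>t. \<phi> t p) ` {real m..}) \<subseteq> C n"
    proof (rule image_closure_subset)
      show "continuous_on (closure ((\<lambda>t. \<phi> t p) ` {real m..})) (\<phi> t)"
        using continuous_flow_time_map_continuous[OF \<phi>] CK[of m] K(2) unfolding C_def
        by (meson continuous_on_subset order.trans)
      show "closed (C n)" by (simp add: C_def)
      show "\<phi> t ` (\<lambda>t. \<phi> t p) ` {real m..} \<subseteq> C n"
      proof clarify
        fix s assume "real m \<le> s"
        then have "real n \<le> t + s" using m by linarith
        moreover have "\<phi> (t + s) p = \<phi> t (\<phi> s p)" using \<phi> p by (simp add: continuous_flow_def)
        ultimately show "\<phi> t (\<phi> s p) \<in> C n"
          unfolding C_def by (metis atLeast_iff closure_subset imageI subsetD)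
      qed
    qed
    moreover have "x \<in> C m" using x unfolding S_def by blast
    ultimately show "\<phi> t x \<in> C n" unfolding C_def by blast
  qed
  show ?thesis
    by (rule that[OF cS ne SK inv]) (auto simp: S_def C_def)
qed

text \<open>Zorn's lemma for a property that is stable under intersections, applied to complements. A chain of
nonempty compact sets has a nonempty intersection by the finite intersection property.\<close>

lemma compact_minimal_subset:
  fixes S :: "'a::t2_space set"
  assumes S: "compact S" "S \<noteq> {}" "P S"
    and P: "\<And>\<C>. \<C> \<noteq> {} \<Longrightarrow> (\<And>X. X \<in> \<C> \<Longrightarrow> P X) \<Longrightarrow> P (\<Inter>\<C>)"
  obtains M where "M \<subseteq> S" "M \<noteq> {}" "compact M" "P M"
    "\<And>X. X \<subseteq> M \<Longrightarrow> X \<noteq> {} \<Longrightarrow> compact X \<Longrightarrow> P X \<Longrightarrow> X = M"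
proof -
  define \<A> where "\<A> = {X. X \<subseteq> S \<and> X \<noteq> {} \<and> compact X \<and> P X}"
  have "\<exists>U\<in>uminus ` \<A>. \<forall>X\<in>C. X \<subseteq> U" if C: "subset.chain (uminus ` \<A>) C" for C
  proof (cases "C = {}")
    case True then show ?thesis using S by (auto simp: \<A>_def)
  next
    case False
    define D where "D = uminus ` C"
    have D\<A>: "D \<subseteq> \<A>" using C unfolding D_def subset.chain_def by auto
    have chain: "X \<subseteq> Y \<or> Y \<subseteq> X" if "X \<in> D" "Y \<in> D" for X Y
    proof -
      obtain A B where "A \<in> C" "B \<in> C" "X = - A" "Y = - B" using \<open>X \<in> D\<close> \<open>Y \<in> D\<close> unfolding D_def by auto
      moreover have "A \<subseteq> B \<or> B \<subseteq> A" using C calculation(1,2) unfolding subset_chain_def by blast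
      ultimately show ?thesis by blast
    qed
    have "S \<inter> (\<Inter>X\<in>D. X) \<noteq> {}"
    proof (rule compact_imp_fip_image[OF S(1)])
      show "closed X" if "X \<in> D" for X using D\<A> that by (auto simp: \<A>_def compact_imp_closed)
      fix D' assume D': "finite D'" "D' \<subseteq> D"
      show "S \<inter> (\<Inter>X\<in>D'. X) \<noteq> {}"
      proof (cases "D' = {}")
        case False
        obtain m where m: "m \<in> D'" "\<And>X. X \<in> D' \<Longrightarrow> X \<subseteq> m \<Longrightarrow> m = X"
          using finite_has_minimal[OF D'(1) False] by blast
        then have "m \<subseteq> X" if "X \<in> D'" for X using chain[of m X] D'(2) that by blast
        moreover have "m \<in> \<A>" using m D'(2) D\<A> by blast
        ultimately show ?thesis unfolding \<A>_def by blast
      qed (use S in auto)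
    qed
    moreover have "D \<noteq> {}" using False by (auto simp: D_def)
    moreover have "compact (\<Inter>D)"
    proof -
      obtain Y where Y: "Y \<in> D" using \<open>D \<noteq> {}\<close> by blast
      have "compact X" if "X \<in> D" for X using that D\<A> by (auto simp: \<A>_def)
      then have "compact (Y \<inter> \<Inter>D)"
        using Y by (intro compact_Int_closed closed_Inter) (auto intro: compact_imp_closed)
      then show ?thesis using Y by (simp add: Int_absorb1 Inter_lower)
    qed
    ultimately have "\<Inter>D \<in> \<A>"
      using D\<A> P[of D] unfolding \<A>_def by auto
    moreover have "X \<subseteq> - \<Inter>D" if "X \<in> C" for X using that unfolding D_def by auto
    ultimately show ?thesis by blast
  qed
  then have "\<exists>N\<in>uminus ` \<A>. \<forall>X\<in>uminus ` \<A>. N \<subseteq> X \<longrightarrow> X = N" by (rule subset_Zorn)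
  then obtain M where M: "M \<in> \<A>" and max: "\<And>X. X \<in> \<A> \<Longrightarrow> - M \<subseteq> - X \<Longrightarrow> - X = - M"
    by (metis (no_types, lifting) imageE imageI)
  show ?thesis
  proof (rule that[of M])
    show "X = M" if "X \<subseteq> M" "X \<noteq> {}" "compact X" "P X" for X
      using max[of X] that M unfolding \<A>_def by auto
  qed (use M in \<open>simp_all add: \<A>_def\<close>)
qed

context dissipative_family
begin

lemma base_nonempty: "W \<noteq> {}"
  using base_minimal by (simp add: minimal_flow_def)

lemma base_minimalD:
  assumes "S \<subseteq> W" "S \<noteq> {}" "compact S" "\<And>t w. w \<in> S \<Longrightarrow> \<sigma> t w \<in> S"
  shows "S = W"
proof -
  have "w \<in> \<sigma> t ` S" if "w \<in> S" for t w
  proof (rule image_eqI)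
    have "w \<in> W" using that assms(1) by blast
    show "\<sigma> (- t) w \<in> S" using assms(4) that by blast
    show "w = \<sigma> t (\<sigma> (- t) w)" using base_add[OF \<open>w \<in> W\<close>, of t "- t"] \<open>w \<in> W\<close> by simp
  qed
  then have "\<forall>t. \<sigma> t ` S = S" using assms(4) by blast
  then show ?thesis using base_minimal assms unfolding minimal_flow_def by blast
qed

lemma reversed_base_flow: "continuous_flow W (\<lambda>t. \<sigma> (- t))"
proof -
  have "continuous_on (UNIV \<times> W) (\<lambda>p. (\<lambda>(t, w). \<sigma> t w) (- fst p, snd p))"
    by (rule continuous_on_compose2[OF base_cont]) (auto intro!: continuous_intros)
  moreover have "\<sigma> (- (s + t)) w = \<sigma> (- s) (\<sigma> (- t) w)" if "w \<in> W" for s t w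
    using base_add[OF that, of "- s" "- t"] by simp
  ultimately show ?thesis
    unfolding continuous_flow_def by (simp add: case_prod_unfold)
qed

text \<open>The limit set of the orbit under the reversed flow is nonempty, compact and invariant, hence equal
to the whole minimal base.\<close>

lemma backward_orbit_dense:
  assumes w: "w \<in> W" and v: "v \<in> W" and U: "open U" "v \<in> U"
  shows "\<exists>t\<ge>T. \<sigma> (- t) w \<in> U"
proof -
  obtain S where S: "compact S" "S \<noteq> {}" "S \<subseteq> W" "\<And>t x. x \<in> S \<Longrightarrow> \<sigma> (- t) x \<in> S"
    "\<And>n. S \<subseteq> closure ((\<lambda>t. \<sigma> (- t) w) ` {real n..})"
    by (rule limit_set_compact_invariant[OF reversed_base_flow w compact_base order.refl])
       (use w in \<open>auto intro: that\<close>)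
  have "\<sigma> t x \<in> S" if "x \<in> S" for t x using S(4)[OF that, of "- t"] by simp
  then have "S = W" by (rule base_minimalD[OF S(3,2,1)])
  obtain n :: nat where n: "T \<le> real n" using real_arch_simple by blast
  have "v \<in> closure ((\<lambda>t. \<sigma> (- t) w) ` {real n..})" using S(5) \<open>S = W\<close> v by blast
  then have "U \<inter> (\<lambda>t. \<sigma> (- t) w) ` {real n..} \<noteq> {}"
    using U open_Int_closure_eq_empty[OF U(1)] by blast
  then show ?thesis using n by fastforce
qed

end

context clamped_flow
begin

lemma skew_minimalD:
  assumes "skew_minimal W \<sigma> f M"
  shows "M \<noteq> {}" "compact M" "invariant M" "\<And>t p. p \<in> M \<Longrightarrow> \<Psi> t p \<in> M" "M \<subseteq> W \<times> {-R0..R0}"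
    and "\<And>S. S \<subseteq> M \<Longrightarrow> S \<noteq> {} \<Longrightarrow> compact S \<Longrightarrow> invariant S \<Longrightarrow> S = M"
proof -
  show *: "M \<noteq> {}" "compact M" "invariant M"
    and "\<And>S. S \<subseteq> M \<Longrightarrow> S \<noteq> {} \<Longrightarrow> compact S \<Longrightarrow> invariant S \<Longrightarrow> S = M"
    using assms unfolding skew_minimal_iff by blast+
  show "\<Psi> t p \<in> M" if "p \<in> M" for t p using *(3) that by (simp add: invariant_def)
  show "M \<subseteq> W \<times> {-R0..R0}" using invariant_in_strip * by blast
qed

lemma minimal_subset_exists:
  assumes "compact S" "S \<noteq> {}" "invariant S"
  obtains M where "M \<subseteq> S" "skew_minimal W \<sigma> f M"
proof (rule compact_minimal_subset[of S invariant])
  show "invariant (\<Inter>\<C>)" if "\<C> \<noteq> {}" "\<And>X. X \<in> \<C> \<Longrightarrow> invariant X" for \<C>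
    using that unfolding invariant_def by blast
  show thesis if "M \<subseteq> S" "M \<noteq> {}" "compact M" "invariant M"
    "\<And>X. X \<subseteq> M \<Longrightarrow> X \<noteq> {} \<Longrightarrow> compact X \<Longrightarrow> invariant X \<Longrightarrow> X = M" for M
    using that \<open>\<And>M. M \<subseteq> S \<Longrightarrow> skew_minimal W \<sigma> f M \<Longrightarrow> thesis\<close> by (simp add: skew_minimal_iff)
qed (rule assms)+

lemma minimal_in_forward_limit:
  assumes w: "w \<in> W" and x: "\<bar>x\<bar> \<le> R"
  obtains M where "skew_minimal W \<sigma> f M" "M \<subseteq> closure ((\<lambda>t. \<Psi> t (w, x)) ` {0..})"
proof -
  have K: "compact (W \<times> {-R..R})" using compact_base by (intro compact_Times) auto
  have stays: "\<Psi> t (w, x) \<in> W \<times> {-R..R}" if "0 \<le> t" for t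
    using X_stays_in_strip[OF w _ x that] R w by (auto simp: abs_le_iff)
  have wx: "(w, x) \<in> W \<times> UNIV" using w by simp
  obtain S where S: "compact S" "S \<noteq> {}" "S \<subseteq> W \<times> {-R..R}" "\<And>t p. p \<in> S \<Longrightarrow> \<Psi> t p \<in> S"
    "\<And>n. S \<subseteq> closure ((\<lambda>t. \<Psi> t (w, x)) ` {real n..})"
    by (rule limit_set_compact_invariant[OF \<Psi>_flow wx K _ stays]) (auto intro: that)
  have "invariant S" using S(3,4) unfolding invariant_def by (intro conjI allI ballI)
  then obtain M where "M \<subseteq> S" "skew_minimal W \<sigma> f M"
    by (rule minimal_subset_exists[OF S(1,2)]) (rule that)
  then show ?thesis using that S(5)[of 0] by auto
qed

lemma orbit_closure_of_minimal:
  assumes M: "skew_minimal W \<sigma> f M" and p: "p \<in> M"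
  shows "closure (range (\<lambda>t. \<Psi> t p)) = M"
proof -
  note inv = skew_minimalD(3,2)[OF M]
  let ?C = "closure (range (\<lambda>t. \<Psi> t p))"
  have M\<Psi>: "\<Psi> t p \<in> M" if "p \<in> M" for t p using inv(1) that unfolding invariant_def by simp
  have MW: "M \<subseteq> W \<times> {-R..R}" using inv(1) unfolding invariant_def by simp
  have CM: "?C \<subseteq> M"
    by (rule closure_minimal) (use M\<Psi>[OF p] compact_imp_closed[OF inv(2)] in \<open>simp_all add: image_subset_iff\<close>)
  have pW: "p \<in> W \<times> UNIV" using MW p by blast
  have C\<Psi>: "\<Psi> s ` ?C \<subseteq> ?C" for s
  proof (rule image_closure_subset)
    show "continuous_on ?C (\<Psi> s)"
      using continuous_flow_time_map_continuous[OF invariant_flow[OF inv(1)]] CM by (rule continuous_on_subset)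
    show "\<Psi> s ` range (\<lambda>t. \<Psi> t p) \<subseteq> ?C"
    proof (rule subsetI)
      fix z assume "z \<in> \<Psi> s ` range (\<lambda>t. \<Psi> t p)"
      then obtain t where z: "z = \<Psi> s (\<Psi> t p)" by blast
      have "\<Psi> s (\<Psi> t p) = \<Psi> (s + t) p" using pW by (auto simp: base_add X_add)
      then show "z \<in> ?C" unfolding z by (metis closure_subset rangeI subsetD)
    qed
  qed simp
  have "invariant ?C" unfolding invariant_def
    using order.trans[OF CM MW] C\<Psi> by (simp add: image_subset_iff)
  moreover have "compact ?C" using CM inv(2) by (metis closed_closure compact_Int_closed inf.absorb2)
  moreover have "?C \<noteq> {}" by simp
  ultimately show ?thesis using skew_minimalD(6)[OF M CM] by blast
qed

lemma fst_minimal: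
  assumes M: "skew_minimal W \<sigma> f M" shows "fst ` M = W"
proof (rule base_minimalD)
  note inv = skew_minimalD(3,2,1)[OF M]
  show "fst ` M \<subseteq> W" "fst ` M \<noteq> {}" using inv by (auto simp: invariant_def)
  show "compact (fst ` M)" using inv(2) by (intro compact_continuous_image continuous_on_fst continuous_on_id)
  fix t w assume "w \<in> fst ` M"
  then obtain x where "(w, x) \<in> M" by auto
  then have "\<Psi> t (w, x) \<in> M" using inv(1) by (auto simp: invariant_def simp del: \<Psi>_pair)
  then show "\<sigma> t w \<in> fst ` M" by force
qed

lemma X_backward: "w \<in> W \<Longrightarrow> X (- t) (\<sigma> t w) (X t w x) = x"
  "w \<in> W \<Longrightarrow> X t (\<sigma> (- t) w) (X (- t) w x) = x"
  using X_add[of w "- t" t x] X_add[of w t "- t" x] by auto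

text \<open>Solutions cannot cross: at a crossing time they would coincide, and flowing back they would have the
same initial value.\<close>

lemma X_mono:
  assumes w: "w \<in> W" and "x \<le> y"
  shows "X t w x \<le> X t w y"
proof (rule ccontr)
  assume c: "\<not> X t w x \<le> X t w y"
  let ?d = "\<lambda>s. X s w x - X s w y"
  have "isCont (\<lambda>s. X s w x) s" for x s using X_deriv[OF w] DERIV_isCont by blast
  then have "isCont ?d s" for s by (intro continuous_diff)
  then have "continuous_on UNIV ?d" by (simp add: continuous_at_imp_continuous_on)
  then have "connected (range ?d)" by (rule connected_continuous_image) simp
  moreover have "?d 0 \<le> 0" "0 \<le> ?d t" using w \<open>x \<le> y\<close> c by auto
  ultimately have "0 \<in> range ?d"
    using connectedD_interval[of "range ?d" "?d 0" "?d t" 0] by blast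
  then obtain s where "X s w x = X s w y" by auto
  then have "x = y" by (metis X_backward(1)[OF w])
  then show False using c by simp
qed

end

section \<open>Minimal sets with negative exponents are attracting graphs\<close>

lemma exp_decay:
  assumes "(0::real) < \<kappa>" shows "((\<lambda>t. A * exp (- \<kappa> * t)) \<longlongrightarrow> 0) at_top"
proof -
  have "filterlim (\<lambda>t. - \<kappa> * t) at_bot at_top"
    by (rule filterlim_tendsto_neg_mult_at_bot[OF tendsto_const _ filterlim_ident]) (use assms in simp)
  from tendsto_mult_right_zero[OF filterlim_compose[OF exp_at_bot this], of A] show ?thesis by simp
qed

context clamped_flow
begin

lemma growth_rate_continuous:
  assumes "S \<subseteq> W \<times> UNIV" shows "continuous_on S (\<lambda>(w, x). q w x)"
  by (rule continuous_on_subset[OF q_cont assms])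

text \<open>Suppose that for each \<open>n\<close> some orbit piece of length \<open>T n\<close> violates the bound with constant
\<open>n + B + l0\<close>, where \<open>B\<close> bounds \<open>\<bar>q\<bar>\<close> on \<open>M\<close> and \<open>l0 = -\<gamma> / 2\<close>. Since the integral is at most \<open>B * T n\<close>,
the lengths tend to infinity, and all averages are at least \<open>\<gamma> / 2\<close>. A limiting invariant
measure would then have an integral of at least \<open>\<gamma> / 2 > \<gamma>\<close>.\<close>

lemma negative_exponent_bounds_growth:
  assumes M: "compact M" "invariant M" and \<gamma>: "\<gamma> < 0"
    and neg: "\<And>\<nu>. \<nu> \<in> invariant_measures \<sigma> f M \<Longrightarrow> (\<integral>(w, x). q w x \<partial>\<nu>) \<le> \<gamma>"
  obtains C where "0 \<le> C"
    "\<And>w x t. (w, x) \<in> M \<Longrightarrow> 0 \<le> t \<Longrightarrow> integral {0..t} (\<lambda>s. q (\<sigma> s w) (X s w x)) \<le> C - (- \<gamma> / 2) * t"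
proof (rule ccontr)
  assume no: "\<not> thesis"
  define l0 where "l0 = - \<gamma> / 2"
  have "l0 > 0" using \<gamma> by (simp add: l0_def)
  let ?Q = "\<lambda>(w, x). q w x"
  have MW: "M \<subseteq> W \<times> UNIV" using M(2) unfolding invariant_def by blast
  have Qc: "continuous_on M ?Q" using growth_rate_continuous[OF MW] .
  obtain B where B: "0 < B" "\<And>p. p \<in> M \<Longrightarrow> \<bar>?Q p\<bar> \<le> B" by (rule continuous_on_compact_bounded[OF M(1) Qc]) (rule that)
  have ex: "\<exists>p t. p \<in> M \<and> 0 \<le> t \<and> real n + B + l0 - l0 * t < integral {0..t} (\<lambda>s. ?Q (\<Psi> s p))" for n
  proof (rule ccontr)
    assume c: "\<not> ?thesis"
    have "thesis"
    proof (rule that[of "real n + B + l0"])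
      show "0 \<le> real n + B + l0" using B(1) \<open>l0 > 0\<close> by simp
      fix w x t assume "(w, x) \<in> M" "(0::real) \<le> t"
      then have "\<not> (real n + B + l0 - l0 * t < integral {0..t} (\<lambda>s. ?Q (\<Psi> s (w, x))))" using c by blast
      then show "integral {0..t} (\<lambda>s. q (\<sigma> s w) (X s w x)) \<le> real n + B + l0 - (- \<gamma> / 2) * t"
        unfolding l0_def by simp
    qed
    then show False using no by blast
  qed
  then obtain p T where p: "\<And>n. p n \<in> M" and T0: "\<And>n::nat. 0 \<le> T n"
    and big: "\<And>n. real n + B + l0 - l0 * T n < integral {0..T n} (\<lambda>s. ?Q (\<Psi> s (p n)))"
    by metis
  have \<Psi>M: "\<Psi> t p \<in> M" if "p \<in> M" for t p using M(2) that by (simp add: invariant_def)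
  have Tlow: "real n + (B + l0) < (B + l0) * T n" for n
  proof -
    have "norm (integral {0..T n} (\<lambda>s. ?Q (\<Psi> s (p n)))) \<le> B * (T n - 0)"
    proof (rule integral_bound[OF T0])
      show "continuous_on {0..T n} (\<lambda>s. ?Q (\<Psi> s (p n)))"
        by (rule continuous_on_compose2[OF Qc continuous_on_subset[OF continuous_flow_orbit_continuous[OF invariant_flow[OF M(2)] p]]])
           (use \<Psi>M[OF p] in \<open>simp_all add: image_subset_iff\<close>)
      show "norm (?Q (\<Psi> s (p n))) \<le> B" for s using B(2)[OF \<Psi>M[OF p]] by simp
    qed
    then show ?thesis using big[of n] by (simp add: algebra_simps)
  qed
  have pos: "B + l0 > 0" using B(1) \<open>l0 > 0\<close> by simp
  have Tn: "T n > real n / (B + l0)" "T n > 0" for n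
  proof -
    have "real n < T n * (B + l0)" "0 < (B + l0) * T n" using Tlow[of n] pos by (auto simp: mult.commute)
    then show "T n > real n / (B + l0)" "T n > 0" using pos by (simp_all add: pos_divide_less_eq zero_less_mult_iff)
  qed
  have "filterlim (\<lambda>n. real n / (B + l0)) at_top sequentially"
    using filterlim_tendsto_pos_mult_at_top[OF tendsto_const[of "1 / (B + l0)"] _ filterlim_real_sequentially] pos
    by simp
  then have Tlim: "filterlim T at_top sequentially"
    by (rule filterlim_at_top_mono) (use Tn(1) in \<open>auto intro!: always_eventually less_imp_le\<close>)
  have avg: "(- l0) * T n \<le> integral {0..T n} (\<lambda>s. ?Q (\<Psi> s (p n)))" for n
    using big[of n] B(1) \<open>l0 > 0\<close> by simp
  obtain \<nu> where \<nu>: "prob_space \<nu>" "sets \<nu> = sets (restrict_space borel M)"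
    "\<And>t. \<Psi> t \<in> measurable \<nu> \<nu>" "\<And>t. distr \<nu> \<nu> (\<Psi> t) = \<nu>" "- l0 \<le> (\<integral>p. ?Q p \<partial>\<nu>)"
    by (rule krylov_bogoliubov_average[OF M(1) invariant_flow[OF M(2)] Qc p Tn(2) Tlim avg]) (rule that)
  have space: "space \<nu> = M" using sets_eq_imp_space_eq[OF \<nu>(2)] by (simp add: space_restrict_space)
  have eq: "skew_flow \<sigma> f t x = \<Psi> t x" if "x \<in> space \<nu>" for t x
    using invariant_skew_flow[OF M(2)] that unfolding space by blast
  have "skew_flow \<sigma> f t \<in> measurable \<nu> \<nu>" for t
  proof -
    have "skew_flow \<sigma> f t \<in> measurable \<nu> \<nu> \<longleftrightarrow> \<Psi> t \<in> measurable \<nu> \<nu>"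
      by (rule measurable_cong) (rule eq)
    then show ?thesis using \<nu>(3) by blast
  qed
  moreover have "distr \<nu> \<nu> (skew_flow \<sigma> f t) = \<nu>" for t
  proof -
    have "distr \<nu> \<nu> (skew_flow \<sigma> f t) = distr \<nu> \<nu> (\<Psi> t)" by (rule distr_cong[OF refl refl eq])
    then show ?thesis using \<nu>(4) by simp
  qed
  ultimately have "\<nu> \<in> invariant_measures \<sigma> f M"
    unfolding invariant_measures_def using \<nu>(1,2) by blast
  from neg[OF this] \<nu>(5) show False using \<gamma> by (simp add: l0_def)
qed

text \<open>As long as two solutions in a common fibre are so close that \<open>q\<close> varies by less than \<open>l / 2\<close> between
them, their distance \<open>d\<close> satisfies \<open>d * d' \<le> (q + l / 2) * d\<^sup>2\<close>, so it decays at the rate \<open>l / 2\<close>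
up to the factor \<open>exp C\<close>. Starting \<open>exp C\<close> times closer ensures that they never leave the
range where this estimate is valid.\<close>

lemma exponential_tube:
  assumes M: "compact M" "invariant M" and "0 < l" "0 \<le> C"
    and growth: "\<And>w x t. (w, x) \<in> M \<Longrightarrow> 0 \<le> t \<Longrightarrow> integral {0..t} (\<lambda>s. q (\<sigma> s w) (X s w x)) \<le> C - l * t"
  obtains \<delta> where "0 < \<delta>"
    "\<And>w m x t. (w, m) \<in> M \<Longrightarrow> \<bar>x - m\<bar> < \<delta> \<Longrightarrow> 0 \<le> t \<Longrightarrow>
       \<bar>X t w x - X t w m\<bar> \<le> exp C * \<bar>x - m\<bar> * exp (- (l / 2) * t)"
proof -
  let ?Q = "\<lambda>(w, x). q w x"
  have "compact (W \<times> {-R..R})" using compact_base by (intro compact_Times) auto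
  then have "uniformly_continuous_on (W \<times> {-R..R}) ?Q"
    by (intro compact_uniformly_continuous growth_rate_continuous) auto
  then obtain \<epsilon> where "\<epsilon> > 0" and \<epsilon>: "\<And>p p'. p \<in> W \<times> {-R..R} \<Longrightarrow> p' \<in> W \<times> {-R..R} \<Longrightarrow> dist p' p < \<epsilon> \<Longrightarrow> dist (?Q p') (?Q p) < l / 2"
    unfolding uniformly_continuous_on_def using \<open>0 < l\<close> by (meson half_gt_zero)
  have q_close: "q w z \<le> q w m + l / 2" if "w \<in> W" "m \<in> {-R..R}" "z \<in> {-R..R}" "\<bar>z - m\<bar> < \<epsilon>" for w z m
  proof -
    have "\<bar>q w z - q w m\<bar> < l / 2"
      using \<epsilon>[of "(w, m)" "(w, z)"] that by (simp add: dist_Pair_Pair dist_real_def)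
    then show ?thesis by linarith
  qed
  have slope: "(y - m) * (f w y - f w m) \<le> (q w m + l / 2) * (y - m)^2"
    if w: "w \<in> W" and m: "m \<in> {-R..R}" and y: "y \<in> {-R..R}" and ym: "\<bar>y - m\<bar> < \<epsilon>" for w y m
  proof -
    have "\<exists>z. z \<in> {-R..R} \<and> \<bar>z - m\<bar> < \<epsilon> \<and> f w y - f w m = (y - m) * q w z"
    proof (cases y m rule: linorder_cases)
      case less
      from MVT2[OF less, of "f w" "q w"] f_deriv[OF w]
      obtain z where "y < z" "z < m" "f w m - f w y = (m - y) * q w z" by blast
      then show ?thesis using m y ym by (intro exI[of _ z]) (auto simp: algebra_simps)
    next
      case equal
      then show ?thesis using m \<open>\<epsilon> > 0\<close> by (intro exI[of _ m]) auto
    next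
      case greater
      from MVT2[OF greater, of "f w" "q w"] f_deriv[OF w]
      obtain z where "m < z" "z < y" "f w y - f w m = (y - m) * q w z" by blast
      then show ?thesis using m y ym by (intro exI[of _ z]) auto
    qed
    then obtain z where z: "z \<in> {-R..R}" "\<bar>z - m\<bar> < \<epsilon>" "f w y - f w m = (y - m) * q w z" by blast
    have "(y - m) * (f w y - f w m) = q w z * (y - m)^2" using z(3) by (simp add: power2_eq_square)
    also have "\<dots> \<le> (q w m + l / 2) * (y - m)^2" by (intro mult_right_mono q_close w m z) simp
    finally show ?thesis .
  qed
  \<comment> \<open>Orbits of \<open>M\<close> satisfy \<open>\<bar>x\<bar> \<le> R0\<close>; within \<open>R - R0\<close> of them the clamping has no effect.\<close>
  define \<eta> where "\<eta> = min \<epsilon> (R - R0)"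
  have "\<eta> > 0" using \<open>\<epsilon> > 0\<close> R by (simp add: \<eta>_def)
  define \<delta> where "\<delta> = \<eta> / exp C"
  have "\<delta> > 0" using \<open>\<eta> > 0\<close> by (simp add: \<delta>_def)
  have strip: "M \<subseteq> W \<times> {-R0..R0}" by (rule invariant_in_strip[OF M])
  show ?thesis
  proof (rule that[OF \<open>\<delta> > 0\<close>])
    fix w m x t assume wm: "(w, m) \<in> M" and xm: "\<bar>x - m\<bar> < \<delta>" and t: "(0::real) \<le> t"
    have w: "w \<in> W" using strip wm by blast
    have orbM: "(\<sigma> s w, X s w m) \<in> M" for s using M(2) wm unfolding invariant_def by (metis \<Psi>_pair)
    have mbd: "\<bar>X s w m\<bar> \<le> R0" for s
    proof -
      have "X s w m \<in> {-R0..R0}" using strip orbM[of s] by blast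
      then show ?thesis by auto
    qed
    define qm where "qm s = q (\<sigma> s w) (X s w m)" for s
    have "continuous_on UNIV (\<lambda>s. ?Q (\<Psi> s (w, m)))"
      by (rule continuous_on_compose2[OF growth_rate_continuous[of M] continuous_flow_orbit_continuous[OF invariant_flow[OF M(2)] wm]])
         (use strip orbM in auto)
    then have "continuous_on UNIV qm" by (simp add: qm_def)
    then obtain H where H: "\<And>s. (H has_real_derivative qm s) (at s)"
      by (rule continuous_has_antiderivative) (rule that)
    have Hgrowth: "H s - H 0 \<le> C - l * s" if "0 \<le> s" for s
      using growth[OF wm that] FTC_real[OF that H] by (simp add: qm_def)
    define d where "d s = X s w x - X s w m" for s
    define d' where "d' s = clamped R (\<sigma> s w) (X s w x) - clamped R (\<sigma> s w) (X s w m)" for s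
    have d0: "d 0 = x - m" by (simp add: d_def w)
    have dd: "(d has_real_derivative d' s) (at s)" for s
      unfolding d_def d'_def by (rule DERIV_diff[OF X_deriv[OF w] X_deriv[OF w]])
    have dcont: "continuous_on A d" for A
      using dd by (meson DERIV_isCont continuous_at_imp_continuous_on)
    have local: "d s * d' s \<le> (qm s + l / 2) * (d s)^2" if "\<bar>d s\<bar> < \<eta>" for s
    proof -
      have b: "\<bar>X s w x\<bar> \<le> R" "\<bar>X s w m\<bar> \<le> R" "\<bar>X s w x - X s w m\<bar> < \<epsilon>"
        using that mbd[of s] R unfolding d_def \<eta>_def by linarith+
      then show ?thesis
        using slope[of "\<sigma> s w" "X s w m" "X s w x"] w
        by (simp add: d_def d'_def qm_def clamped_eq abs_le_iff)
    qed
    define E where "E s = (d s)^2 * exp (- 2 * (H s + l / 2 * s))" for s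
    have dE: "(E has_real_derivative 2 * (d s * d' s - (qm s + l / 2) * (d s)^2) * exp (- 2 * (H s + l / 2 * s))) (at s)" for s
      unfolding E_def by (rule derivative_eq_intros dd H refl | simp add: algebra_simps power2_eq_square)+
    have key: "\<bar>d \<tau>\<bar> \<le> exp C * \<bar>d 0\<bar> * exp (- (l / 2) * \<tau>)"
      if \<tau>: "0 \<le> \<tau>" and small: "\<And>s. 0 < s \<Longrightarrow> s < \<tau> \<Longrightarrow> \<bar>d s\<bar> < \<eta>" for \<tau>
    proof -
      have "E \<tau> \<le> E 0"
      proof (rule DERIV_nonpos_imp_decreasing_open[OF \<tau>])
        fix s assume "0 < s" "s < \<tau>"
        then have "2 * (d s * d' s - (qm s + l / 2) * (d s)^2) * exp (- 2 * (H s + l / 2 * s)) \<le> 0"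
          using local[OF small] by (simp add: mult_le_0_iff)
        then show "\<exists>y. (E has_real_derivative y) (at s) \<and> y \<le> 0" using dE by blast
      next
        show "continuous_on {0..\<tau>} E" using dE by (meson DERIV_isCont continuous_at_imp_continuous_on)
      qed
      then have "E \<tau> * exp (2 * (H \<tau> + l / 2 * \<tau>)) \<le> E 0 * exp (2 * (H \<tau> + l / 2 * \<tau>))"
        by (rule mult_right_mono) simp
      also have "E \<tau> * exp (2 * (H \<tau> + l / 2 * \<tau>)) = (d \<tau>)^2"
        by (simp add: E_def mult.assoc exp_add[symmetric])
      also have "E 0 * exp (2 * (H \<tau> + l / 2 * \<tau>)) = (d 0)^2 * exp (2 * (H \<tau> - H 0) + l * \<tau>)"
        by (simp add: E_def mult.assoc exp_add[symmetric] algebra_simps)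
      also have "\<dots> \<le> (d 0)^2 * exp (2 * C - l * \<tau>)"
      proof -
        have "2 * (H \<tau> - H 0) + l * \<tau> \<le> 2 * C - l * \<tau>" 
          using mult_left_mono[OF Hgrowth[OF \<tau>], of 2] by (simp add: algebra_simps)
        then show ?thesis by (intro mult_left_mono) simp_all
      qed
      also have "\<dots> = (exp C * \<bar>d 0\<bar> * exp (- (l / 2) * \<tau>))^2"
        by (simp add: power_mult_distrib power2_eq_square[of "exp _"] exp_add[symmetric] mult_ac)
      finally have "\<bar>d \<tau>\<bar>^2 \<le> (exp C * \<bar>d 0\<bar> * exp (- (l / 2) * \<tau>))^2" by simp
      then show ?thesis by (rule power2_le_imp_le) simp
    qed
    have start: "exp C * \<bar>d 0\<bar> < \<eta>"
      using xm unfolding d0 \<delta>_def by (simp add: pos_less_divide_eq mult.commute)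
    \<comment> \<open>At the first time with \<open>\<bar>d s\<bar> \<ge> \<eta>\<close> the estimate still applies and gives a smaller value.\<close>
    have small: "\<bar>d s\<bar> < \<eta>" if "0 \<le> s" "s \<le> t" for s
    proof (rule ccontr)
      assume c: "\<not> \<bar>d s\<bar> < \<eta>"
      define S where "S = {s \<in> {0..t}. \<eta> \<le> \<bar>d s\<bar>}"
      have "closed S" unfolding S_def
        by (rule continuous_on_closed_Collect_le) (auto intro!: continuous_intros dcont)
      then have "compact S" 
        using compact_Int_closed[OF compact_Icc, of S 0 t] by (simp add: S_def Int_absorb1 subset_iff)
      moreover have "S \<noteq> {}" using c that unfolding S_def by auto
      ultimately obtain s1 where s1: "s1 \<in> S" "\<And>s. s \<in> S \<Longrightarrow> s1 \<le> s"
        using compact_attains_inf by metis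
      have "\<bar>d s1\<bar> \<le> exp C * \<bar>d 0\<bar> * exp (- (l / 2) * s1)"
      proof (rule key)
        show "0 \<le> s1" using s1(1) by (simp add: S_def)
        fix s assume "0 < s" "s < s1"
        then show "\<bar>d s\<bar> < \<eta>" using s1(2)[of s] s1(1) unfolding S_def by (cases "\<eta> \<le> \<bar>d s\<bar>") auto
      qed
      also have "\<dots> \<le> exp C * \<bar>d 0\<bar> * 1"
        using s1(1) \<open>0 < l\<close> by (intro mult_left_mono) (auto simp: S_def)
      finally show False using start s1(1) by (simp add: S_def)
    qed
    show "\<bar>X t w x - X t w m\<bar> \<le> exp C * \<bar>x - m\<bar> * exp (- (l / 2) * t)"
      using key[OF t small] unfolding d0 by (simp add: d_def)
  qed
qed

text \<open>Fibres with two points contradict the backward recurrence of the base: the two points are at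
distance at least \<open>\<delta>\<close> in the remote past, whereas the fibres over the open set \<open>- B\<close> lie between the
lowest value \<open>c\<close> of \<open>M\<close> and \<open>c + \<delta> / 2\<close>. A compact graph is the graph of a continuous
function.\<close>

lemma minimal_is_graph:
  assumes M: "skew_minimal W \<sigma> f M" and pos: "0 < \<delta>" "0 < K" "0 < \<kappa>"
    and tube: "\<And>w m x t. (w, m) \<in> M \<Longrightarrow> \<bar>x - m\<bar> < \<delta> \<Longrightarrow> 0 \<le> t \<Longrightarrow>
       \<bar>X t w x - X t w m\<bar> \<le> K * \<bar>x - m\<bar> * exp (- \<kappa> * t)"
  obtains h where "continuous_on W h" "M = graph_over W h"
proof -
  note D = skew_minimalD[OF M]
  have inM: "(\<sigma> t w, X t w x) \<in> M" if "(w, x) \<in> M" for t w x using D(4)[OF that, of t] by simp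
  have MW: "w \<in> W" if "(w, x) \<in> M" for w x using D(5) that by blast
  have sep: "\<exists>T. \<forall>t\<ge>T. \<delta> \<le> \<bar>X (- t) w m1 - X (- t) w m2\<bar>"
    if m: "(w, m1) \<in> M" "(w, m2) \<in> M" "m1 \<noteq> m2" for w m1 m2
  proof -
    have "\<forall>\<^sub>F t in at_top. K * \<delta> * exp (- \<kappa> * t) < \<bar>m1 - m2\<bar> \<and> 0 \<le> t"
      using order_tendstoD(2)[OF exp_decay[OF pos(3), of "K * \<delta>"], of "\<bar>m1 - m2\<bar>"] m(3)
      by (intro eventually_conj eventually_ge_at_top) simp
    then obtain T where T: "\<And>t. t \<ge> T \<Longrightarrow> K * \<delta> * exp (- \<kappa> * t) < \<bar>m1 - m2\<bar> \<and> 0 \<le> t"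
      unfolding eventually_at_top_linorder by blast
    have "\<delta> \<le> \<bar>X (- t) w m1 - X (- t) w m2\<bar>" if "t \<ge> T" for t
    proof (rule ccontr)
      assume c: "\<not> \<delta> \<le> \<bar>X (- t) w m1 - X (- t) w m2\<bar>"
      have "\<bar>X t (\<sigma> (- t) w) (X (- t) w m1) - X t (\<sigma> (- t) w) (X (- t) w m2)\<bar>
        \<le> K * \<bar>X (- t) w m1 - X (- t) w m2\<bar> * exp (- \<kappa> * t)"
        using tube[OF inM[OF m(2)]] c T[OF that] by simp
      then have "\<bar>m1 - m2\<bar> \<le> K * \<bar>X (- t) w m1 - X (- t) w m2\<bar> * exp (- \<kappa> * t)"
        by (simp only: X_backward(2)[OF MW[OF m(1)]])
      also have "\<dots> \<le> K * \<delta> * exp (- \<kappa> * t)"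
        using c pos by (intro mult_right_mono mult_left_mono) auto
      finally show False using T[OF that] by linarith
    qed
    then show ?thesis by blast
  qed
  \<comment> \<open>The lowest point of \<open>M\<close>, and the topmost point of its fibre.\<close>
  obtain w0 c where wc: "(w0, c) \<in> M" and cmin: "\<And>w x. (w, x) \<in> M \<Longrightarrow> c \<le> x"
    using continuous_attains_inf[OF D(2,1) continuous_on_snd[OF continuous_on_id]] by force
  have w0: "w0 \<in> W" using MW[OF wc] .
  have "compact (M \<inter> {w0} \<times> UNIV)" by (intro compact_Int_closed D(2) closed_Times) auto
  moreover have "M \<inter> {w0} \<times> UNIV \<noteq> {}" using wc by blast
  ultimately obtain top where top: "(w0, top) \<in> M" and topmax: "\<And>x. (w0, x) \<in> M \<Longrightarrow> x \<le> top"
    using continuous_attains_sup[of "M \<inter> {w0} \<times> UNIV" snd] continuous_on_snd[OF continuous_on_id] by force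
  have "(w0, c) \<in> closure (range (\<lambda>t. \<Psi> t (w0, top)))"
    unfolding orbit_closure_of_minimal[OF M top] by (rule wc)
  then obtain t where t: "dist (\<Psi> t (w0, top)) (w0, c) < \<delta> / 2"
    using pos(1) unfolding closure_approachable by (metis half_gt_zero rangeE)
  have low: "X t w0 top < c + \<delta> / 2"
    using t dist_snd_le[of "\<Psi> t (w0, top)" "(w0, c)"] by (simp add: dist_real_def)
  \<comment> \<open>Topmost points flow to topmost points, so the whole fibre over \<open>\<sigma> t w0\<close> is low.\<close>
  have fibre: "z < c + \<delta> / 2" if "(\<sigma> t w0, z) \<in> M" for z
  proof -
    have bk: "\<sigma> (- t) (\<sigma> t w0) = w0" using base_add[OF w0, of "- t" t] w0 by simp
    have "(w0, X (- t) (\<sigma> t w0) z) \<in> M" using inM[OF that, of "- t"] by (simp add: bk)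
    then have "X t w0 (X (- t) (\<sigma> t w0) z) \<le> X t w0 top" by (intro X_mono w0 topmax)
    also have "X t w0 (X (- t) (\<sigma> t w0) z) = z"
      using X_backward(2)[OF base_closed[OF w0], of t t z] by (simp add: bk)
    finally show ?thesis using low by simp
  qed
  \<comment> \<open>The base points with a point of \<open>M\<close> at height \<open>c + \<delta> / 2\<close> or above form a compact set.\<close>
  define B where "B = fst ` (M \<inter> UNIV \<times> {c + \<delta> / 2..})"
  have "compact B" unfolding B_def
    by (intro compact_continuous_image continuous_on_fst continuous_on_id compact_Int_closed D(2) closed_Times) auto
  then have openB: "open (- B)" by (simp add: compact_imp_closed open_Compl)
  have notB: "\<sigma> t w0 \<in> - B"
  proof
    assume "\<sigma> t w0 \<in> B"
    then obtain z where "(\<sigma> t w0, z) \<in> M" "c + \<delta> / 2 \<le> z" unfolding B_def by force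
    then show False using fibre by fastforce
  qed
  have single: "m1 = m2" if m: "(w, m1) \<in> M" "(w, m2) \<in> M" for w m1 m2
  proof (rule ccontr)
    assume "m1 \<noteq> m2"
    then obtain T where T: "\<And>t. t \<ge> T \<Longrightarrow> \<delta> \<le> \<bar>X (- t) w m1 - X (- t) w m2\<bar>" using sep[OF m] by blast
    obtain s where s: "s \<ge> T" "\<sigma> (- s) w \<in> - B"
      using backward_orbit_dense[OF MW[OF m(1)] base_closed[OF w0] openB notB] by blast
    have in_low: "X (- s) w x < c + \<delta> / 2" if "(w, x) \<in> M" for x
    proof (rule ccontr)
      assume "\<not> X (- s) w x < c + \<delta> / 2"
      then have "(\<sigma> (- s) w, X (- s) w x) \<in> M \<inter> UNIV \<times> {c + \<delta> / 2..}" using inM[OF that] by auto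
      then have "\<sigma> (- s) w \<in> B" unfolding B_def by (metis fst_conv imageI)
      then show False using s(2) by blast
    qed
    have "\<bar>X (- s) w m1 - X (- s) w m2\<bar> < \<delta>"
      using in_low[OF m(1)] in_low[OF m(2)] cmin[OF inM[OF m(1), of "- s"]] cmin[OF inM[OF m(2), of "- s"]] pos(1)
      by linarith
    then show False using T[OF s(1)] by linarith
  qed
  have ex: "\<exists>x. (w, x) \<in> M" if "w \<in> W" for w using fst_minimal[OF M] that by force
  define h where "h w = (THE x. (w, x) \<in> M)" for w
  have h: "h w = x" if "(w, x) \<in> M" for w x
    unfolding h_def by (rule the_equality[of "\<lambda>x. (w, x) \<in> M"]) (use single that in blast)+
  have "continuous_on (fst ` M) (\<lambda>w. (w, h w))"
    by (rule continuous_on_inv[OF continuous_on_fst[OF continuous_on_id] D(2)]) (auto simp: h)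
  then have "continuous_on W (\<lambda>w. snd (w, h w))"
    unfolding fst_minimal[OF M] by (rule continuous_on_snd)
  moreover have "M = graph_over W h"
    unfolding graph_over_def using ex h MW by (auto simp: image_iff)
  ultimately show ?thesis using that by simp
qed

end

section \<open>Uniqueness and uniform attraction\<close>

context clamped_flow
begin

definition negative_exponents :: bool where
  "negative_exponents \<longleftrightarrow> (\<forall>M. skew_minimal W \<sigma> f M \<longrightarrow>
     (\<exists>\<gamma><0. \<forall>\<nu>\<in>invariant_measures \<sigma> f M. (\<integral>(w, x). q w x \<partial>\<nu>) \<le> \<gamma>))"

definition attracting_graph :: "('a \<Rightarrow> real) \<Rightarrow> real \<Rightarrow> real \<Rightarrow> real \<Rightarrow> bool" where
  "attracting_graph h \<delta> K \<kappa> \<longleftrightarrow> continuous_on W h \<and> 0 < \<delta> \<and> 0 < K \<and> 0 < \<kappa> \<and>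
     (\<forall>w\<in>W. \<forall>x. \<bar>x - h w\<bar> < \<delta> \<longrightarrow> (\<forall>t\<ge>0. \<bar>X t w x - h (\<sigma> t w)\<bar> \<le> K * exp (- \<kappa> * t)))"

lemma graph_invariant:
  assumes "skew_minimal W \<sigma> f (graph_over W h)" "w \<in> W"
  shows "h (\<sigma> t w) = X t w (h w)" "\<bar>h w\<bar> \<le> R0"
proof -
  have wh: "(w, h w) \<in> graph_over W h" using assms(2) by (simp add: graph_over_def)
  then have "(\<sigma> t w, X t w (h w)) \<in> graph_over W h" using skew_minimalD(4)[OF assms(1) wh, of t] by simp
  then show "h (\<sigma> t w) = X t w (h w)" by (auto simp: graph_over_def)
  have "(w, h w) \<in> W \<times> {-R0..R0}" using skew_minimalD(5)[OF assms(1)] wh by blast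
  then show "\<bar>h w\<bar> \<le> R0" by auto
qed

lemma minimal_attracting_graph:
  assumes M: "skew_minimal W \<sigma> f M" and neg: negative_exponents
  shows "\<exists>h \<delta> K \<kappa>. M = graph_over W h \<and> attracting_graph h \<delta> K \<kappa>"
proof -
  note D = skew_minimalD[OF M]
  obtain \<gamma> where \<gamma>: "\<gamma> < 0" "\<And>\<nu>. \<nu> \<in> invariant_measures \<sigma> f M \<Longrightarrow> (\<integral>(w, x). q w x \<partial>\<nu>) \<le> \<gamma>"
    using neg M unfolding negative_exponents_def by blast
  have l: "0 < - \<gamma> / 2" using \<gamma>(1) by simp
  obtain C where C: "0 \<le> C"
    "\<And>w x t. (w, x) \<in> M \<Longrightarrow> 0 \<le> t \<Longrightarrow> integral {0..t} (\<lambda>s. q (\<sigma> s w) (X s w x)) \<le> C - (- \<gamma> / 2) * t"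
    by (rule negative_exponent_bounds_growth[OF D(2,3) \<gamma>(1)]) (erule \<gamma>(2), rule that)
  obtain \<delta> where \<delta>: "0 < \<delta>" and tube: "\<And>w m x t. (w, m) \<in> M \<Longrightarrow> \<bar>x - m\<bar> < \<delta> \<Longrightarrow> 0 \<le> t \<Longrightarrow>
       \<bar>X t w x - X t w m\<bar> \<le> exp C * \<bar>x - m\<bar> * exp (- (- \<gamma> / 2 / 2) * t)"
    by (rule exponential_tube[OF D(2,3) l C(1)]) (erule (1) C(2), rule that)
  define \<kappa> where "\<kappa> = - \<gamma> / 2 / 2"
  have \<kappa>: "0 < \<kappa>" using \<gamma>(1) by (simp add: \<kappa>_def)
  obtain h where h: "continuous_on W h" "M = graph_over W h"
    by (rule minimal_is_graph[OF M \<delta> exp_gt_zero \<kappa>]) (erule (2) tube[folded \<kappa>_def], rule that)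
  have "\<bar>X t w x - h (\<sigma> t w)\<bar> \<le> (exp C * \<delta>) * exp (- \<kappa> * t)"
    if "w \<in> W" "\<bar>x - h w\<bar> < \<delta>" "0 \<le> t" for w x t
  proof -
    have "(w, h w) \<in> M" using h(2) that(1) by (simp add: graph_over_def)
    from tube[OF this that(2,3)]
    have "\<bar>X t w x - h (\<sigma> t w)\<bar> \<le> exp C * \<bar>x - h w\<bar> * exp (- \<kappa> * t)"
      using graph_invariant(1)[OF M[unfolded h(2)] that(1)] by (simp add: \<kappa>_def)
    also have "\<dots> \<le> (exp C * \<delta>) * exp (- \<kappa> * t)" using that(2) by (intro mult_right_mono mult_left_mono) simp_all
    finally show ?thesis .
  qed
  then have "attracting_graph h \<delta> (exp C * \<delta>) \<kappa>"
    unfolding attracting_graph_def using h(1) \<delta> \<kappa> by simp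
  then show ?thesis using h(2) by blast
qed

lemma X_slice_continuous:
  "continuous_on (W \<times> UNIV) (\<lambda>(w, x). X t w x)"
  "w \<in> W \<Longrightarrow> continuous_on UNIV (X t w)"
proof -
  have "continuous_on (W \<times> UNIV) (\<lambda>p. (\<lambda>(t, w, x). X t w x) (t, p))"
    by (rule continuous_on_compose2[OF X_cont]) (auto intro!: continuous_intros)
  then show *: "continuous_on (W \<times> UNIV) (\<lambda>(w, x). X t w x)" by (simp add: case_prod_unfold)
  assume "w \<in> W"
  then have "continuous_on UNIV (\<lambda>x. (\<lambda>(w, x). X t w x) (w, x))"
    by (intro continuous_on_compose2[OF *]) (auto intro!: continuous_intros)
  then show "continuous_on UNIV (X t w)" by simp
qed

lemma distance_to_graph_continuous:
  assumes "continuous_on W h"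
  shows "continuous_on (W \<times> UNIV) (\<lambda>(w, x). \<bar>X t w x - h (\<sigma> t w)\<bar>)"
proof -
  have "continuous_on (W \<times> (UNIV :: real set)) (\<lambda>p. \<sigma> t (fst p))"
    by (rule continuous_on_compose2[OF continuous_flow_time_map_continuous[OF base_flow]]) (auto intro!: continuous_intros)
  then have "continuous_on (W \<times> (UNIV :: real set)) (\<lambda>p. h (\<sigma> t (fst p)))"
    by (rule continuous_on_compose2[OF assms]) auto
  then show ?thesis
    using X_slice_continuous(1)[of t] by (simp add: case_prod_unfold continuous_on_diff continuous_on_rabs)
qed

text \<open>The limit set of the orbit contains a minimal graph. Near a point \<open>(v, h v)\<close> of it the orbit is also
close to the graph in the vertical direction, since \<open>h\<close> is continuous.\<close>

lemma enters_some_tube: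
  assumes w: "w \<in> W" and x: "\<bar>x\<bar> \<le> R"
  shows "\<exists>M. skew_minimal W \<sigma> f M \<and> (\<forall>h \<delta>. M = graph_over W h \<longrightarrow> continuous_on W h \<longrightarrow> 0 < \<delta> \<longrightarrow>
     (\<exists>t\<ge>0. \<bar>X t w x - h (\<sigma> t w)\<bar> < \<delta>))"
proof -
  obtain M where M: "skew_minimal W \<sigma> f M" "M \<subseteq> closure ((\<lambda>t. \<Psi> t (w, x)) ` {0..})"
    by (rule minimal_in_forward_limit[OF w x]) (rule that)
  have "\<exists>t\<ge>0. \<bar>X t w x - h (\<sigma> t w)\<bar> < \<delta>"
    if h: "M = graph_over W h" "continuous_on W h" and \<delta>: "0 < \<delta>" for h \<delta>
  proof -
    obtain v where v: "v \<in> W" using base_nonempty by blast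
    have "(v, h v) \<in> closure ((\<lambda>t. \<Psi> t (w, x)) ` {0..})" using M(2) v h(1) by (auto simp: graph_over_def)
    then obtain y where y: "\<And>n. y n \<in> (\<lambda>t. \<Psi> t (w, x)) ` {0..}" and lim: "y \<longlonglongrightarrow> (v, h v)"
      unfolding closure_sequential by blast
    have yW: "y n \<in> W \<times> UNIV" for n using y[of n] w by auto
    have "(\<lambda>n. (\<lambda>(w, x). \<bar>X 0 w x - h (\<sigma> 0 w)\<bar>) (y n)) \<longlonglongrightarrow> (\<lambda>(w, x). \<bar>X 0 w x - h (\<sigma> 0 w)\<bar>) (v, h v)"
      by (rule continuous_on_tendsto_compose[OF distance_to_graph_continuous[OF h(2)] lim])
         (use v yW in \<open>auto intro!: always_eventually\<close>)
    then have "(\<lambda>n. (\<lambda>(w, x). \<bar>X 0 w x - h (\<sigma> 0 w)\<bar>) (y n)) \<longlonglongrightarrow> 0" using v by simp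
    from order_tendstoD(2)[OF this \<delta>] obtain n where "(\<lambda>(w, x). \<bar>X 0 w x - h (\<sigma> 0 w)\<bar>) (y n) < \<delta>"
      using eventually_happens'[OF sequentially_bot] by blast
    moreover obtain t where "t \<ge> 0" "y n = \<Psi> t (w, x)" using y[of n] by auto
    ultimately show ?thesis using w by (intro exI[of _ t]) simp
  qed
  then show ?thesis using M(1) by blast
qed

text \<open>An orbit that enters both tubes approaches both graphs, so \<open>\<bar>h - h'\<bar>\<close> tends to 0 along a base
orbit and its minimum over the compact base is 0.\<close>

lemma attracting_graphs_meet:
  assumes "attracting_graph h \<delta> K \<kappa>" "attracting_graph h' \<delta>' K' \<kappa>'" and w: "w \<in> W"
    and t: "0 \<le> t" "\<bar>X t w x - h (\<sigma> t w)\<bar> < \<delta>" and t': "0 \<le> t'" "\<bar>X t' w x - h' (\<sigma> t' w)\<bar> < \<delta>'"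
  shows "\<exists>v\<in>W. h v = h' v"
proof -
  have bound: "\<bar>X s w x - h (\<sigma> s w)\<bar> \<le> (K * exp (\<kappa> * t)) * exp (- \<kappa> * s)"
    if "attracting_graph h \<delta> K \<kappa>" "t \<le> s" "\<bar>X t w x - h (\<sigma> t w)\<bar> < \<delta>" for h \<delta> K \<kappa> s t
  proof -
    have le: "\<bar>X (s - t) (\<sigma> t w) (X t w x) - h (\<sigma> (s - t) (\<sigma> t w))\<bar> \<le> K * exp (- \<kappa> * (s - t))"
      using that w unfolding attracting_graph_def by simp
    have shift: "X (s - t) (\<sigma> t w) (X t w x) = X s w x" "\<sigma> (s - t) (\<sigma> t w) = \<sigma> s w"
      using X_add[OF w, of "s - t" t x] base_add[OF w, of "s - t" t] by simp_all
    have exp_shift: "exp (- \<kappa> * (s - t)) = exp (\<kappa> * t) * exp (- \<kappa> * s)"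
      by (simp add: exp_add[symmetric] algebra_simps)
    show ?thesis using le unfolding shift exp_shift mult.assoc .
  qed
  have hc: "continuous_on W h" "continuous_on W h'" and \<kappa>: "0 < \<kappa>" "0 < \<kappa>'"
    using assms(1,2) by (simp_all add: attracting_graph_def)
  have "continuous_on W (\<lambda>v. \<bar>h v - h' v\<bar>)" using hc by (intro continuous_intros)
  then obtain v where v: "v \<in> W" "\<And>u. u \<in> W \<Longrightarrow> \<bar>h v - h' v\<bar> \<le> \<bar>h u - h' u\<bar>"
    using continuous_attains_inf[OF compact_base base_nonempty] by blast
  let ?b = "\<lambda>s. (K * exp (\<kappa> * t)) * exp (- \<kappa> * s) + (K' * exp (\<kappa>' * t')) * exp (- \<kappa>' * s)"
  have "\<bar>h v - h' v\<bar> \<le> ?b s" if "s \<ge> max t t'" for s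
  proof -
    have "\<bar>h v - h' v\<bar> \<le> \<bar>h (\<sigma> s w) - h' (\<sigma> s w)\<bar>" by (rule v(2)) (simp add: w)
    also have "\<dots> \<le> \<bar>X s w x - h (\<sigma> s w)\<bar> + \<bar>X s w x - h' (\<sigma> s w)\<bar>" by linarith
    also have "\<dots> \<le> ?b s"
      using that by (intro add_mono bound[OF assms(1) _ t(2)] bound[OF assms(2) _ t'(2)]) simp_all
    finally show ?thesis .
  qed
  then have "\<forall>\<^sub>F s in at_top. \<bar>h v - h' v\<bar> \<le> ?b s" unfolding eventually_at_top_linorder by blast
  moreover have "(?b \<longlongrightarrow> 0 + 0) at_top" by (intro tendsto_add exp_decay \<kappa>)
  ultimately have "\<bar>h v - h' v\<bar> \<le> 0 + 0" by (intro tendsto_lowerbound[of ?b "0 + 0" at_top]) simp_all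
  then show ?thesis using v(1) by auto
qed

lemma minimal_sets_meet:
  assumes M: "skew_minimal W \<sigma> f M" and N: "skew_minimal W \<sigma> f N" and "M \<inter> N \<noteq> {}"
  shows "M = N"
proof -
  note D = skew_minimalD[OF M] and E = skew_minimalD[OF N]
  have MN: "invariant (M \<inter> N)" "compact (M \<inter> N)"
    using D(2,3) E(2,3) compact_Int unfolding invariant_def by blast+
  have "M \<inter> N = M" by (rule D(6)) (use MN assms(3) in blast)+
  moreover have "M \<inter> N = N" by (rule E(6)) (use MN assms(3) in blast)+
  ultimately have "M = N" by (rule subst)
  then show ?thesis by simp
qed

text \<open>Here \<open>U M w\<close> is the set of initial values over \<open>w\<close> whose orbits enter the tube around \<open>M\<close>. These open
sets are pairwise disjoint and cover the connected interval \<open>{-R..R}\<close>, and each contains the point of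
\<open>M\<close> over \<open>w\<close>; so there is only one of them.\<close>

theorem unique_exponentially_attracting_minimal_set:
  assumes neg: negative_exponents
  obtains h where "continuous_on W h" "skew_minimal W \<sigma> f (graph_over W h)"
    "\<And>N. skew_minimal W \<sigma> f N \<Longrightarrow> N = graph_over W h"
    "\<exists>C>0. \<exists>\<kappa>>0. \<forall>w\<in>W. \<forall>x. \<bar>x\<bar> \<le> R \<longrightarrow> (\<forall>t\<ge>0. \<bar>X t w x - h (\<sigma> t w)\<bar> \<le> C * exp (- \<kappa> * t))"
proof -
  have "\<forall>M. \<exists>h \<delta> K \<kappa>. skew_minimal W \<sigma> f M \<longrightarrow> M = graph_over W h \<and> attracting_graph h \<delta> K \<kappa>"
    using minimal_attracting_graph[OF _ neg] by blast
  then obtain h \<delta> K \<kappa> where *: "\<And>M. skew_minimal W \<sigma> f M \<Longrightarrow> M = graph_over W (h M) \<and> attracting_graph (h M) (\<delta> M) (K M) (\<kappa> M)"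
    by metis
  have gr: "M = graph_over W (h M)" and att: "attracting_graph (h M) (\<delta> M) (K M) (\<kappa> M)" if "skew_minimal W \<sigma> f M" for M
    using *[OF that] by simp_all
  define U where "U M w = {x. \<exists>t\<ge>0. \<bar>X t w x - h M (\<sigma> t w)\<bar> < \<delta> M}" for M w
  have openU: "open (U M w)" if "w \<in> W" for M w
  proof -
    have "U M w = (\<Union>t\<in>{0..}. {x. \<bar>X t w x - h M (\<sigma> t w)\<bar> < \<delta> M})" unfolding U_def by auto
    moreover have "open {x. \<bar>X t w x - h M (\<sigma> t w)\<bar> < \<delta> M}" for t
      using X_slice_continuous(2)[OF that, of t] by (intro open_Collect_less continuous_intros)
    ultimately show ?thesis by auto
  qed
  have disj: "M = N" if M: "skew_minimal W \<sigma> f M" and N: "skew_minimal W \<sigma> f N" and w: "w \<in> W" and x: "x \<in> U M w" "x \<in> U N w" for M N w x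
  proof -
    obtain t t' where "0 \<le> t" "\<bar>X t w x - h M (\<sigma> t w)\<bar> < \<delta> M" "0 \<le> t'" "\<bar>X t' w x - h N (\<sigma> t' w)\<bar> < \<delta> N"
      using x unfolding U_def by blast
    from attracting_graphs_meet[OF att[OF M] att[OF N] w this]
    obtain v where "v \<in> W" "h M v = h N v" by blast
    then have "(v, h M v) \<in> graph_over W (h M) \<inter> graph_over W (h N)" by (auto simp: graph_over_def)
    then have "M \<inter> N \<noteq> {}" using gr[OF M] gr[OF N] by auto
    then show ?thesis by (rule minimal_sets_meet[OF M N])
  qed
  have cover: "\<exists>M. skew_minimal W \<sigma> f M \<and> x \<in> U M w" if "w \<in> W" "\<bar>x\<bar> \<le> R" for w x
  proof -
    note wx = that
    obtain M where M: "skew_minimal W \<sigma> f M"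
      and e: "\<And>h \<delta>. M = graph_over W h \<Longrightarrow> continuous_on W h \<Longrightarrow> 0 < \<delta> \<Longrightarrow> \<exists>t\<ge>0. \<bar>X t w x - h (\<sigma> t w)\<bar> < \<delta>"
      using enters_some_tube[OF wx] by blast
    show ?thesis using e[OF gr[OF M]] att[OF M] M unfolding U_def attracting_graph_def by blast
  qed
  have h_in: "h M w \<in> U M w" "\<bar>h M w\<bar> \<le> R" if "skew_minimal W \<sigma> f M" "w \<in> W" for M w
  proof -
    have "skew_minimal W \<sigma> f (graph_over W (h M))" using that(1) gr[OF that(1)] by simp
    then show "\<bar>h M w\<bar> \<le> R" using graph_invariant(2)[OF _ that(2)] R by fastforce
    show "h M w \<in> U M w" unfolding U_def
      using att[OF that(1)] that(2) by (auto simp: attracting_graph_def intro!: exI[of _ 0])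
  qed
  obtain w0 where w0: "w0 \<in> W" using base_nonempty by blast
  obtain M0 where M0: "skew_minimal W \<sigma> f M0" using cover[OF w0, of 0] R R0_pos by auto
  have all: "x \<in> U M0 w" if w: "w \<in> W" and x: "\<bar>x\<bar> \<le> R" for w x
  proof (rule ccontr)
    assume "x \<notin> U M0 w"
    define V where "V = (\<Union>M\<in>{M. skew_minimal W \<sigma> f M \<and> M \<noteq> M0}. U M w)"
    have "open V" unfolding V_def using openU[OF w] by blast
    have "U M0 w \<inter> V = {}" using disj[OF M0 _ w] unfolding V_def by blast
    moreover have "{-R..R} \<subseteq> U M0 w \<union> V"
    proof
      fix y assume "y \<in> {-R..R}"
      then have "\<bar>y\<bar> \<le> R" by auto
      then obtain M where "skew_minimal W \<sigma> f M" "y \<in> U M w" using cover[OF w] by blast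
      then show "y \<in> U M0 w \<union> V" unfolding V_def by blast
    qed
    moreover have "h M0 w \<in> U M0 w \<inter> {-R..R}" using h_in[OF M0 w] by auto
    moreover have "x \<in> V \<inter> {-R..R}"
    proof -
      have "x \<in> {-R..R}" using x by auto
      then show ?thesis using calculation(2) \<open>x \<notin> U M0 w\<close> by blast
    qed
    ultimately show False
      using connectedD[OF connected_Icc[of "-R" R] openU[OF w, of M0] \<open>open V\<close>] by blast
  qed
  have unique: "N = M0" if N: "skew_minimal W \<sigma> f N" for N
    using disj[OF N M0 w0 h_in(1)[OF N w0] all[OF w0 h_in(2)[OF N w0]]] .
  let ?h = "h M0"
  have cont: "continuous_on W ?h" and pos: "0 < \<delta> M0" "0 < K M0" "0 < \<kappa> M0"
    using att[OF M0] by (simp_all add: attracting_graph_def)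
  have h0: "skew_minimal W \<sigma> f (graph_over W ?h)" using M0 gr[OF M0] by simp
  \<comment> \<open>A limit of initial points with later and later entrance times would never enter the tube.\<close>
  have "\<exists>n::nat. \<forall>w\<in>W. \<forall>x. \<bar>x\<bar> \<le> R \<longrightarrow> (\<exists>t\<in>{0..real n}. \<bar>X t w x - ?h (\<sigma> t w)\<bar> < \<delta> M0)"
  proof (rule ccontr)
    assume "\<not> ?thesis"
    then have "\<forall>n::nat. \<exists>p. p \<in> W \<times> {-R..R} \<and> (\<forall>t\<in>{0..real n}. \<not> (case p of (w, x) \<Rightarrow> \<bar>X t w x - ?h (\<sigma> t w)\<bar>) < \<delta> M0)"
      by (fastforce simp: abs_le_iff)
    from choice[OF this] obtain p where p: "\<And>n::nat. p n \<in> W \<times> {-R..R}"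
      "\<And>n t. t \<in> {0..real n} \<Longrightarrow> \<not> (case p n of (w, x) \<Rightarrow> \<bar>X t w x - ?h (\<sigma> t w)\<bar>) < \<delta> M0"
      by blast
    have "compact (W \<times> {-R..R})" using compact_base by (intro compact_Times) auto
    then obtain l r where l: "l \<in> W \<times> {-R..R}" "strict_mono (r :: nat \<Rightarrow> nat)" "(p \<circ> r) \<longlonglongrightarrow> l"
      using seq_compactE[OF compact_imp_seq_compact, of "W \<times> {-R..R}" p] p(1) by blast
    obtain w x where wx: "l = (w, x)" "w \<in> W" "\<bar>x\<bar> \<le> R" using l(1) by (auto simp: abs_le_iff)
    obtain t where t: "0 \<le> t" "\<bar>X t w x - ?h (\<sigma> t w)\<bar> < \<delta> M0" using all[OF wx(2,3)] unfolding U_def by blast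
    have pW: "p n \<in> W \<times> UNIV" for n using p(1)[of n] by (simp add: mem_Times_iff)
    have "(\<lambda>n. (\<lambda>(w, x). \<bar>X t w x - ?h (\<sigma> t w)\<bar>) ((p \<circ> r) n)) \<longlonglongrightarrow> (\<lambda>(w, x). \<bar>X t w x - ?h (\<sigma> t w)\<bar>) l"
      by (rule continuous_on_tendsto_compose[OF distance_to_graph_continuous[OF cont] l(3)])
         (use l(1) pW in \<open>auto intro!: always_eventually\<close>)
    from order_tendstoD(2)[OF this, of "\<delta> M0"] t(2)
    have "\<forall>\<^sub>F n in sequentially. (\<lambda>(w, x). \<bar>X t w x - ?h (\<sigma> t w)\<bar>) ((p \<circ> r) n) < \<delta> M0"
      unfolding wx(1) by simp
    moreover have "\<forall>\<^sub>F n in sequentially. t \<le> real n"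
      using eventually_ge_at_top[of "nat \<lceil>t\<rceil>"] by eventually_elim linarith
    ultimately have "\<forall>\<^sub>F n in sequentially. False"
    proof eventually_elim
      case (elim n)
      have "n \<le> r n" using l(2) by (rule strict_mono_imp_increasing)
      then have "t \<in> {0..real (r n)}" using elim(2) t(1) by simp
      then show ?case using p(2)[of t "r n"] elim(1) by simp
    qed
    then show False by simp
  qed
  then obtain n :: nat where n: "\<And>w x. w \<in> W \<Longrightarrow> \<bar>x\<bar> \<le> R \<Longrightarrow> \<exists>t\<in>{0..real n}. \<bar>X t w x - ?h (\<sigma> t w)\<bar> < \<delta> M0"
    by blast
  \<comment> \<open>After the entrance the tube estimate applies; before it the distance is at most \<open>2 * R\<close>,
    which the factor \<open>exp (\<kappa> M0 * real n)\<close> compensates.\<close>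
  define C where "C = (K M0 + 2 * R) * exp (\<kappa> M0 * real n)"
  have "C > 0" unfolding C_def using pos R R0_pos by simp
  have rate: "\<bar>X s w x - ?h (\<sigma> s w)\<bar> \<le> C * exp (- \<kappa> M0 * s)" if w: "w \<in> W" and x: "\<bar>x\<bar> \<le> R" and s: "0 \<le> s" for w x s
  proof -
    obtain t where t: "0 \<le> t" "t \<le> real n" "\<bar>X t w x - ?h (\<sigma> t w)\<bar> < \<delta> M0" using n[OF w x] by auto
    have R0: "0 \<le> R" using R R0_pos by simp
    show ?thesis
    proof (cases "t \<le> s")
      case True
      have "\<bar>X (s - t) (\<sigma> t w) (X t w x) - ?h (\<sigma> (s - t) (\<sigma> t w))\<bar> \<le> K M0 * exp (- \<kappa> M0 * (s - t))"
        using att[OF M0] True t(3) w unfolding attracting_graph_def by simp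
      moreover have "X (s - t) (\<sigma> t w) (X t w x) = X s w x" "\<sigma> (s - t) (\<sigma> t w) = \<sigma> s w"
        using X_add[OF w, of "s - t" t x] base_add[OF w, of "s - t" t] by simp_all
      ultimately have "\<bar>X s w x - ?h (\<sigma> s w)\<bar> \<le> K M0 * exp (- \<kappa> M0 * (s - t))" by simp
      also have "\<dots> = K M0 * exp (\<kappa> M0 * t) * exp (- \<kappa> M0 * s)"
        by (simp add: exp_add[symmetric] algebra_simps)
      also have "\<dots> \<le> C * exp (- \<kappa> M0 * s)"
        unfolding C_def using pos t R0 by (intro mult_right_mono mult_mono) simp_all
      finally show ?thesis .
    next
      case False
      have "\<bar>X s w x\<bar> \<le> R" using X_stays_in_strip[OF w _ x s] R by simp
      moreover have "\<bar>?h (\<sigma> s w)\<bar> \<le> R" using h_in(2)[OF M0 base_closed[OF w]] .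
      ultimately have "\<bar>X s w x - ?h (\<sigma> s w)\<bar> \<le> (2 * R) * 1" by linarith
      also have "1 \<le> exp (\<kappa> M0 * real n) * exp (- \<kappa> M0 * s)"
      proof -
        have "\<kappa> M0 * s \<le> \<kappa> M0 * real n" using False t(2) pos(3) by (intro mult_left_mono) simp_all
        then show ?thesis by (simp add: exp_add[symmetric])
      qed
      then have "(2 * R) * 1 \<le> (2 * R) * (exp (\<kappa> M0 * real n) * exp (- \<kappa> M0 * s))"
        using R0 by (intro mult_left_mono) simp_all
      also have "\<dots> \<le> (K M0 + 2 * R) * (exp (\<kappa> M0 * real n) * exp (- \<kappa> M0 * s))"
        using pos(2) by (intro mult_right_mono) simp_all
      also have "\<dots> = C * exp (- \<kappa> M0 * s)" by (simp add: C_def mult.assoc)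
      finally show ?thesis .
    qed
  qed
  show ?thesis
  proof (rule that[OF cont h0])
    show "N = graph_over W ?h" if "skew_minimal W \<sigma> f N" for N
      using unique[OF that] gr[OF M0] by simp
    show "\<exists>C>0. \<exists>\<kappa>>0. \<forall>w\<in>W. \<forall>x. \<bar>x\<bar> \<le> R \<longrightarrow> (\<forall>t\<ge>0. \<bar>X t w x - ?h (\<sigma> t w)\<bar> \<le> C * exp (- \<kappa> * t))"
      using \<open>C > 0\<close> pos(3) rate by blast
  qed
qed

lemma orbit_closure_of_minimal_graph:
  assumes "skew_minimal W \<sigma> f (graph_over W h)" "w \<in> W"
  shows "orbit_closure \<sigma> h w = graph_over W h"
proof -
  have "(w, h w) \<in> graph_over W h" using assms(2) by (simp add: graph_over_def)
  from orbit_closure_of_minimal[OF assms(1) this] show ?thesis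
    unfolding orbit_closure_def by (simp add: graph_invariant(1)[OF assms])
qed

end

section \<open>The global attractor\<close>

text \<open>The constants depend on \<open>r\<close> but not on the initial point; this uniformity gives the attraction of
bounded sets.\<close>

definition attracts_strip ::
  "'w set \<Rightarrow> (real \<Rightarrow> 'w \<Rightarrow> 'w) \<Rightarrow> ('w \<Rightarrow> real \<Rightarrow> real) \<Rightarrow> ('w \<Rightarrow> real) \<Rightarrow> real \<Rightarrow> bool" where
  "attracts_strip W \<sigma> f h r \<longleftrightarrow> (\<exists>C>0. \<exists>\<kappa>>0. \<forall>w\<in>W. \<forall>x. \<bar>x\<bar> \<le> r \<longrightarrow> (\<forall>t\<ge>0. t \<in> sol_dom \<sigma> f w x \<and>
     \<bar>sol \<sigma> f t w x - h (\<sigma> t w)\<bar> \<le> C * exp (- \<kappa> * t)))"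

lemma attracts_stripE:
  assumes "attracts_strip W \<sigma> f h r"
  obtains C \<kappa> where "0 < C" "0 < \<kappa>"
    "\<And>w x t. w \<in> W \<Longrightarrow> \<bar>x\<bar> \<le> r \<Longrightarrow> 0 \<le> t \<Longrightarrow> t \<in> sol_dom \<sigma> f w x"
    "\<And>w x t. w \<in> W \<Longrightarrow> \<bar>x\<bar> \<le> r \<Longrightarrow> 0 \<le> t \<Longrightarrow> \<bar>sol \<sigma> f t w x - h (\<sigma> t w)\<bar> \<le> C * exp (- \<kappa> * t)"
proof -
  obtain C \<kappa> where "0 < C" "0 < \<kappa>" and *: "\<forall>w\<in>W. \<forall>x. \<bar>x\<bar> \<le> r \<longrightarrow> (\<forall>t\<ge>0. t \<in> sol_dom \<sigma> f w x \<and>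
     \<bar>sol \<sigma> f t w x - h (\<sigma> t w)\<bar> \<le> C * exp (- \<kappa> * t))"
    using assms unfolding attracts_strip_def by blast
  show ?thesis by (rule that[OF \<open>0 < C\<close> \<open>0 < \<kappa>\<close>]) (use * in simp_all)
qed

lemma attracts_strip_cong:
  assumes "\<And>w. w \<in> W \<Longrightarrow> h w = h' w" "\<And>t w. w \<in> W \<Longrightarrow> \<sigma> t w \<in> W"
  shows "attracts_strip W \<sigma> f h r \<longleftrightarrow> attracts_strip W \<sigma> f h' r"
  unfolding attracts_strip_def using assms by simp

lemma graph_over_eqD: "graph_over W h = graph_over W h' \<Longrightarrow> w \<in> W \<Longrightarrow> h w = h' w"
  unfolding graph_over_def by (auto simp: set_eq_iff image_iff)

context dissipative_family
begin

text \<open>For each \<open>r\<close> the equation is clamped at a level beyond \<open>r\<close>. The graphs obtained for different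
\<open>r\<close> coincide, because minimality for the original local flow does not refer to the clamping.\<close>

lemma uniform_exponential_attraction:
  assumes neg: "\<And>M. skew_minimal W \<sigma> f M \<Longrightarrow>
     \<exists>\<gamma><0. \<forall>\<nu>\<in>invariant_measures \<sigma> f M. (\<integral>(w, x). q w x \<partial>\<nu>) \<le> \<gamma>"
  obtains h where "continuous_on W h" "skew_minimal W \<sigma> f (graph_over W h)"
    "\<And>N. skew_minimal W \<sigma> f N \<Longrightarrow> N = graph_over W h"
    "\<And>w. w \<in> W \<Longrightarrow> orbit_closure \<sigma> h w = graph_over W h"
    "\<And>r. attracts_strip W \<sigma> f h r"
proof -
  have main: "\<exists>h. continuous_on W h \<and> skew_minimal W \<sigma> f (graph_over W h) \<and>
      (\<forall>N. skew_minimal W \<sigma> f N \<longrightarrow> N = graph_over W h) \<and>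
      (\<forall>w\<in>W. orbit_closure \<sigma> h w = graph_over W h) \<and>
      attracts_strip W \<sigma> f h r" for r
  proof -
    define R where "R = max r R0 + 1"
    have "0 < R" using R0_pos by (simp add: R_def)
    obtain X where X: "continuous_on (UNIV \<times> W \<times> UNIV) (\<lambda>(t, w, x). X t w x)"
      "\<And>w x. w \<in> W \<Longrightarrow> X 0 w x = x"
      "\<And>w x t. w \<in> W \<Longrightarrow> ((\<lambda>s. X s w x) has_real_derivative clamped R (\<sigma> t w) (X t w x)) (at t)"
      by (rule clamped_flow_exists[OF \<open>0 < R\<close>]) (rule that)
    interpret clamped_flow W \<sigma> f q R0 R X
      by unfold_locales (simp add: R_def, rule X(1), erule X(2), erule X(3))
    have "negative_exponents" unfolding negative_exponents_def using neg by blast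
    then obtain h where h: "continuous_on W h" "skew_minimal W \<sigma> f (graph_over W h)"
      "\<And>N. skew_minimal W \<sigma> f N \<Longrightarrow> N = graph_over W h"
      "\<exists>C>0. \<exists>\<kappa>>0. \<forall>w\<in>W. \<forall>x. \<bar>x\<bar> \<le> R \<longrightarrow> (\<forall>t\<ge>0. \<bar>X t w x - h (\<sigma> t w)\<bar> \<le> C * exp (- \<kappa> * t))"
      by (rule unique_exponentially_attracting_minimal_set) (rule that)
    have oc: "\<forall>w\<in>W. orbit_closure \<sigma> h w = graph_over W h"
      using orbit_closure_of_minimal_graph[OF h(2)] by blast
    obtain C \<kappa> where C: "C > 0" "\<kappa> > 0"
      "\<And>w x t. w \<in> W \<Longrightarrow> \<bar>x\<bar> \<le> R \<Longrightarrow> 0 \<le> t \<Longrightarrow> \<bar>X t w x - h (\<sigma> t w)\<bar> \<le> C * exp (- \<kappa> * t)"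
      using h(4) by blast
    have "t \<in> sol_dom \<sigma> f w x \<and> \<bar>sol \<sigma> f t w x - h (\<sigma> t w)\<bar> \<le> C * exp (- \<kappa> * t)"
      if "w \<in> W" "\<bar>x\<bar> \<le> r" "0 \<le> t" for w x t
      using X_is_sol_forward[of w "max r R0" x t] C(3)[of w x t] that by (simp add: R_def)
    then have "attracts_strip W \<sigma> f h r" unfolding attracts_strip_def using C(1,2) by blast
    then show ?thesis using h(1-3) oc by blast
  qed
  obtain h where h: "continuous_on W h" "skew_minimal W \<sigma> f (graph_over W h)"
      "\<And>N. skew_minimal W \<sigma> f N \<Longrightarrow> N = graph_over W h"
      "\<And>w. w \<in> W \<Longrightarrow> orbit_closure \<sigma> h w = graph_over W h"
    using main[of 0] by blast
  show ?thesis
  proof (rule that[OF h])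
    fix r
    obtain h' where h': "skew_minimal W \<sigma> f (graph_over W h')"
      and rate: "attracts_strip W \<sigma> f h' r"
      using main[of r] by blast
    have "graph_over W h' = graph_over W h" by (rule h(3)[OF h'])
    then have "attracts_strip W \<sigma> f h' r \<longleftrightarrow> attracts_strip W \<sigma> f h r"
      by (intro attracts_strip_cong base_closed) (rule graph_over_eqD)
    then show "attracts_strip W \<sigma> f h r" using rate by simp
  qed
qed

end

lemma graph_over_cong: "(\<And>w. w \<in> W \<Longrightarrow> h w = h' w) \<Longrightarrow> graph_over W h = graph_over W h'"
  by (simp add: graph_over_def)

lemma minimal_graph_equilibrium:
  assumes "skew_minimal W \<sigma> f (graph_over W h)"
  shows "equilibrium W \<sigma> f h"
proof -
  have inv: "skew_invariant W \<sigma> f (graph_over W h)" using assms by (simp add: skew_minimal_def)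
  have "t \<in> sol_dom \<sigma> f w (h w) \<and> h (\<sigma> t w) = sol \<sigma> f t w (h w)" if "w \<in> W" for w t
  proof -
    have wh: "(w, h w) \<in> graph_over W h" using that by (simp add: graph_over_def)
    then have "skew_flow \<sigma> f t (w, h w) \<in> skew_flow \<sigma> f t ` graph_over W h" by (rule imageI)
    then have "(\<sigma> t w, sol \<sigma> f t w (h w)) \<in> graph_over W h"
      using inv by (simp add: skew_invariant_def skew_flow_def)
    moreover have "sol_dom \<sigma> f w (h w) = UNIV" using inv wh unfolding skew_invariant_def by blast
    ultimately show ?thesis by (auto simp: graph_over_def)
  qed
  then show ?thesis unfolding equilibrium_def by blast
qed

lemma uniform_attraction_global_attractor:
  assumes h: "skew_minimal W \<sigma> f (graph_over W h)"
    and \<sigma>W: "\<And>t w. w \<in> W \<Longrightarrow> \<sigma> t w \<in> W"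
    and rate: "\<And>r. attracts_strip W \<sigma> f h r"
  shows "global_attractor W \<sigma> f (graph_over W h)"
  unfolding global_attractor_def
proof (intro conjI ballI allI impI)
  show "compact (graph_over W h)" "skew_invariant W \<sigma> f (graph_over W h)"
    using h by (simp_all add: skew_minimal_def)
  show "{0..} \<subseteq> sol_dom \<sigma> f w x" if "w \<in> W" for w x
    by (rule attracts_stripE[OF rate[of "\<bar>x\<bar>"]]) (use that in auto)
  fix B :: "('a \<times> real) set" assume B: "B \<subseteq> W \<times> UNIV \<and> bounded B"
  then obtain r where r: "\<And>p. p \<in> B \<Longrightarrow> norm (snd p) \<le> r"
    using bounded_snd[of B] unfolding bounded_iff by blast
  obtain C \<kappa> where C: "0 < C" "0 < \<kappa>" "\<And>w x t. w \<in> W \<Longrightarrow> \<bar>x\<bar> \<le> r \<Longrightarrow> 0 \<le> t \<Longrightarrow>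
      \<bar>sol \<sigma> f t w x - h (\<sigma> t w)\<bar> \<le> C * exp (- \<kappa> * t)"
    by (rule attracts_stripE[OF rate[of r]]) (rule that)
  have "hausdorff_semidist (skew_flow \<sigma> f t ` B) (graph_over W h) \<le> ennreal (C * exp (- \<kappa> * t))" if t: "0 \<le> t" for t
    unfolding hausdorff_semidist_def
  proof (rule SUP_least)
    fix p assume "p \<in> skew_flow \<sigma> f t ` B"
    then obtain w x where wx: "(w, x) \<in> B" and p: "p = (\<sigma> t w, sol \<sigma> f t w x)"
      by (auto simp: skew_flow_def)
    have w: "w \<in> W" and x: "\<bar>x\<bar> \<le> r" using B wx r[OF wx] by auto
    show "(INF q\<in>graph_over W h. ennreal (dist p q)) \<le> ennreal (C * exp (- \<kappa> * t))"
    proof (rule INF_lower2)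
      show "(\<sigma> t w, h (\<sigma> t w)) \<in> graph_over W h" using \<sigma>W[OF w] by (simp add: graph_over_def)
      show "ennreal (dist p (\<sigma> t w, h (\<sigma> t w))) \<le> ennreal (C * exp (- \<kappa> * t))"
        using C(3)[OF w x t] by (intro ennreal_leI) (simp add: p dist_Pair_Pair dist_real_def)
    qed
  qed
  then have bound: "\<forall>\<^sub>F t in at_top. hausdorff_semidist (skew_flow \<sigma> f t ` B) (graph_over W h) \<le> ennreal (C * exp (- \<kappa> * t))"
    unfolding eventually_at_top_linorder by blast
  have decay: "((\<lambda>t. ennreal (C * exp (- \<kappa> * t))) \<longlongrightarrow> 0) at_top"
    using tendsto_ennrealI[OF exp_decay[OF C(2), of C]] by simp
  show "((\<lambda>t. hausdorff_semidist (skew_flow \<sigma> f t ` B) (graph_over W h)) \<longlongrightarrow> 0) at_top"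
    by (rule tendsto_sandwich[OF always_eventually bound tendsto_const decay]) simp
qed

text \<open>Each point of \<open>A\<close> is the position at time \<open>t\<close> of some point of \<open>A\<close>, for every \<open>t\<close>; as \<open>A\<close> is
bounded, \<open>\<bar>x - h w\<bar>\<close> is at most \<open>C * exp (- \<kappa> * t)\<close> for one \<open>C\<close> and all \<open>t\<close>.\<close>

lemma compact_invariant_subset_attracting_graph:
  fixes A :: "('w::metric_space \<times> real) set"
  assumes A: "compact A" "skew_invariant W \<sigma> f A"
    and rate: "\<And>r. attracts_strip W \<sigma> f h r"
    and wx: "(w, x) \<in> A"
  shows "x = h w"
proof -
  obtain r where r: "\<And>p. p \<in> A \<Longrightarrow> norm (snd p) \<le> r"
    using bounded_snd[of A] compact_imp_bounded[OF A(1)] unfolding bounded_iff by blast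
  obtain C \<kappa> where C: "0 < C" "0 < \<kappa>" "\<And>w x t. w \<in> W \<Longrightarrow> \<bar>x\<bar> \<le> r \<Longrightarrow> 0 \<le> t \<Longrightarrow>
      \<bar>sol \<sigma> f t w x - h (\<sigma> t w)\<bar> \<le> C * exp (- \<kappa> * t)"
    by (rule attracts_stripE[OF rate[of r]]) (rule that)
  have "\<bar>x - h w\<bar> \<le> C * exp (- \<kappa> * t)" if "0 \<le> t" for t
  proof -
    have "(w, x) \<in> skew_flow \<sigma> f t ` A" using A(2) wx by (simp add: skew_invariant_def)
    then obtain v y where vy: "(v, y) \<in> A" "w = \<sigma> t v" "x = sol \<sigma> f t v y" by (auto simp: skew_flow_def)
    have "v \<in> W" using A(2) vy(1) by (auto simp: skew_invariant_def)
    then show ?thesis using C(3)[of v y t] r[OF vy(1)] that vy(2,3) by simp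
  qed
  then have "\<forall>\<^sub>F t in at_top. \<bar>x - h w\<bar> \<le> C * exp (- \<kappa> * t)"
    unfolding eventually_at_top_linorder by blast
  then have "\<bar>x - h w\<bar> \<le> 0"
    by (intro tendsto_lowerbound[OF exp_decay[OF C(2), of C]]) simp_all
  then show ?thesis by simp
qed

text \<open>The supremum bounds its members because the integrals are bounded: the integrand is
continuous on the compact set \<open>M\<close>.\<close>

lemma integral_le_upper_lyapunov:
  assumes M: "compact M" and c: "continuous_on M (\<lambda>(w, x). a w + gx w x)"
    and \<nu>: "\<nu> \<in> invariant_measures \<sigma> f M"
  shows "(\<integral>(w, x). a w + gx w x \<partial>\<nu>) \<le> upper_lyapunov \<sigma> f a gx M"
proof -
  let ?Q = "\<lambda>(w, x). a w + gx w x"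
  obtain B where B: "0 < B" "\<And>p. p \<in> M \<Longrightarrow> \<bar>?Q p\<bar> \<le> B"
    by (rule continuous_on_compact_bounded[OF M c]) (rule that)
  have "(\<integral>p. ?Q p \<partial>\<mu>) \<le> B" if "\<mu> \<in> invariant_measures \<sigma> f M" for \<mu>
  proof -
    have \<mu>: "prob_space \<mu>" "sets \<mu> = sets (restrict_space borel M)"
      using that by (simp_all add: invariant_measures_def)
    interpret prob_space \<mu> by (rule \<mu>)
    have space: "space \<mu> = M" using sets_eq_imp_space_eq[OF \<mu>(2)] by (simp add: space_restrict_space)
    have "?Q \<in> borel_measurable \<mu>"
      using borel_measurable_continuous_on_restrict[OF c] measurable_cong_sets[OF \<mu>(2) refl] by blast
    then have "integrable \<mu> ?Q"
      by (intro integrable_const_bound[of _ B]) (use B(2) space in auto)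
    then show ?thesis by (rule integral_le_const) (use B(2) space in \<open>auto intro!: AE_I2 dest: abs_le_D1\<close>)
  qed
  then have "bdd_above ((\<lambda>\<nu>. \<integral>p. ?Q p \<partial>\<nu>) ` invariant_measures \<sigma> f M)" by (intro bdd_aboveI2)
  then show ?thesis unfolding upper_lyapunov_def by (rule cSUP_upper[OF \<nu>])
qed

lemma coercive_dissipative:
  fixes a b :: "'w::metric_space \<Rightarrow> real" and g :: "'w \<Rightarrow> real \<Rightarrow> real"
  assumes W: "compact W" and a: "continuous_on W a" and b: "continuous_on W b"
    and top: "\<And>K. \<forall>\<^sub>F x in at_top. \<forall>w\<in>W. g w x / x < K"
    and bot: "\<And>K. \<forall>\<^sub>F x in at_bot. \<forall>w\<in>W. g w x / x < K"
  obtains R0 where "0 < R0" "\<And>w x. w \<in> W \<Longrightarrow> R0 \<le> x \<Longrightarrow> equation_rhs a b g w x < 0"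
    "\<And>w x. w \<in> W \<Longrightarrow> x \<le> - R0 \<Longrightarrow> 0 < equation_rhs a b g w x"
proof -
  obtain A where A: "0 < A" "\<And>w. w \<in> W \<Longrightarrow> \<bar>a w\<bar> \<le> A" by (rule continuous_on_compact_bounded[OF W a]) (rule that)
  obtain B where B: "0 < B" "\<And>w. w \<in> W \<Longrightarrow> \<bar>b w\<bar> \<le> B" by (rule continuous_on_compact_bounded[OF W b]) (rule that)
  define K where "K = - (A + B)"
  obtain N1 where N1: "\<And>x w. x \<ge> N1 \<Longrightarrow> w \<in> W \<Longrightarrow> g w x / x < K"
    using top[of K] unfolding eventually_at_top_linorder by blast
  obtain N2 where N2: "\<And>x w. x \<le> N2 \<Longrightarrow> w \<in> W \<Longrightarrow> g w x / x < K"
    using bot[of K] unfolding eventually_at_bot_linorder by blast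
  define R0 where "R0 = max 1 (max N1 (- N2))"
  show ?thesis
  proof (rule that[of R0])
    show "0 < R0" by (simp add: R0_def)
    fix w x assume w: "w \<in> W"
    have aA: "a w \<le> A" "- A \<le> a w" "b w \<le> B" "- B \<le> b w" using A(2)[OF w] B(2)[OF w] by linarith+
    show "equation_rhs a b g w x < 0" if "R0 \<le> x"
    proof -
      have x: "1 \<le> x" "N1 \<le> x" using that by (simp_all add: R0_def)
      then have "g w x < K * x" using N1[OF x(2) w] by (simp add: pos_divide_less_eq)
      moreover have "a w * x \<le> A * x" using aA x by (intro mult_right_mono) auto
      moreover have "B * 1 \<le> B * x" using x B(1) by (intro mult_left_mono) auto
      then have "b w \<le> B * x" using aA by linarith
      ultimately show ?thesis by (simp add: equation_rhs_def K_def algebra_simps)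
    qed
    show "0 < equation_rhs a b g w x" if "x \<le> - R0"
    proof -
      have x: "x \<le> - 1" "x \<le> N2" using that by (simp_all add: R0_def)
      then have "K * x < g w x" using N2[OF x(2) w] by (simp add: neg_divide_less_eq)
      moreover have "A * x \<le> a w * x" using aA x by (intro mult_right_mono_neg) auto
      moreover have "B * x \<le> B * (- 1)" using x B(1) by (intro mult_left_mono) auto
      then have "B * x \<le> b w" using aA by linarith
      ultimately show ?thesis by (simp add: equation_rhs_def K_def algebra_simps)
    qed
  qed
qed

theorem theorem3p4:
  fixes W :: "'w::metric_space set"
    and \<sigma> :: "real \<Rightarrow> 'w \<Rightarrow> 'w"
    and a b :: "'w \<Rightarrow> real"
    and g gx :: "'w \<Rightarrow> real \<Rightarrow> real"
  assumes "compact W"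
    and "continuous_flow W \<sigma>"
    and "minimal_flow W \<sigma>"
    and "continuous_on W a"
    and "continuous_on W b"
    and "\<And>w x. w \<in> W \<Longrightarrow> (g w has_real_derivative gx w x) (at x)"
    and "continuous_on (W \<times> UNIV) (\<lambda>(w, x). g w x)"
    and "continuous_on (W \<times> UNIV) (\<lambda>(w, x). gx w x)"
    and "\<And>K. \<forall>\<^sub>F x in at_top. \<forall>w\<in>W. g w x / x < K"
    and "\<And>K. \<forall>\<^sub>F x in at_bot. \<forall>w\<in>W. g w x / x < K"
  shows "let f = equation_rhs a b g;
             all_negative = (\<forall>M. skew_minimal W \<sigma> f M \<longrightarrow> upper_lyapunov \<sigma> f a gx M < 0);
             unique_negative = (\<exists>M. skew_minimal W \<sigma> f M \<and>
               (\<forall>N. skew_minimal W \<sigma> f N \<longrightarrow> N = M) \<and> upper_lyapunov \<sigma> f a gx M < 0)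
         in (all_negative \<longleftrightarrow> unique_negative) \<and>
            (all_negative \<longrightarrow>
              (\<exists>A \<alpha> \<beta>. attractor_with_bounds W \<sigma> f A \<alpha> \<beta>) \<and>
              (\<forall>A \<alpha> \<beta>. attractor_with_bounds W \<sigma> f A \<alpha> \<beta> \<longrightarrow>
                 skew_minimal W \<sigma> f A \<and> (\<forall>N. skew_minimal W \<sigma> f N \<longrightarrow> N = A) \<and>
                 (\<forall>w0\<in>common_continuity_points W \<alpha> \<beta>.
                    orbit_closure \<sigma> \<alpha> w0 = A \<and> orbit_closure \<sigma> \<beta> w0 = A) \<and>
                 continuous_on W \<alpha> \<and> continuous_on W \<beta> \<and>
                 equilibrium W \<sigma> f \<alpha> \<and> equilibrium W \<sigma> f \<beta> \<and>
                 A = graph_over W \<alpha> \<and> A = graph_over W \<beta> \<and>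
                 attracts_exponentially W \<sigma> f \<alpha>))"
proof -
  define f where "f = equation_rhs a b g"
  define q where "q w x = a w + gx w x" for w x
  define all_negative where "all_negative \<longleftrightarrow> (\<forall>M. skew_minimal W \<sigma> f M \<longrightarrow> upper_lyapunov \<sigma> f a gx M < 0)"
  obtain R0 where R0: "0 < R0" "\<And>w x. w \<in> W \<Longrightarrow> R0 \<le> x \<Longrightarrow> f w x < 0"
    "\<And>w x. w \<in> W \<Longrightarrow> x \<le> - R0 \<Longrightarrow> 0 < f w x"
    by (rule coercive_dissipative[OF assms(1,4,5,9,10), folded f_def]) (rule that)
  have ca: "continuous_on (W \<times> (UNIV :: real set)) (\<lambda>p. a (fst p))"
    and cb: "continuous_on (W \<times> (UNIV :: real set)) (\<lambda>p. b (fst p))"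
    by (rule continuous_on_compose2[OF assms(4)] continuous_on_compose2[OF assms(5)], auto intro!: continuous_intros)+
  have qc: "continuous_on (W \<times> UNIV) (\<lambda>(w, x). q w x)"
    using ca assms(8) by (simp add: q_def case_prod_unfold continuous_on_add)
  have fc: "continuous_on (W \<times> UNIV) (\<lambda>(w, x). f w x)"
    using ca cb assms(7) by (simp add: f_def equation_rhs_def case_prod_unfold) (intro continuous_intros; simp)
  have fd: "(f w has_real_derivative q w x) (at x)" if "w \<in> W" for w x
    unfolding f_def equation_rhs_def[abs_def] q_def
    by (auto intro!: derivative_eq_intros assms(6)[OF that])
  interpret dissipative_family W \<sigma> f q R0
    by (unfold_locales; rule assms(1) assms(2) assms(3) fd fc qc R0; assumption)
  have graph: "\<exists>h. continuous_on W h \<and> skew_minimal W \<sigma> f (graph_over W h) \<and>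
      (\<forall>N. skew_minimal W \<sigma> f N \<longrightarrow> N = graph_over W h) \<and>
      (\<forall>w\<in>W. orbit_closure \<sigma> h w = graph_over W h) \<and>
      (\<forall>r. attracts_strip W \<sigma> f h r)"
    if neg: all_negative
  proof -
    have "\<exists>\<gamma><0. \<forall>\<nu>\<in>invariant_measures \<sigma> f M. (\<integral>(w, x). q w x \<partial>\<nu>) \<le> \<gamma>"
      if M: "skew_minimal W \<sigma> f M" for M
    proof (intro exI conjI ballI)
      show "upper_lyapunov \<sigma> f a gx M < 0" using neg M unfolding all_negative_def by blast
      have "M \<subseteq> W \<times> UNIV" "compact M" using M unfolding skew_minimal_def skew_invariant_def by blast+
      then show "(\<integral>(w, x). q w x \<partial>\<nu>) \<le> upper_lyapunov \<sigma> f a gx M" if "\<nu> \<in> invariant_measures \<sigma> f M" for \<nu>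
        using integral_le_upper_lyapunov[OF _ continuous_on_subset[OF qc[unfolded q_def]] that] unfolding q_def by blast
    qed
    note bound = this
    obtain h where h: "continuous_on W h" "skew_minimal W \<sigma> f (graph_over W h)"
      "\<And>N. skew_minimal W \<sigma> f N \<Longrightarrow> N = graph_over W h"
      "\<And>w. w \<in> W \<Longrightarrow> orbit_closure \<sigma> h w = graph_over W h"
      "\<And>r. attracts_strip W \<sigma> f h r"
      by (rule uniform_exponential_attraction) (erule bound, rule that)
    then show ?thesis by (intro exI[of _ h] conjI allI impI ballI)
  qed
  have equivalence: "all_negative \<longleftrightarrow> (\<exists>M. skew_minimal W \<sigma> f M \<and>
      (\<forall>N. skew_minimal W \<sigma> f N \<longrightarrow> N = M) \<and> upper_lyapunov \<sigma> f a gx M < 0)"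
  proof
    assume neg: all_negative
    obtain h where h: "skew_minimal W \<sigma> f (graph_over W h)"
      and uniq: "\<forall>N. skew_minimal W \<sigma> f N \<longrightarrow> N = graph_over W h"
      using graph[OF neg] by (elim exE conjE) (rule that)
    have "upper_lyapunov \<sigma> f a gx (graph_over W h) < 0" using neg h unfolding all_negative_def by simp
    then show "\<exists>M. skew_minimal W \<sigma> f M \<and> (\<forall>N. skew_minimal W \<sigma> f N \<longrightarrow> N = M) \<and> upper_lyapunov \<sigma> f a gx M < 0"
      using h uniq by (intro exI[of _ "graph_over W h"] conjI)
  next
    assume "\<exists>M. skew_minimal W \<sigma> f M \<and> (\<forall>N. skew_minimal W \<sigma> f N \<longrightarrow> N = M) \<and> upper_lyapunov \<sigma> f a gx M < 0"
    then obtain M where M: "\<forall>N. skew_minimal W \<sigma> f N \<longrightarrow> N = M" "upper_lyapunov \<sigma> f a gx M < 0"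
      by (elim exE conjE) (rule that)
    show all_negative
      unfolding all_negative_def
    proof (intro allI impI)
      fix N assume "skew_minimal W \<sigma> f N"
      then have "N = M" using M(1) by simp
      then show "upper_lyapunov \<sigma> f a gx N < 0" using M(2) by simp
    qed
  qed
  have conclusion: "(\<exists>A \<alpha> \<beta>. attractor_with_bounds W \<sigma> f A \<alpha> \<beta>) \<and>
      (\<forall>A \<alpha> \<beta>. attractor_with_bounds W \<sigma> f A \<alpha> \<beta> \<longrightarrow>
         skew_minimal W \<sigma> f A \<and> (\<forall>N. skew_minimal W \<sigma> f N \<longrightarrow> N = A) \<and>
         (\<forall>w0\<in>common_continuity_points W \<alpha> \<beta>.
            orbit_closure \<sigma> \<alpha> w0 = A \<and> orbit_closure \<sigma> \<beta> w0 = A) \<and>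
         continuous_on W \<alpha> \<and> continuous_on W \<beta> \<and>
         equilibrium W \<sigma> f \<alpha> \<and> equilibrium W \<sigma> f \<beta> \<and>
         A = graph_over W \<alpha> \<and> A = graph_over W \<beta> \<and>
         attracts_exponentially W \<sigma> f \<alpha>)" if neg: all_negative
  proof -
    obtain h where h: "continuous_on W h" "skew_minimal W \<sigma> f (graph_over W h)"
      "\<forall>N. skew_minimal W \<sigma> f N \<longrightarrow> N = graph_over W h"
      and closure: "\<forall>w\<in>W. orbit_closure \<sigma> h w = graph_over W h"
      and rate': "\<forall>r. attracts_strip W \<sigma> f h r"
      using graph[OF neg] by (elim exE conjE) (rule that)
    have rate: "attracts_strip W \<sigma> f h r" for r using rate' by simp
    have attractor: "attractor_with_bounds W \<sigma> f (graph_over W h) h h"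
      unfolding attractor_with_bounds_def
    proof (intro conjI)
      show "global_attractor W \<sigma> f (graph_over W h)"
        by (rule uniform_attraction_global_attractor[OF h(2) base_closed rate])
      show "graph_over W h = (\<Union>w\<in>W. {w} \<times> {h w..h w})" unfolding graph_over_def by fastforce
    qed simp
    have every: "skew_minimal W \<sigma> f A \<and> (\<forall>N. skew_minimal W \<sigma> f N \<longrightarrow> N = A) \<and>
         (\<forall>w0\<in>common_continuity_points W \<alpha> \<beta>.
            orbit_closure \<sigma> \<alpha> w0 = A \<and> orbit_closure \<sigma> \<beta> w0 = A) \<and>
         continuous_on W \<alpha> \<and> continuous_on W \<beta> \<and>
         equilibrium W \<sigma> f \<alpha> \<and> equilibrium W \<sigma> f \<beta> \<and>
         A = graph_over W \<alpha> \<and> A = graph_over W \<beta> \<and>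
         attracts_exponentially W \<sigma> f \<alpha>"
      if A: "attractor_with_bounds W \<sigma> f A \<alpha> \<beta>" for A \<alpha> \<beta>
    proof -
      have Ac: "compact A" "skew_invariant W \<sigma> f A"
        and \<alpha>\<beta>: "\<And>w. w \<in> W \<Longrightarrow> \<alpha> w \<le> \<beta> w" and Aeq: "A = (\<Union>w\<in>W. {w} \<times> {\<alpha> w..\<beta> w})"
        using A unfolding attractor_with_bounds_def global_attractor_def by blast+
      have on_graph: "x = h w" if "(w, x) \<in> A" for w x
        by (rule compact_invariant_subset_attracting_graph[OF Ac rate that])
      have eq: "\<alpha> w = h w" "\<beta> w = h w" if "w \<in> W" for w
      proof -
        have "(w, \<alpha> w) \<in> A" "(w, \<beta> w) \<in> A" unfolding Aeq using \<alpha>\<beta>[OF that] that by simp_all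
        then show "\<alpha> w = h w" "\<beta> w = h w" using on_graph by blast+
      qed
      have A\<alpha>: "A = graph_over W h" unfolding Aeq graph_over_def using eq by auto
      have gr: "graph_over W \<alpha> = graph_over W h" "graph_over W \<beta> = graph_over W h"
        by (rule graph_over_cong, rule eq, assumption)+
      have cont: "continuous_on W \<alpha>" "continuous_on W \<beta>"
        using h(1) eq by (simp_all cong: continuous_on_cong)
      have oc: "orbit_closure \<sigma> \<alpha> w = A" "orbit_closure \<sigma> \<beta> w = A" if "w \<in> W" for w
        using bspec[OF closure that] eq base_closed[OF that] A\<alpha> by (simp_all add: orbit_closure_def)
      have eqs: "equilibrium W \<sigma> f \<alpha>" "equilibrium W \<sigma> f \<beta>"
        by (rule minimal_graph_equilibrium, simp add: gr h(2))+
      have "attracts_exponentially W \<sigma> f \<alpha>"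
        unfolding attracts_exponentially_def
      proof (intro ballI allI)
        fix w x0 assume w: "w \<in> W"
        obtain C \<kappa> where C: "0 < C" "0 < \<kappa>" "\<And>t. 0 \<le> t \<Longrightarrow> t \<in> sol_dom \<sigma> f w x0"
          "\<And>t. 0 \<le> t \<Longrightarrow> \<bar>sol \<sigma> f t w x0 - h (\<sigma> t w)\<bar> \<le> C * exp (- \<kappa> * t)"
          by (rule attracts_stripE[OF rate[of "\<bar>x0\<bar>"]]) (use w in \<open>auto intro: that\<close>)
        then show "\<exists>C>0. \<exists>\<gamma>>0. \<forall>t\<ge>0. t \<in> sol_dom \<sigma> f w x0 \<and>
            \<bar>sol \<sigma> f t w x0 - \<alpha> (\<sigma> t w)\<bar> \<le> C * exp (- \<gamma> * t)"
          unfolding eq(1)[OF base_closed[OF w]] by blast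
      qed
      moreover have "\<forall>w0\<in>common_continuity_points W \<alpha> \<beta>. orbit_closure \<sigma> \<alpha> w0 = A \<and> orbit_closure \<sigma> \<beta> w0 = A"
      proof
        fix w0 assume "w0 \<in> common_continuity_points W \<alpha> \<beta>"
        then have "w0 \<in> W" by (simp add: common_continuity_points_def)
        then show "orbit_closure \<sigma> \<alpha> w0 = A \<and> orbit_closure \<sigma> \<beta> w0 = A" using oc by blast
      qed
      moreover have "skew_minimal W \<sigma> f A" "\<forall>N. skew_minimal W \<sigma> f N \<longrightarrow> N = A"
        unfolding A\<alpha> by (rule h)+
      moreover have "A = graph_over W \<alpha>" "A = graph_over W \<beta>" unfolding gr by (rule A\<alpha>)+
      ultimately show ?thesis using cont eqs by (intro conjI)
    qed
    show ?thesis
      by (rule conjI, (rule exI)+, rule attractor, (rule allI)+, rule impI, erule every)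
  qed
  show ?thesis
    unfolding Let_def f_def[symmetric] all_negative_def[symmetric]
    by (rule conjI[OF equivalence], rule impI, erule conclusion)
qed

end
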